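(* Consider a four dimensional Ricci-flat $T^2$-symmetric nonGowdy metric $g$ with metric functions $\eta, U, a, A, G, H$ of $(R,\theta)\in(0,R_0]\times S^1$, as described in the context. Put $R = e^{-\tau}$ and $R_0 = e^{-\tau_0}$. If $\int_{S^1} H\, d\theta$ is bounded below as $\tau\to\infty$, and $$\int_{\tau_0}^\infty e^{2\tau}\, \left\| e^{4U} a^2 A_\theta^2 \right\|_{H^{-1}_\tau}^2\, d\tau < \infty ,$$ then $$\int_{\tau_0}^\infty e^{2\tau}\, \left\| a(a^{-1}U_\tau)_\tau - \tfrac12 e^{2\tau} e^{4U} A_\tau^2 \right\|_{H^{-1}_\tau}^2\, d\tau < \infty .$$
   Context: Setting. The spacetime is four dimensional with a free spatial isometric $T^2$-action; $x^1,x^2$ are linear coordinates along the $T^2$-orbits and $(R,\theta)\in(0,R_0]\times S^1$ are coordinates on the quotient. The smooth Lorentzian metric is $$g = e^{2(\eta-U)}(-dR^2 + a^{-2}d\theta^2) + e^{2U}\big(dx^1 + A\,dx^2 + (G+AH)\,d\theta\big)^2 + e^{-2U}R^2 (dx^2 + H\,d\theta)^2,$$ where $\eta, U, a, A, G, H$ are smooth functions of $(R,\theta)$ with $a>0$. The metric $g$ is Ricci-flat. Let $G_{IJ}$ ($I,J\in\{1,2\}$) be the inner product matrix $\begin{pmatrix} e^{2U} & e^{2U}A\\ e^{2U}A & e^{2U}A^2 + e^{-2U}R^2\end{pmatrix}$, with determinant $R^2$, and let $F^1_{R\theta} = \partial_R G$, $F^2_{R\theta} = \partial_R H$ be the curvature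 components of the connection $(G\,d\theta, H\,d\theta)$. The twist quantities $C_I = e^{-2(\eta-U)}\, a\, R\, \sum_K G_{IK}F^K_{R\theta}$ are constant by the vacuum equations; the spacetime being nonGowdy, they are not both zero, and the coordinates $x^1,x^2$ are chosen so that $C_1 = 0$ and $C_2 = K$ with $K>0$ a constant. Norm. For $\sigma\in L^2(S^1; a^{-1}d\theta)$ on the time-$\tau$ slice, $$\|\sigma\|_{H^{-1}_\tau} = \sup_{\widehat\sigma\neq0} \frac{\int_{S^1}\sigma\widehat\sigma\, a^{-1}d\theta}{\sqrt{\int_{S^1}(\widehat\sigma^2 + a^2\widehat\sigma_\theta^2)\, a^{-1}d\theta}},$$ where $\widehat\sigma$ ranges over smooth functions on $S^1$ and $a = a(\tau,\cdot)$. Subscripts $\tau,\theta$ denote partial derivatives. *)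

theory Defs
  imports "HOL-Analysis.Analysis"
begin

text \<open>
  Angles are lifted to the universal cover: \<open>S\<^sup>1 = \<real> / 2\<pi>\<int>\<close>, and a function on \<open>S\<^sup>1\<close> is a
  \<open>2\<pi>\<close>-periodic function on \<open>\<real>\<close>.  Likewise the \<open>T\<^sup>2\<close>-orbits are lifted to their linear coordinates
  \<open>(x\<^sup>1, x\<^sup>2)\<close>; the metric coefficients do not depend on these and Ricci-flatness is local.
\<close>

section \<open>Partial derivatives and smoothness\<close>

text \<open>
  Derivatives are taken within the domain \<open>D\<close>.  The domains used below are open sets or closed on
  one side by a coordinate hyperplane, so the derivative within \<open>D\<close> is unique; at boundary points it
  is the one-sided derivative.
\<close>

definition pd :: "'a::euclidean_space set \<Rightarrow> 'a \<Rightarrow> ('a \<Rightarrow> real) \<Rightarrow> 'a \<Rightarrow> real" where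
  "pd D b f x = frechet_derivative f (at x within D) b"

primrec Ck_on :: "nat \<Rightarrow> 'a::euclidean_space set \<Rightarrow> ('a \<Rightarrow> real) \<Rightarrow> bool" where
  "Ck_on 0 D f \<longleftrightarrow> continuous_on D f"
| "Ck_on (Suc k) D f \<longleftrightarrow> f differentiable_on D \<and> (\<forall>b\<in>Basis. Ck_on k D (pd D b f))"

definition smooth_on :: "'a::euclidean_space set \<Rightarrow> ('a \<Rightarrow> real) \<Rightarrow> bool" where
  "smooth_on D f \<longleftrightarrow> (\<forall>k. Ck_on k D f)"

section \<open>Ricci curvature in coordinates\<close>

definition christoffel ::
    "(real^'n) set \<Rightarrow> (real^'n \<Rightarrow> real^'n^'n) \<Rightarrow> 'n \<Rightarrow> 'n \<Rightarrow> 'n \<Rightarrow> real^'n \<Rightarrow> real" where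
  "christoffel D g k i j x =
     1/2 * (\<Sum>l\<in>UNIV. matrix_inv (g x) $ k $ l *
       (pd D (axis i 1) (\<lambda>y. g y $ j $ l) x + pd D (axis j 1) (\<lambda>y. g y $ i $ l) x
        - pd D (axis l 1) (\<lambda>y. g y $ i $ j) x))"

definition ricci ::
    "(real^'n) set \<Rightarrow> (real^'n \<Rightarrow> real^'n^'n) \<Rightarrow> 'n \<Rightarrow> 'n \<Rightarrow> real^'n \<Rightarrow> real" where
  "ricci D g i j x =
     (\<Sum>k\<in>UNIV. pd D (axis k 1) (christoffel D g k i j) x
                - pd D (axis j 1) (christoffel D g k i k) x)
   + (\<Sum>k\<in>UNIV. \<Sum>l\<in>UNIV.
        christoffel D g k k l x * christoffel D g l i j x
      - christoffel D g k j l x * christoffel D g l i k x)"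

definition ricci_flat_on :: "(real^'n) set \<Rightarrow> (real^'n \<Rightarrow> real^'n^'n) \<Rightarrow> bool" where
  "ricci_flat_on D g \<longleftrightarrow> (\<forall>x\<in>D. \<forall>i j. ricci D g i j x = 0)"

section \<open>\<open>T\<^sup>2\<close>-symmetric metrics\<close>

text \<open>The metric functions are functions of the pair \<open>(R, \<theta>)\<close>.\<close>

definition quot_dom :: "real \<Rightarrow> (real \<times> real) set" where
  "quot_dom R0 = {0<..R0} \<times> UNIV"

definition smooth_periodic :: "real \<Rightarrow> (real \<times> real \<Rightarrow> real) \<Rightarrow> bool" where
  "smooth_periodic R0 f \<longleftrightarrow>
     smooth_on (quot_dom R0) f \<and> (\<forall>R\<in>{0<..R0}. \<forall>\<theta>. f (R, \<theta> + 2 * pi) = f (R, \<theta>))"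

definition total_dom :: "real \<Rightarrow> (real^4) set" where
  "total_dom R0 = {p. 0 < p $ 1 \<and> p $ 1 \<le> R0}"

text \<open>
  Coordinates on the spacetime are \<open>p = (R, \<theta>, x\<^sup>1, x\<^sup>2)\<close>, with indices \<open>1, 2, 3, 4\<close> in this order.
  The form below is the metric evaluated on two tangent vectors \<open>v, w\<close>.
\<close>

definition t2_metric_form ::
    "(real \<times> real \<Rightarrow> real) \<Rightarrow> (real \<times> real \<Rightarrow> real) \<Rightarrow> (real \<times> real \<Rightarrow> real) \<Rightarrow>
     (real \<times> real \<Rightarrow> real) \<Rightarrow> (real \<times> real \<Rightarrow> real) \<Rightarrow> (real \<times> real \<Rightarrow> real) \<Rightarrow>
     real^4 \<Rightarrow> real^4 \<Rightarrow> real^4 \<Rightarrow> real" where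
  "t2_metric_form \<eta> U a A G H p v w =
     (let R = p $ 1; q = (p $ 1, p $ 2);
          \<alpha> = (\<lambda>u. u $ 3 + A q * u $ 4 + (G q + A q * H q) * u $ 2);
          \<beta> = (\<lambda>u. u $ 4 + H q * u $ 2)
      in exp (2 * (\<eta> q - U q)) * (- (v $ 1 * w $ 1) + inverse ((a q)\<^sup>2) * (v $ 2 * w $ 2))
         + exp (2 * U q) * (\<alpha> v * \<alpha> w)
         + exp (- 2 * U q) * R\<^sup>2 * (\<beta> v * \<beta> w))"

definition t2_metric ::
    "(real \<times> real \<Rightarrow> real) \<Rightarrow> (real \<times> real \<Rightarrow> real) \<Rightarrow> (real \<times> real \<Rightarrow> real) \<Rightarrow>
     (real \<times> real \<Rightarrow> real) \<Rightarrow> (real \<times> real \<Rightarrow> real) \<Rightarrow> (real \<times> real \<Rightarrow> real) \<Rightarrow>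
     real^4 \<Rightarrow> real^4^4" where
  "t2_metric \<eta> U a A G H p =
     (\<chi> i j. t2_metric_form \<eta> U a A G H p (axis i 1) (axis j 1))"

definition orbit_metric ::
    "(real \<times> real \<Rightarrow> real) \<Rightarrow> (real \<times> real \<Rightarrow> real) \<Rightarrow> real \<times> real \<Rightarrow> real^2^2" where
  "orbit_metric U A q =
     vector [vector [exp (2 * U q),       exp (2 * U q) * A q],
             vector [exp (2 * U q) * A q, exp (2 * U q) * (A q)\<^sup>2 + exp (- 2 * U q) * (fst q)\<^sup>2]]"

definition curvature_R\<theta> ::
    "real \<Rightarrow> (real \<times> real \<Rightarrow> real) \<Rightarrow> (real \<times> real \<Rightarrow> real) \<Rightarrow> real \<times> real \<Rightarrow> real^2" where
  "curvature_R\<theta> R0 G H q = vector [pd (quot_dom R0) (1, 0) G q, pd (quot_dom R0) (1, 0) H q]"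

definition twist ::
    "real \<Rightarrow> (real \<times> real \<Rightarrow> real) \<Rightarrow> (real \<times> real \<Rightarrow> real) \<Rightarrow> (real \<times> real \<Rightarrow> real) \<Rightarrow>
     (real \<times> real \<Rightarrow> real) \<Rightarrow> (real \<times> real \<Rightarrow> real) \<Rightarrow> (real \<times> real \<Rightarrow> real) \<Rightarrow>
     real \<times> real \<Rightarrow> real^2" where
  "twist R0 \<eta> U a A G H q =
     (exp (- 2 * (\<eta> q - U q)) * a q * fst q) *\<^sub>R (orbit_metric U A q *v curvature_R\<theta> R0 G H q)"

section \<open>The time variable \<open>\<tau> = - ln R\<close>\<close>

definition in_tau :: "(real \<times> real \<Rightarrow> real) \<Rightarrow> real \<times> real \<Rightarrow> real" where
  "in_tau f = (\<lambda>(\<tau>, \<theta>). f (exp (- \<tau>), \<theta>))"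

definition d_tau :: "real \<Rightarrow> (real \<times> real \<Rightarrow> real) \<Rightarrow> real \<times> real \<Rightarrow> real" where
  "d_tau \<tau>0 f = pd ({\<tau>0..} \<times> UNIV) (1, 0) f"

definition d_theta :: "real \<Rightarrow> (real \<times> real \<Rightarrow> real) \<Rightarrow> real \<times> real \<Rightarrow> real" where
  "d_theta \<tau>0 f = pd ({\<tau>0..} \<times> UNIV) (0, 1) f"

section \<open>The \<open>H\<^sup>-\<^sup>1\<close> norm on a time slice\<close>

text \<open>
  Here \<open>a\<close> and \<open>\<sigma>\<close> are the restrictions to the slice.  The supremum is taken in the extended
  nonnegative reals, so that it is never a junk value.  Since the quotient is odd in the test
  function, sending negative quotients to \<open>0\<close> does not change the supremum.
\<close>

definition test_functions :: "(real \<Rightarrow> real) set" where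
  "test_functions = {s. smooth_on UNIV s \<and> (\<forall>\<theta>. s (\<theta> + 2 * pi) = s \<theta>) \<and> s \<noteq> (\<lambda>\<theta>. 0)}"

definition Hm1_norm :: "(real \<Rightarrow> real) \<Rightarrow> (real \<Rightarrow> real) \<Rightarrow> ennreal" where
  "Hm1_norm a \<sigma> =
     (SUP s\<in>test_functions.
        ennreal ((LINT \<theta>:{0..2*pi}|lborel. \<sigma> \<theta> * s \<theta> * inverse (a \<theta>))
               / sqrt (LINT \<theta>:{0..2*pi}|lborel. ((s \<theta>)\<^sup>2 + (a \<theta>)\<^sup>2 * (deriv s \<theta>)\<^sup>2) * inverse (a \<theta>))))"

end

theory Submission
  imports Defs
begin

text \<open>
  Where \<open>A\<close>, \<open>G\<close>, \<open>H\<close> vanish the metric is diagonal, and a linear shear of \<open>\<theta>, x\<^sup>1, x\<^sup>2\<close> with constant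
  coefficients arranges this at any given point.  Evaluating the Ricci tensor there gives wave
  equations for \<open>U\<close> and \<open>A\<close>, the equation \<open>a\<^sub>R / a = - K\<^sup>2 e\<^bsup>2\<eta>\<^esup> / (2 R\<^sup>3)\<close>, and the constraint for \<open>\<eta>\<^sub>R\<close>.

  Because of the twist the wave-map energy of \<open>(2 U - ln R, A)\<close> is not monotone, but the error
  cancels after adding \<open>\<integral> K\<^sup>2 e\<^bsup>2\<eta>\<^esup> / (4 a R\<^sup>2) d\<theta> + (3 K / 8) \<integral> H d\<theta>\<close>, where \<open>H\<^sub>R = K e\<^bsup>2\<eta>\<^esup> / (a R\<^sup>3)\<close>.  The lower
  bound on \<open>\<integral> H d\<theta>\<close> bounds this modified energy from below, so its total dissipation is finite,
  and hence \<open>\<integral> e\<^bsup>-2\<tau>\<^esup> \<integral> a U\<^sub>\<theta>\<^sup>2 d\<theta> d\<tau> < \<infinity>\<close>.  Finally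
  \<open>a (a\<^sup>-\<^sup>1 U\<^sub>\<tau>)\<^sub>\<tau> - e\<^bsup>2\<tau>\<^esup> e\<^bsup>4U\<^esup> A\<^sub>\<tau>\<^sup>2 / 2 = e\<^bsup>-2\<tau>\<^esup> a (a U\<^sub>\<theta>)\<^sub>\<theta> - e\<^bsup>4U\<^esup> a\<^sup>2 A\<^sub>\<theta>\<^sup>2 / 2\<close>, and the first term on the right is a
  divergence, with \<open>H\<^sup>-\<^sup>1\<close> norm at most \<open>e\<^bsup>-2\<tau>\<^esup> (\<integral> a U\<^sub>\<theta>\<^sup>2 d\<theta>)\<^bsup>1/2\<^esup>\<close>.
\<close>

section \<open>Covariance of the Ricci tensor on metric jets\<close>

text \<open>The Ricci tensor is an algebraic function of the 2-jet of the metric. The arrays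
  \<open>h\<close>, \<open>dg\<close>, \<open>ddg\<close> isolate that function, so the shear can be
  frozen at one point: no derivative of the shear ever enters, and the off-diagonal entries vanish
  there while their derivatives stay free.

  Divided by \<open>R\<close>, the orbit metric has determinant one and reads
  \<open>e^P (dx^1 + A dx^2)^2 + e^(- P) (dx^2)^2\<close> with \<open>P = 2 U - ln R\<close>. This
  gives a map into the hyperbolic plane \<open>dP^2 + e^(2 P) dA^2\<close>, which is why
  \<open>P\<close> and not \<open>U\<close> carries the energy. The function \<open>ln R\<close>
  solves the wave equation only when \<open>a\<close> does not depend on \<open>R\<close>; so the
  twist, through \<open>a_R\<close>, both rescales the energy and puts a source into the equation
  for \<open>P\<close>. These are the errors that the added terms must cancel.

  One further obstacle comes from measure theory: the dual norm is a supremum over uncountably many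
  test functions, and its measurability in \<tau> is needed before integrals can be added.\<close>

definition lowered :: "('n \<Rightarrow> 'n \<Rightarrow> 'n \<Rightarrow> real) \<Rightarrow> 'n \<Rightarrow> 'n \<Rightarrow> 'n \<Rightarrow> real" where
  "lowered dg l i j = 1/2 * (dg i j l + dg j i l - dg l i j)"

text \<open>Here \<open>h\<close> plays the inverse metric and \<open>dg m i j\<close> the
  derivative of \<open>g_ij\<close> in direction \<open>m\<close>, as independent arrays;
  \<open>lowered\<close> gives the Christoffel symbols of the first kind.\<close>

definition chr_jet ::
    "('n::finite \<Rightarrow> 'n \<Rightarrow> real) \<Rightarrow> ('n \<Rightarrow> 'n \<Rightarrow> 'n \<Rightarrow> real) \<Rightarrow> 'n \<Rightarrow> 'n \<Rightarrow> 'n \<Rightarrow> real" where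
  "chr_jet h dg k i j = (\<Sum>l\<in>UNIV. h k l * lowered dg l i j)"

text \<open>The derivative of the inverse metric \<open>h\<close> enters through \<open>\<partial>h = - h (\<partial>g) h\<close>.\<close>

definition dchr_jet ::
    "('n::finite \<Rightarrow> 'n \<Rightarrow> real) \<Rightarrow> ('n \<Rightarrow> 'n \<Rightarrow> 'n \<Rightarrow> real) \<Rightarrow> ('n \<Rightarrow> 'n \<Rightarrow> 'n \<Rightarrow> 'n \<Rightarrow> real)
      \<Rightarrow> 'n \<Rightarrow> 'n \<Rightarrow> 'n \<Rightarrow> 'n \<Rightarrow> real" where
  "dchr_jet h dg ddg m k i j =
     (\<Sum>l\<in>UNIV. h k l * (lowered (ddg m) l i j - (\<Sum>b\<in>UNIV. dg m l b * chr_jet h dg b i j)))"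

definition ricci_of ::
    "('n::finite \<Rightarrow> 'n \<Rightarrow> 'n \<Rightarrow> real) \<Rightarrow> ('n \<Rightarrow> 'n \<Rightarrow> 'n \<Rightarrow> 'n \<Rightarrow> real) \<Rightarrow> 'n \<Rightarrow> 'n \<Rightarrow> real" where
  "ricci_of C dC i j = (\<Sum>k\<in>UNIV. dC k k i j - dC j k i k)
     + (\<Sum>k\<in>UNIV. \<Sum>l\<in>UNIV. C k k l * C l i j - C k j l * C l i k)"

definition ricci_jet ::
    "('n::finite \<Rightarrow> 'n \<Rightarrow> real) \<Rightarrow> ('n \<Rightarrow> 'n \<Rightarrow> 'n \<Rightarrow> real) \<Rightarrow> ('n \<Rightarrow> 'n \<Rightarrow> 'n \<Rightarrow> 'n \<Rightarrow> real)
      \<Rightarrow> 'n \<Rightarrow> 'n \<Rightarrow> real" where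
  "ricci_jet h dg ddg = ricci_of (chr_jet h dg) (dchr_jet h dg ddg)"

text \<open>Change of frame on one index: \<open>up\<close> for a contravariant slot,
  \<open>dn\<close> for a covariant one. Tensors of higher rank are transformed by nesting, which
  reduces covariance to linearity, reordering of the nested operators, and contraction.\<close>

definition up :: "('n::finite \<Rightarrow> 'n \<Rightarrow> real) \<Rightarrow> ('n \<Rightarrow> real) \<Rightarrow> 'n \<Rightarrow> real" where
  "up M X k = (\<Sum>c\<in>UNIV. M k c * X c)"

definition dn :: "('n::finite \<Rightarrow> 'n \<Rightarrow> real) \<Rightarrow> ('n \<Rightarrow> real) \<Rightarrow> 'n \<Rightarrow> real" where
  "dn L Y i = (\<Sum>a\<in>UNIV. L a i * Y a)"

lemma dn_add: "dn L (\<lambda>a. X a + Y a) i = dn L X i + dn L Y i"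
  and dn_diff: "dn L (\<lambda>a. X a - Y a) i = dn L X i - dn L Y i"
  and dn_cmult: "dn L (\<lambda>a. c * X a) i = c * dn L X i"
  and dn_mult_right: "dn L (\<lambda>a. X a * c) i = dn L X i * c"
  and up_mult_right: "up L (\<lambda>a. X a * c) i = up L X i * c"
  and dn_zero: "dn L (\<lambda>a. 0) i = 0"
  and dn_sum: "dn L (\<lambda>a. \<Sum>x\<in>A. Z x a) i = (\<Sum>x\<in>A. dn L (Z x) i)"
  and up_sum: "up L (\<lambda>a. \<Sum>x\<in>A. Z x a) i = (\<Sum>x\<in>A. up L (Z x) i)"
proof -
  show "dn L (\<lambda>a. \<Sum>x\<in>A. Z x a) i = (\<Sum>x\<in>A. dn L (Z x) i)"
    unfolding dn_def sum_distrib_left by (rule sum.swap)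
  show "up L (\<lambda>a. \<Sum>x\<in>A. Z x a) i = (\<Sum>x\<in>A. up L (Z x) i)"
    unfolding up_def sum_distrib_left by (rule sum.swap)
qed (auto simp: dn_def up_def algebra_simps sum.distrib sum_subtractf sum_distrib_left sum_distrib_right)

lemma dn_dn_swap: "dn L (\<lambda>a. dn L (\<lambda>b. T a b) j) i = dn L (\<lambda>b. dn L (\<lambda>a. T a b) i) j"
  unfolding dn_def sum_distrib_left by (subst sum.swap) (simp add: mult_ac)

lemma up_dn_swap: "up M (\<lambda>a. dn L (\<lambda>b. T a b) j) i = dn L (\<lambda>b. up M (\<lambda>a. T a b) i) j"
  unfolding dn_def up_def sum_distrib_left by (subst sum.swap) (simp add: mult_ac)

text \<open>Stated for an arbitrary two-slot \<open>T\<close>, not only a product, so that it also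
  contracts two indices of one symbol, as in the traces of \<open>chr_jet\<close> and
  \<open>dchr_jet\<close>.\<close>

lemma contract_trace:
  assumes "\<And>a c. (\<Sum>k\<in>UNIV. L a k * M k c) = (if a = c then 1 else 0)"
  shows "(\<Sum>k\<in>UNIV. up M (\<lambda>c. dn L (\<lambda>a. T c a) k) k) = (\<Sum>c\<in>UNIV. T c c)"
proof -
  have "(\<Sum>k\<in>UNIV. up M (\<lambda>c. dn L (\<lambda>a. T c a) k) k)
      = (\<Sum>k\<in>UNIV. \<Sum>c\<in>UNIV. \<Sum>a\<in>UNIV. (L a k * M k c) * T c a)"
    by (simp add: up_def dn_def sum_distrib_left mult_ac)
  also have "\<dots> = (\<Sum>c\<in>UNIV. \<Sum>k\<in>UNIV. \<Sum>a\<in>UNIV. (L a k * M k c) * T c a)"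
    by (rule sum.swap)
  also have "\<dots> = (\<Sum>c\<in>UNIV. \<Sum>a\<in>UNIV. \<Sum>k\<in>UNIV. (L a k * M k c) * T c a)"
    by (intro sum.cong refl sum.swap)
  also have "\<dots> = (\<Sum>c\<in>UNIV. \<Sum>a\<in>UNIV. if a = c then T c a else 0)"
    by (intro sum.cong refl) (simp add: sum_distrib_right[symmetric] assms)
  finally show ?thesis by simp
qed

lemma contract:
  assumes "\<And>a c. (\<Sum>k\<in>UNIV. L a k * M k c) = (if a = c then 1 else 0)"
  shows "(\<Sum>k\<in>UNIV. up M X k * dn L Y k) = (\<Sum>c\<in>UNIV. X c * Y c)"
  using contract_trace[OF assms, of "\<lambda>c a. X c * Y a"] by (simp add: dn_cmult up_mult_right)

lemma contract':
  assumes "\<And>a c. (\<Sum>k\<in>UNIV. L a k * M k c) = (if a = c then 1 else 0)"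
  shows "(\<Sum>k\<in>UNIV. dn L Y k * up M X k) = (\<Sum>c\<in>UNIV. Y c * X c)"
  using contract[OF assms, of X Y] by (simp add: mult_ac)

lemma dn_rotate:
  "dn L (\<lambda>a. dn L (\<lambda>b. dn L (\<lambda>c. T a b c) l) j) i = dn L (\<lambda>c. dn L (\<lambda>a. dn L (\<lambda>b. T a b c) j) i) l"
proof -
  have "dn L (\<lambda>a. dn L (\<lambda>b. dn L (\<lambda>c. T a b c) l) j) i
      = dn L (\<lambda>a. dn L (\<lambda>c. dn L (\<lambda>b. T a b c) j) l) i"
    by (intro arg_cong[where f="\<lambda>Y. dn L Y i"] ext dn_dn_swap)
  also have "\<dots> = dn L (\<lambda>c. dn L (\<lambda>a. dn L (\<lambda>b. T a b c) j) i) l"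
    by (rule dn_dn_swap)
  finally show ?thesis .
qed

text \<open>The three terms of \<open>lowered\<close> carry the direction of differentiation in
  different slots; the nested operators are permuted until all three match.\<close>

lemma lowered_dn:
  "lowered (\<lambda>m i j. dn L (\<lambda>a. dn L (\<lambda>b. dn L (\<lambda>c. T a b c) j) i) m) l i j
    = dn L (\<lambda>c. dn L (\<lambda>a. dn L (\<lambda>b. lowered T c a b) j) i) l"
proof -
  have "dn L (\<lambda>a. dn L (\<lambda>b. dn L (\<lambda>c. T a b c) l) i) j
      = dn L (\<lambda>c. dn L (\<lambda>a. dn L (\<lambda>b. T b a c) j) i) l"
    unfolding dn_rotate[of L _ l i j] by (intro arg_cong[where f="\<lambda>Y. dn L Y l"] ext dn_dn_swap)
  then show ?thesis
    unfolding lowered_def dn_add dn_diff dn_cmult dn_rotate[of L _ l j i] by simp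
qed

lemma lowered_linear: "lowered (\<lambda>a b c. dn L (\<lambda>e. T e a b c) m) l i j = dn L (\<lambda>e. lowered (T e) l i j) m"
  unfolding lowered_def dn_add dn_diff dn_cmult ..

text \<open>For a change of frame with constant coefficients the inhomogeneous term in the
  transformation of Christoffel symbols is absent. So the symbols and their derivatives transform
  like tensors, and each of the four sums making up the Ricci tensor is covariant by itself.\<close>

lemma ricci_jet_covariant:
  fixes L M :: "'n::finite \<Rightarrow> 'n \<Rightarrow> real"
  assumes inv: "\<And>a c. (\<Sum>k\<in>UNIV. L a k * M k c) = (if a = c then 1 else 0)"
    and h: "\<And>k l. h' k l = up M (\<lambda>c. up M (\<lambda>d. h c d) l) k"
    and dg: "\<And>m i j. dg' m i j = dn L (\<lambda>a. dn L (\<lambda>b. dn L (\<lambda>c. dg a b c) j) i) m"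
    and ddg: "\<And>m n i j. ddg' m n i j
      = dn L (\<lambda>e. dn L (\<lambda>a. dn L (\<lambda>b. dn L (\<lambda>c. ddg e a b c) j) i) n) m"
  shows "ricci_jet h' dg' ddg' i j = dn L (\<lambda>a. dn L (\<lambda>b. ricci_jet h dg ddg a b) j) i"
proof -
  let ?C = "chr_jet h dg" and ?dC = "dchr_jet h dg ddg"
  let ?C' = "chr_jet h' dg'" and ?dC' = "dchr_jet h' dg' ddg'"
  have raise: "(\<Sum>l\<in>UNIV. h' k l * dn L Y l) = up M (\<lambda>c. \<Sum>l\<in>UNIV. h c l * Y l) k" for k Y
  proof -
    have "h' k l = up M (\<lambda>d. up M (\<lambda>c. h c d) k) l" for l
      unfolding h up_def sum_distrib_left by (subst sum.swap) (simp add: mult_ac)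
    then show ?thesis by (simp add: contract[OF inv] up_sum up_mult_right)
  qed
  have low: "lowered dg' l i j = dn L (\<lambda>c. dn L (\<lambda>a. dn L (\<lambda>b. lowered dg c a b) j) i) l" for l i j
    using lowered_dn[of L dg l i j] by (simp add: dg[abs_def])
  have C: "?C' k i j = up M (\<lambda>c. dn L (\<lambda>a. dn L (\<lambda>b. ?C c a b) j) i) k" for k i j
    unfolding chr_jet_def low raise by (simp add: dn_sum dn_cmult)
  have low2: "lowered (ddg' m) l i j
      = dn L (\<lambda>d. dn L (\<lambda>e. dn L (\<lambda>a. dn L (\<lambda>b. lowered (ddg e) d a b) j) i) m) l" for m l i j
  proof -
    have "ddg' m = (\<lambda>n i j. dn L (\<lambda>a. dn L (\<lambda>b. dn L (\<lambda>c. dn L (\<lambda>e. ddg e a b c) m) j) i) n)"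
      by (intro ext) (simp only: ddg dn_dn_swap[of L _ _ m])
    then have "lowered (ddg' m) l i j
        = dn L (\<lambda>d. dn L (\<lambda>a. dn L (\<lambda>b. dn L (\<lambda>e. lowered (ddg e) d a b) m) j) i) l"
      by (simp only: lowered_dn lowered_linear)
    then show ?thesis by (simp only: dn_rotate[of L _ m j i])
  qed
  have corr: "(\<Sum>b\<in>UNIV. dg' m l b * ?C' b i j)
      = dn L (\<lambda>d. dn L (\<lambda>e. dn L (\<lambda>a. dn L (\<lambda>b. \<Sum>c\<in>UNIV. dg e d c * ?C c a b) j) i) m) l" for m l i j
  proof -
    have "dg' m l b = dn L (\<lambda>c. dn L (\<lambda>e. dn L (\<lambda>d. dg e d c) l) m) b" for b
      unfolding dg by (rule dn_rotate)
    then have "(\<Sum>b\<in>UNIV. dg' m l b * ?C' b i j)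
        = (\<Sum>b\<in>UNIV. dn L (\<lambda>c. dn L (\<lambda>e. dn L (\<lambda>d. dg e d c) l) m) b
             * up M (\<lambda>c. dn L (\<lambda>a. dn L (\<lambda>b. ?C c a b) j) i) b)"
      by (simp only: C)
    also have "\<dots> = (\<Sum>c\<in>UNIV. dn L (\<lambda>e. dn L (\<lambda>d. dg e d c) l) m
             * dn L (\<lambda>a. dn L (\<lambda>b. ?C c a b) j) i)"
      by (rule contract'[OF inv])
    also have "\<dots> = (\<Sum>c\<in>UNIV. dn L (\<lambda>d. dn L (\<lambda>e. dg e d c) m) l
             * dn L (\<lambda>a. dn L (\<lambda>b. ?C c a b) j) i)"
      by (simp only: dn_dn_swap[of L _ l m])
    finally show ?thesis by (simp add: dn_sum dn_cmult dn_mult_right)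
  qed
  have dC: "?dC' m k i j = dn L (\<lambda>e. up M (\<lambda>c. dn L (\<lambda>a. dn L (\<lambda>b. ?dC e c a b) j) i) k) m" for m k i j
    unfolding dchr_jet_def low2 corr dn_diff[symmetric] raise up_dn_swap[of M L, symmetric]
    by (simp add: dn_sum dn_cmult)
  have T1: "(\<Sum>k\<in>UNIV. ?dC' k k i j) = dn L (\<lambda>a. dn L (\<lambda>b. \<Sum>k\<in>UNIV. ?dC k k a b) j) i"
    unfolding dC up_dn_swap[symmetric]
    by (subst contract_trace[OF inv]) (simp add: dn_sum)
  have T2: "(\<Sum>k\<in>UNIV. ?dC' j k i k) = dn L (\<lambda>a. dn L (\<lambda>b. \<Sum>k\<in>UNIV. ?dC b k a k) j) i"
  proof -
    have "?dC' j k i k = up M (\<lambda>c. dn L (\<lambda>b. dn L (\<lambda>e. dn L (\<lambda>a. ?dC e c a b) i) j) k) k" for k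
      unfolding dC up_dn_swap[symmetric] dn_rotate[of L _ k i j] ..
    then have "(\<Sum>k\<in>UNIV. ?dC' j k i k) = (\<Sum>k\<in>UNIV. dn L (\<lambda>e. dn L (\<lambda>a. ?dC e k a k) i) j)"
      by (simp add: contract_trace[OF inv])
    then show ?thesis by (simp add: dn_sum dn_dn_swap[of L _ i j])
  qed
  have T3: "(\<Sum>k\<in>UNIV. \<Sum>l\<in>UNIV. ?C' k k l * ?C' l i j)
      = dn L (\<lambda>a. dn L (\<lambda>b. \<Sum>k\<in>UNIV. \<Sum>l\<in>UNIV. ?C k k l * ?C l a b) j) i"
  proof -
    have "(\<Sum>k\<in>UNIV. ?C' k k l) = dn L (\<lambda>b. \<Sum>c\<in>UNIV. ?C c c b) l" for l
      unfolding C by (simp add: contract_trace[OF inv] dn_sum)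
    then have "(\<Sum>k\<in>UNIV. \<Sum>l\<in>UNIV. ?C' k k l * ?C' l i j)
        = (\<Sum>l\<in>UNIV. dn L (\<lambda>b. \<Sum>c\<in>UNIV. ?C c c b) l * ?C' l i j)"
      by (subst sum.swap) (simp add: sum_distrib_right[symmetric])
    also have "\<dots> = (\<Sum>l\<in>UNIV. (\<Sum>c\<in>UNIV. ?C c c l) * dn L (\<lambda>a. dn L (\<lambda>b. ?C l a b) j) i)"
      unfolding C by (rule contract'[OF inv])
    also have "\<dots> = (\<Sum>k\<in>UNIV. \<Sum>l\<in>UNIV. ?C k k l * dn L (\<lambda>a. dn L (\<lambda>b. ?C l a b) j) i)"
      by (subst sum.swap) (simp add: sum_distrib_right)
    finally show ?thesis by (simp add: dn_sum dn_cmult)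
  qed
  \<comment> \<open>Two indices are contracted between two symbols. The contraction over
    \<open>l\<close> comes first; the one over \<open>k\<close> follows after exchanging the
    sums.\<close>
  have T4: "(\<Sum>k\<in>UNIV. \<Sum>l\<in>UNIV. ?C' k j l * ?C' l i k)
      = dn L (\<lambda>a. dn L (\<lambda>b. \<Sum>k\<in>UNIV. \<Sum>l\<in>UNIV. ?C k b l * ?C l a k) j) i"
  proof -
    have "(\<Sum>l\<in>UNIV. ?C' k j l * ?C' l i k)
        = (\<Sum>l\<in>UNIV. up M (\<lambda>c. dn L (\<lambda>a. ?C c a l) j) k * dn L (\<lambda>f. dn L (\<lambda>e. ?C l e f) i) k)" for k
    proof -
      have "?C' k j l = dn L (\<lambda>b. up M (\<lambda>c. dn L (\<lambda>a. ?C c a b) j) k) l" for l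
        unfolding C by (simp only: up_dn_swap dn_dn_swap[of L _ l j])
      then have "(\<Sum>l\<in>UNIV. ?C' k j l * ?C' l i k)
          = (\<Sum>l\<in>UNIV. dn L (\<lambda>b. up M (\<lambda>c. dn L (\<lambda>a. ?C c a b) j) k) l
              * up M (\<lambda>c. dn L (\<lambda>a. dn L (\<lambda>b. ?C c a b) k) i) l)"
        by (simp add: C)
      also have "\<dots> = (\<Sum>l\<in>UNIV. up M (\<lambda>c. dn L (\<lambda>a. ?C c a l) j) k
              * dn L (\<lambda>e. dn L (\<lambda>f. ?C l e f) k) i)"
        by (rule contract'[OF inv])
      finally show ?thesis by (simp only: dn_dn_swap[of L _ k i])
    qed
    then have "(\<Sum>k\<in>UNIV. \<Sum>l\<in>UNIV. ?C' k j l * ?C' l i k)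
        = (\<Sum>l\<in>UNIV. \<Sum>k\<in>UNIV. up M (\<lambda>c. dn L (\<lambda>a. ?C c a l) j) k
              * dn L (\<lambda>f. dn L (\<lambda>e. ?C l e f) i) k)"
      by (subst sum.swap) simp
    also have "\<dots> = (\<Sum>l\<in>UNIV. \<Sum>k\<in>UNIV. dn L (\<lambda>a. ?C k a l) j * dn L (\<lambda>e. ?C l e k) i)"
      by (simp add: contract[OF inv])
    also have "\<dots> = (\<Sum>k\<in>UNIV. \<Sum>l\<in>UNIV. dn L (\<lambda>a. ?C k a l) j * dn L (\<lambda>e. ?C l e k) i)"
      by (rule sum.swap)
    finally show ?thesis by (simp add: dn_sum dn_cmult dn_mult_right)
  qed
  show ?thesis
    by (simp only: ricci_jet_def ricci_of_def sum_subtractf T1 T2 T3 T4 dn_add dn_diff)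
qed

section \<open>Ricci tensor of a metric that is diagonal at one point\<close>

text \<open>The arguments are the entries 11, 22, 23, 24, 33, 34, 44; the entries 12, 13, 14 vanish because
  \<open>dR\<close> is orthogonal to the other coordinate differentials.\<close>

definition sym4 :: "real \<Rightarrow> real \<Rightarrow> real \<Rightarrow> real \<Rightarrow> real \<Rightarrow> real \<Rightarrow> real \<Rightarrow> 4 \<Rightarrow> 4 \<Rightarrow> real" where
  "sym4 n p b c u v w i j =
     (if i = 1 \<and> j = 1 then n else if i = 2 \<and> j = 2 then p
      else if i = 2 \<and> j = 3 \<or> i = 3 \<and> j = 2 then b
      else if i = 2 \<and> j = 4 \<or> i = 4 \<and> j = 2 then c
      else if i = 3 \<and> j = 3 then u
      else if i = 3 \<and> j = 4 \<or> i = 4 \<and> j = 3 then v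
      else if i = 4 \<and> j = 4 then w else 0)"

lemma sym4_entries [simp]:
  "sym4 n p b c u v w 1 1 = n"
  "sym4 n p b c u v w 1 2 = 0"
  "sym4 n p b c u v w 1 3 = 0"
  "sym4 n p b c u v w 1 4 = 0"
  "sym4 n p b c u v w 2 1 = 0"
  "sym4 n p b c u v w 2 2 = p"
  "sym4 n p b c u v w 2 3 = b"
  "sym4 n p b c u v w 2 4 = c"
  "sym4 n p b c u v w 3 1 = 0"
  "sym4 n p b c u v w 3 2 = b"
  "sym4 n p b c u v w 3 3 = u"
  "sym4 n p b c u v w 3 4 = v"
  "sym4 n p b c u v w 4 1 = 0"
  "sym4 n p b c u v w 4 2 = c"
  "sym4 n p b c u v w 4 3 = v"
  "sym4 n p b c u v w 4 4 = w"
  by (simp_all add: sym4_def)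

text \<open>Only \<open>h\<close> is diagonal; the \<open>b\<close>, \<open>c\<close>,
  \<open>v\<close> entries may have nonzero derivatives. Of the derivatives of \<open>b\<close> and
  \<open>c\<close> just \<open>b1\<close> and \<open>c1\<close> survive, as gauge invariance
  predicts: a connection along \<open>d\<theta>\<close> alone is curved only through its
  \<open>R\<close>-derivative.\<close>

lemma ricci_jet_diagonal:
  fixes h :: "4 \<Rightarrow> 4 \<Rightarrow> real"
  assumes h: "h = sym4 hn hp 0 0 hu 0 hw"
    and d1: "dg 1 = sym4 n1 p1 b1 c1 u1 v1 w1" and d2: "dg 2 = sym4 n2 p2 b2 c2 u2 v2 w2"
    and d0: "dg 3 = (\<lambda>i j. 0)" "dg 4 = (\<lambda>i j. 0)"
    and d11: "ddg 1 1 = sym4 n11 p11 b11 c11 u11 v11 w11"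
    and d12: "ddg 1 2 = sym4 n12 p12 b12 c12 u12 v12 w12"
    and d21: "ddg 2 1 = sym4 n21 p21 b21 c21 u21 v21 w21"
    and d22: "ddg 2 2 = sym4 n22 p22 b22 c22 u22 v22 w22"
    and d00: "\<And>m. ddg m 3 = (\<lambda>i j. 0)" "\<And>m. ddg m 4 = (\<lambda>i j. 0)"
             "\<And>m. ddg 3 m = (\<lambda>i j. 0)" "\<And>m. ddg 4 m = (\<lambda>i j. 0)"
  shows "ricci_jet h dg ddg 1 1 = - (1/2) * hp * n22 + (1/4) * hp * hp * n2 * p2 - (1/2) * hp * p11 + (1/4) * hp * hp * p1 * p1 + (1/2) * b1 * b1 * hp * hu + (1/2) * c1 * c1 * hp * hw - (1/2) * hu * u11 + (1/4) * hu * hu * u1 * u1 + (1/2) * hu * hw * v1 * v1 - (1/2) * hw * w11 + (1/4) * hw * hw * w1 * w1 + (1/4) * hn * hp * n1 * p1 + (1/4) * hn * hp * n2 * n2 + (1/4) * hn * hu * n1 * u1 - (1/4) * hp * hu * n2 * u2 + (1/4) * hn * hw * n1 * w1 - (1/4) * hp * hw * n2 * w2"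
    "ricci_jet h dg ddg 2 2 = - (1/2) * hn * p11 + (1/4) * hn * hn * n1 * p1 - (1/2) * hn * n22 + (1/4) * hn * hn * n2 * n2 - (1/2) * hu * u22 + (1/4) * hu * hu * u2 * u2 + (1/2) * hu * hw * v2 * v2 - (1/2) * hw * w22 + (1/4) * hw * hw * w2 * w2 + (1/4) * hn * hp * n2 * p2 + (1/4) * hn * hp * p1 * p1 + (1/2) * b1 * b1 * hn * hu + (1/2) * c1 * c1 * hn * hw - (1/4) * hn * hu * p1 * u1 + (1/4) * hp * hu * p2 * u2 - (1/4) * hn * hw * p1 * w1 + (1/4) * hp * hw * p2 * w2"
    "ricci_jet h dg ddg 3 3 = - (1/2) * hn * u11 + (1/4) * hn * hn * n1 * u1 - (1/2) * hp * u22 + (1/4) * hp * hp * p2 * u2 - (1/4) * hn * hp * n2 * u2 + (1/2) * b1 * b1 * hn * hp + (1/4) * hn * hu * u1 * u1 + (1/2) * hn * hw * v1 * v1 - (1/4) * hn * hp * p1 * u1 + (1/4) * hp * hu * u2 * u2 + (1/2) * hp * hw * v2 * v2 - (1/4) * hn * hw * u1 * w1 - (1/4) * hp * hw * u2 * w2"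
    "ricci_jet h dg ddg 3 4 = - (1/2) * hn * v11 + (1/4) * hn * hn * n1 * v1 - (1/2) * hp * v22 + (1/4) * hp * hp * p2 * v2 - (1/4) * hn * hp * n2 * v2 + (1/2) * b1 * c1 * hn * hp + (1/4) * hn * hu * u1 * v1 + (1/4) * hn * hw * v1 * w1 - (1/4) * hn * hp * p1 * v1 + (1/4) * hp * hu * u2 * v2 + (1/4) * hp * hw * v2 * w2"
    "ricci_jet h dg ddg 4 4 = - (1/2) * hn * w11 + (1/4) * hn * hn * n1 * w1 - (1/2) * hp * w22 + (1/4) * hp * hp * p2 * w2 - (1/4) * hn * hp * n2 * w2 + (1/2) * c1 * c1 * hn * hp + (1/2) * hn * hu * v1 * v1 + (1/4) * hn * hw * w1 * w1 - (1/4) * hn * hp * p1 * w1 + (1/2) * hp * hu * v2 * v2 + (1/4) * hp * hw * w2 * w2 - (1/4) * hn * hu * u1 * w1 - (1/4) * hp * hu * u2 * w2"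
proof -
  have C: "chr_jet h dg k i j = h k k * lowered dg k i j" for k i j
    unfolding chr_jet_def using exhaust_4[of k] by (auto simp: sum_4 h)
  have dC: "dchr_jet h dg ddg m k i j
      = h k k * (lowered (ddg m) k i j - (\<Sum>b\<in>UNIV. dg m k b * (h b b * lowered dg b i j)))" for m k i j
    unfolding dchr_jet_def C using exhaust_4[of k] by (auto simp: sum_4 h)
  have hd: "h 1 1 = hn" "h 2 2 = hp" "h 3 3 = hu" "h 4 4 = hw"
    by (simp_all add: h)
  note exp = ricci_jet_def ricci_of_def C dC lowered_def sum_4 hd d1 d2 d0 d11 d12 d21 d22 d00
  show "ricci_jet h dg ddg 1 1 = - (1/2) * hp * n22 + (1/4) * hp * hp * n2 * p2 - (1/2) * hp * p11 + (1/4) * hp * hp * p1 * p1 + (1/2) * b1 * b1 * hp * hu + (1/2) * c1 * c1 * hp * hw - (1/2) * hu * u11 + (1/4) * hu * hu * u1 * u1 + (1/2) * hu * hw * v1 * v1 - (1/2) * hw * w11 + (1/4) * hw * hw * w1 * w1 + (1/4) * hn * hp * n1 * p1 + (1/4) * hn * hp * n2 * n2 + (1/4) * hn * hu * n1 * u1 - (1/4) * hp * hu * n2 * u2 + (1/4) * hn * hw * n1 * w1 - (1/4) * hp * hw * n2 * w2"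
    by (simp add: exp) (simp add: algebra_simps)
  show "ricci_jet h dg ddg 2 2 = - (1/2) * hn * p11 + (1/4) * hn * hn * n1 * p1 - (1/2) * hn * n22 + (1/4) * hn * hn * n2 * n2 - (1/2) * hu * u22 + (1/4) * hu * hu * u2 * u2 + (1/2) * hu * hw * v2 * v2 - (1/2) * hw * w22 + (1/4) * hw * hw * w2 * w2 + (1/4) * hn * hp * n2 * p2 + (1/4) * hn * hp * p1 * p1 + (1/2) * b1 * b1 * hn * hu + (1/2) * c1 * c1 * hn * hw - (1/4) * hn * hu * p1 * u1 + (1/4) * hp * hu * p2 * u2 - (1/4) * hn * hw * p1 * w1 + (1/4) * hp * hw * p2 * w2"
    by (simp add: exp) (simp add: algebra_simps)
  show "ricci_jet h dg ddg 3 3 = - (1/2) * hn * u11 + (1/4) * hn * hn * n1 * u1 - (1/2) * hp * u22 + (1/4) * hp * hp * p2 * u2 - (1/4) * hn * hp * n2 * u2 + (1/2) * b1 * b1 * hn * hp + (1/4) * hn * hu * u1 * u1 + (1/2) * hn * hw * v1 * v1 - (1/4) * hn * hp * p1 * u1 + (1/4) * hp * hu * u2 * u2 + (1/2) * hp * hw * v2 * v2 - (1/4) * hn * hw * u1 * w1 - (1/4) * hp * hw * u2 * w2"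
    by (simp add: exp) (simp add: algebra_simps)
  show "ricci_jet h dg ddg 3 4 = - (1/2) * hn * v11 + (1/4) * hn * hn * n1 * v1 - (1/2) * hp * v22 + (1/4) * hp * hp * p2 * v2 - (1/4) * hn * hp * n2 * v2 + (1/2) * b1 * c1 * hn * hp + (1/4) * hn * hu * u1 * v1 + (1/4) * hn * hw * v1 * w1 - (1/4) * hn * hp * p1 * v1 + (1/4) * hp * hu * u2 * v2 + (1/4) * hp * hw * v2 * w2"
    by (simp add: exp) (simp add: algebra_simps)
  show "ricci_jet h dg ddg 4 4 = - (1/2) * hn * w11 + (1/4) * hn * hn * n1 * w1 - (1/2) * hp * w22 + (1/4) * hp * hp * p2 * w2 - (1/4) * hn * hp * n2 * w2 + (1/2) * c1 * c1 * hn * hp + (1/2) * hn * hu * v1 * v1 + (1/4) * hn * hw * w1 * w1 - (1/4) * hn * hp * p1 * w1 + (1/2) * hp * hu * v2 * v2 + (1/4) * hp * hw * w2 * w2 - (1/4) * hn * hu * u1 * w1 - (1/4) * hp * hu * u2 * w2"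
    by (simp add: exp) (simp add: algebra_simps)
qed

section \<open>The Ricci tensor in terms of the metric jet\<close>

text \<open>Both functions have the same derivatives at \<open>x\<close>, hence the same chosen one,
  whether or not any exists. At interior points this trades the derivative within \<open>D\<close>
  for the full one.\<close>

lemma pd_interior:
  assumes "open S" "S \<subseteq> D" "x \<in> S" "\<And>y. y \<in> S \<Longrightarrow> f y = g y"
  shows "pd D b f x = pd UNIV b g x"
proof -
  have "at x within D = at x"
    using assms(1-3) by (meson at_within_interior interior_maximal subsetD)
  moreover have "(f has_derivative f') (at x) \<longleftrightarrow> (g has_derivative f') (at x)" for f'
    using has_derivative_transform_within_open[OF _ assms(1,3), of f f' UNIV g]
      has_derivative_transform_within_open[OF _ assms(1,3), of g f' UNIV f] assms(4) by auto
  ultimately show ?thesis by (simp add: pd_def frechet_derivative_def)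
qed

lemma pd_has_derivative: "(f has_derivative f') (at x) \<Longrightarrow> pd UNIV b f x = f' b"
  unfolding pd_def by (metis frechet_derivative_at)

lemma has_derivative_pd: "f differentiable at x \<Longrightarrow> (f has_derivative (\<lambda>b. pd UNIV b f x)) (at x)"
  by (simp add: pd_def frechet_derivative_works)

lemma pd_const: "pd UNIV b (\<lambda>y. c) x = 0"
  by (rule pd_has_derivative[OF has_derivative_const])

lemma pd_mult:
  assumes "f differentiable at x" "g differentiable at x"
  shows "pd UNIV b (\<lambda>y. f y * g y) x = pd UNIV b f x * g x + f x * pd UNIV b g x"
  using pd_has_derivative[OF has_derivative_mult[OF assms[THEN has_derivative_pd]], of b] by simp

lemma pd_add:
  assumes "f differentiable at x" "g differentiable at x"
  shows "pd UNIV b (\<lambda>y. f y + g y) x = pd UNIV b f x + pd UNIV b g x"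
  using pd_has_derivative[OF has_derivative_add[OF assms[THEN has_derivative_pd]], of b] by simp

lemma pd_diff:
  assumes "f differentiable at x" "g differentiable at x"
  shows "pd UNIV b (\<lambda>y. f y - g y) x = pd UNIV b f x - pd UNIV b g x"
  using pd_has_derivative[OF has_derivative_diff[OF assms[THEN has_derivative_pd]], of b] by simp

lemma pd_sum:
  assumes "\<And>i. i \<in> I \<Longrightarrow> f i differentiable at x"
  shows "pd UNIV b (\<lambda>y. \<Sum>i\<in>I. f i y) x = (\<Sum>i\<in>I. pd UNIV b (f i) x)"
  by (rule pd_has_derivative[where b = b, OF has_derivative_sum[where I = I, OF assms[THEN has_derivative_pd]]])

lemma matrix_inv_eqI:
  fixes A B :: "real^'n^'n"
  assumes "A ** B = mat 1" "B ** A = mat 1"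
  shows "matrix_inv A = B"
proof -
  have "A ** matrix_inv A = mat 1 \<and> matrix_inv A ** A = mat 1"
    unfolding matrix_inv_def by (rule someI[of _ B]) (use assms in auto)
  then show ?thesis by (metis assms(2) matrix_mul_assoc matrix_mul_lid matrix_mul_rid)
qed

text \<open>Differentiating \<open>h ** g = mat 1\<close> expresses the derivatives of the inverse
  metric through those of \<open>g\<close>; so an explicit inverse \<open>h\<close> has to be
  differentiable, but no formula for its derivative is supplied.\<close>

lemma ricci_eq_ricci_jet:
  fixes g h :: "real^'n \<Rightarrow> real^'n^'n"
  assumes S: "open S" "S \<subseteq> D" "x \<in> S"
    and inv: "\<And>y. y \<in> S \<Longrightarrow> g y ** h y = mat 1" "\<And>y. y \<in> S \<Longrightarrow> h y ** g y = mat 1"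
    and g1: "\<And>i j y. y \<in> S \<Longrightarrow> (\<lambda>y. g y $ i $ j) differentiable at y"
    and g2: "\<And>m i j y. y \<in> S \<Longrightarrow> pd UNIV (axis m 1) (\<lambda>y. g y $ i $ j) differentiable at y"
    and h1: "\<And>i j y. y \<in> S \<Longrightarrow> (\<lambda>y. h y $ i $ j) differentiable at y"
  shows "ricci D g i j x = ricci_jet (\<lambda>k l. h x $ k $ l)
      (\<lambda>m i j. pd UNIV (axis m 1) (\<lambda>y. g y $ i $ j) x)
      (\<lambda>m n i j. pd UNIV (axis m 1) (pd UNIV (axis n 1) (\<lambda>y. g y $ i $ j)) x) i j"
proof -
  let ?h = "\<lambda>y k l. h y $ k $ l"
  let ?dg = "\<lambda>y m i j. pd UNIV (axis m 1) (\<lambda>y. g y $ i $ j) y"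
  let ?ddg = "\<lambda>m n i j. pd UNIV (axis m 1) (pd UNIV (axis n 1) (\<lambda>y. g y $ i $ j)) x"
  have C: "christoffel D g k i j y = chr_jet (?h y) (?dg y) k i j" if "y \<in> S" for k i j y
    unfolding christoffel_def chr_jet_def lowered_def
    using matrix_inv_eqI[OF inv[OF that]] that
    by (simp add: sum_distrib_left pd_interior[OF S(1,2), of y] mult_ac)
  have prod: "(\<Sum>a\<in>UNIV. h y $ k $ a * g y $ a $ c) = (if k = c then 1 else 0)"
    "(\<Sum>a\<in>UNIV. g y $ k $ a * h y $ a $ c) = (if k = c then 1 else 0)" if "y \<in> S" for k c y
    using arg_cong[OF inv(2)[OF that], of "\<lambda>A. A $ k $ c"] arg_cong[OF inv(1)[OF that], of "\<lambda>A. A $ k $ c"]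
    by (simp_all add: matrix_matrix_mult_def mat_def)
  have dh: "pd UNIV (axis m 1) (\<lambda>y. h y $ k $ l) x
      = - (\<Sum>c\<in>UNIV. (\<Sum>a\<in>UNIV. h x $ k $ a * ?dg x m a c) * h x $ c $ l)" for m k l
  proof -
    let ?dh = "\<lambda>k l. pd UNIV (axis m 1) (\<lambda>y. h y $ k $ l) x"
    have "(\<Sum>a\<in>UNIV. ?dh k a * g x $ a $ c) + (\<Sum>a\<in>UNIV. h x $ k $ a * ?dg x m a c) = 0" for c
    proof -
      have "pd UNIV (axis m 1) (\<lambda>y. \<Sum>a\<in>UNIV. h y $ k $ a * g y $ a $ c) x
          = pd UNIV (axis m 1) (\<lambda>y. if k = c then 1 else 0) x"
        by (rule pd_interior[OF S(1) subset_UNIV S(3)]) (rule prod)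
      also have "\<dots> = 0" by (rule pd_const)
      also have "pd UNIV (axis m 1) (\<lambda>y. \<Sum>a\<in>UNIV. h y $ k $ a * g y $ a $ c) x
          = (\<Sum>a\<in>UNIV. ?dh k a * g x $ a $ c + h x $ k $ a * ?dg x m a c)"
        by (subst pd_sum) (auto simp: pd_mult g1[OF S(3)] h1[OF S(3)] intro!: differentiable_mult)
      finally show ?thesis by (simp add: sum.distrib)
    qed
    then have "(\<Sum>a\<in>UNIV. h x $ k $ a * ?dg x m a c) = - (\<Sum>a\<in>UNIV. ?dh k a * g x $ a $ c)" for c
      by (simp add: eq_neg_iff_add_eq_0 add.commute)
    then have "- (\<Sum>c\<in>UNIV. (\<Sum>a\<in>UNIV. h x $ k $ a * ?dg x m a c) * h x $ c $ l)
        = (\<Sum>c\<in>UNIV. \<Sum>a\<in>UNIV. ?dh k a * (g x $ a $ c * h x $ c $ l))"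
      by (simp add: sum_negf sum_distrib_right sum_distrib_left mult_ac)
    also have "\<dots> = (\<Sum>a\<in>UNIV. ?dh k a * (\<Sum>c\<in>UNIV. g x $ a $ c * h x $ c $ l))"
      by (subst sum.swap) (simp add: sum_distrib_left)
    finally show ?thesis by (simp add: prod[OF S(3)] if_distrib[where f = "(*) _"] cong: if_cong)
  qed
  have dlow: "(\<lambda>y. lowered (?dg y) l i j) differentiable at x"
    "pd UNIV (axis m 1) (\<lambda>y. lowered (?dg y) l i j) x = lowered (?ddg m) l i j" for m l i j
  proof -
    note d = g2[OF S(3)]
    let ?T = "\<lambda>y. ?dg y i j l + ?dg y j i l - ?dg y l i j"
    have T: "?T differentiable at x" by (intro differentiable_add differentiable_diff d)
    then show "(\<lambda>y. lowered (?dg y) l i j) differentiable at x"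
      unfolding lowered_def by (intro differentiable_mult differentiable_const)
    have "pd UNIV (axis m 1) (\<lambda>y. lowered (?dg y) l i j) x = 1/2 * pd UNIV (axis m 1) ?T x"
      unfolding lowered_def pd_mult[OF differentiable_const T] pd_const by simp
    also have "pd UNIV (axis m 1) ?T x = ?ddg m i j l + ?ddg m j i l - ?ddg m l i j"
      by (simp add: pd_add pd_diff d differentiable_add)
    finally show "pd UNIV (axis m 1) (\<lambda>y. lowered (?dg y) l i j) x = lowered (?ddg m) l i j"
      by (simp add: lowered_def)
  qed
  have dC: "pd D (axis m 1) (christoffel D g k i j) x = dchr_jet (?h x) (?dg x) ?ddg m k i j" for m k i j
  proof -
    have "pd D (axis m 1) (christoffel D g k i j) x
        = pd UNIV (axis m 1) (\<lambda>y. chr_jet (?h y) (?dg y) k i j) x"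
      by (rule pd_interior[OF S]) (rule C)
    also have "\<dots> = (\<Sum>l\<in>UNIV. pd UNIV (axis m 1) (\<lambda>y. h y $ k $ l) x * lowered (?dg x) l i j
          + h x $ k $ l * lowered (?ddg m) l i j)"
      unfolding chr_jet_def
      by (subst pd_sum) (auto simp: pd_mult dlow h1[OF S(3)] intro!: differentiable_mult)
    finally have split: "pd D (axis m 1) (christoffel D g k i j) x
        = (\<Sum>l\<in>UNIV. pd UNIV (axis m 1) (\<lambda>y. h y $ k $ l) x * lowered (?dg x) l i j)
          + (\<Sum>l\<in>UNIV. h x $ k $ l * lowered (?ddg m) l i j)"
      by (simp only: sum.distrib)
    have inner: "(\<Sum>l\<in>UNIV. pd UNIV (axis m 1) (\<lambda>y. h y $ k $ l) x * lowered (?dg x) l i j)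
        = - (\<Sum>a\<in>UNIV. h x $ k $ a * (\<Sum>c\<in>UNIV. ?dg x m a c * chr_jet (?h x) (?dg x) c i j))"
    proof -
      have "(\<Sum>l\<in>UNIV. pd UNIV (axis m 1) (\<lambda>y. h y $ k $ l) x * lowered (?dg x) l i j)
        = - (\<Sum>l\<in>UNIV. \<Sum>c\<in>UNIV. \<Sum>a\<in>UNIV. h x $ k $ a * ?dg x m a c * h x $ c $ l * lowered (?dg x) l i j)"
        by (simp only: dh mult_minus_left sum_negf sum_distrib_right)
      also have "\<dots> = - (\<Sum>c\<in>UNIV. \<Sum>l\<in>UNIV. \<Sum>a\<in>UNIV. h x $ k $ a * ?dg x m a c * h x $ c $ l * lowered (?dg x) l i j)"
        by (intro arg_cong[where f = uminus] sum.swap)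
      also have "\<dots> = - (\<Sum>c\<in>UNIV. \<Sum>a\<in>UNIV. \<Sum>l\<in>UNIV. h x $ k $ a * ?dg x m a c * h x $ c $ l * lowered (?dg x) l i j)"
        by (intro arg_cong[where f = uminus] sum.cong refl sum.swap)
      also have "\<dots> = - (\<Sum>a\<in>UNIV. \<Sum>c\<in>UNIV. \<Sum>l\<in>UNIV. h x $ k $ a * ?dg x m a c * h x $ c $ l * lowered (?dg x) l i j)"
        by (intro arg_cong[where f = uminus] sum.swap)
      finally show ?thesis by (simp add: chr_jet_def sum_distrib_left mult_ac)
    qed
    show ?thesis
      unfolding split inner by (simp add: dchr_jet_def sum_subtractf right_diff_distrib)
  qed
  show ?thesis
    unfolding ricci_def ricci_jet_def ricci_of_def by (simp add: dC C[OF S(3)])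
qed

section \<open>Two-jets of functions of two variables\<close>

definition jet1 where
  "jet1 W f f1 f2 \<longleftrightarrow> (\<forall>q\<in>W. (f has_derivative (\<lambda>v. f1 q * fst v + f2 q * snd v)) (at q))"
  for f :: "real \<times> real \<Rightarrow> real"

text \<open>One function \<open>f12\<close> serves both mixed partials, so symmetry is part of the
  notion. The sum, product and chain rules preserve it by pure algebra, and Schwarz's theorem is
  invoked once, in \<open>jet2_Ck_on\<close>.\<close>

definition jet2 where
  "jet2 W f f1 f2 f11 f12 f22 \<longleftrightarrow> jet1 W f f1 f2 \<and> jet1 W f1 f11 f12 \<and> jet1 W f2 f12 f22"

lemma jet1_const: "jet1 W (\<lambda>q. c) (\<lambda>q. 0) (\<lambda>q. 0)"
  by (simp add: jet1_def)

lemma jet1_fst: "jet1 W fst (\<lambda>q. 1) (\<lambda>q. 0)"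
  unfolding jet1_def by (auto intro!: derivative_eq_intros)

lemma jet1_add:
  "jet1 W f f1 f2 \<Longrightarrow> jet1 W g g1 g2 \<Longrightarrow> jet1 W (\<lambda>q. f q + g q) (\<lambda>q. f1 q + g1 q) (\<lambda>q. f2 q + g2 q)"
  unfolding jet1_def
  by (auto intro!: has_derivative_eq_rhs[OF has_derivative_add] simp: algebra_simps)

lemma jet1_mult:
  "jet1 W f f1 f2 \<Longrightarrow> jet1 W g g1 g2 \<Longrightarrow>
    jet1 W (\<lambda>q. f q * g q) (\<lambda>q. f1 q * g q + f q * g1 q) (\<lambda>q. f2 q * g q + f q * g2 q)"
  unfolding jet1_def
  by (auto intro!: has_derivative_eq_rhs[OF has_derivative_mult] simp: algebra_simps)

lemma jet1_chain:
  assumes "jet1 W f f1 f2" "\<And>q. q \<in> W \<Longrightarrow> (F has_real_derivative F' (f q)) (at (f q))"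
  shows "jet1 W (\<lambda>q. F (f q)) (\<lambda>q. F' (f q) * f1 q) (\<lambda>q. F' (f q) * f2 q)"
  unfolding jet1_def
proof
  fix q assume q: "q \<in> W"
  have "((F \<circ> f) has_derivative ((*) (F' (f q)) \<circ> (\<lambda>v. f1 q * fst v + f2 q * snd v))) (at q)"
    using assms q by (intro diff_chain_at) (auto simp: jet1_def has_field_derivative_def)
  then show "((\<lambda>q. F (f q)) has_derivative (\<lambda>v. F' (f q) * f1 q * fst v + F' (f q) * f2 q * snd v)) (at q)"
    by (simp add: o_def algebra_simps)
qed

lemma jet1_cong:
  assumes "jet1 W f f1 f2" "open W" "\<And>q. q \<in> W \<Longrightarrow> f q = g q" "\<And>q. q \<in> W \<Longrightarrow> f1 q = g1 q" "\<And>q. q \<in> W \<Longrightarrow> f2 q = g2 q"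
  shows "jet1 W g g1 g2"
  unfolding jet1_def
proof
  fix q assume q: "q \<in> W"
  have "(f has_derivative (\<lambda>v. g1 q * fst v + g2 q * snd v)) (at q)"
    using assms(1,4,5) q by (auto simp: jet1_def)
  then show "(g has_derivative (\<lambda>v. g1 q * fst v + g2 q * snd v)) (at q)"
    by (rule has_derivative_transform_within_open[OF _ assms(2) q]) (rule assms(3))
qed

lemma jet2_const: "jet2 W (\<lambda>q. c) (\<lambda>q. 0) (\<lambda>q. 0) (\<lambda>q. 0) (\<lambda>q. 0) (\<lambda>q. 0)"
  by (simp add: jet2_def jet1_const)

lemma jet2_fst: "jet2 W fst (\<lambda>q. 1) (\<lambda>q. 0) (\<lambda>q. 0) (\<lambda>q. 0) (\<lambda>q. 0)"
  by (simp add: jet2_def jet1_const jet1_fst)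

lemma jet2_add:
  assumes "jet2 W f f1 f2 f11 f12 f22" "jet2 W g g1 g2 g11 g12 g22"
  shows "jet2 W (\<lambda>q. f q + g q) (\<lambda>q. f1 q + g1 q) (\<lambda>q. f2 q + g2 q)
    (\<lambda>q. f11 q + g11 q) (\<lambda>q. f12 q + g12 q) (\<lambda>q. f22 q + g22 q)"
  using assms by (simp add: jet2_def jet1_add)

lemma jet1_eq_rhs: "jet1 W f f1 f2 \<Longrightarrow> (\<And>q. f1 q = g1 q) \<Longrightarrow> (\<And>q. f2 q = g2 q) \<Longrightarrow> jet1 W f g1 g2"
  by (simp add: jet1_def)

lemma jet2_mult:
  assumes "jet2 W f f1 f2 f11 f12 f22" "jet2 W g g1 g2 g11 g12 g22"
  shows "jet2 W (\<lambda>q. f q * g q) (\<lambda>q. f1 q * g q + f q * g1 q) (\<lambda>q. f2 q * g q + f q * g2 q)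
    (\<lambda>q. f11 q * g q + 2 * (f1 q * g1 q) + f q * g11 q)
    (\<lambda>q. f12 q * g q + f1 q * g2 q + f2 q * g1 q + f q * g12 q)
    (\<lambda>q. f22 q * g q + 2 * (f2 q * g2 q) + f q * g22 q)"
  using assms unfolding jet2_def
  by (auto intro!: jet1_mult jet1_eq_rhs[OF jet1_add[OF jet1_mult jet1_mult]])

lemma jet2_chain:
  assumes "jet2 W f f1 f2 f11 f12 f22"
    and "\<And>q. q \<in> W \<Longrightarrow> (F has_real_derivative F' (f q)) (at (f q))"
    and "\<And>q. q \<in> W \<Longrightarrow> (F' has_real_derivative F'' (f q)) (at (f q))"
  shows "jet2 W (\<lambda>q. F (f q)) (\<lambda>q. F' (f q) * f1 q) (\<lambda>q. F' (f q) * f2 q)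
    (\<lambda>q. F'' (f q) * f1 q * f1 q + F' (f q) * f11 q) (\<lambda>q. F'' (f q) * f1 q * f2 q + F' (f q) * f12 q)
    (\<lambda>q. F'' (f q) * f2 q * f2 q + F' (f q) * f22 q)"
  using assms(1) unfolding jet2_def
  by (auto intro!: jet1_chain assms(2,3) jet1_eq_rhs[OF jet1_mult[OF jet1_chain]])

lemma jet2_exp:
  assumes "jet2 W f f1 f2 f11 f12 f22"
  shows "jet2 W (\<lambda>q. exp (f q)) (\<lambda>q. exp (f q) * f1 q) (\<lambda>q. exp (f q) * f2 q)
    (\<lambda>q. exp (f q) * f1 q * f1 q + exp (f q) * f11 q) (\<lambda>q. exp (f q) * f1 q * f2 q + exp (f q) * f12 q)
    (\<lambda>q. exp (f q) * f2 q * f2 q + exp (f q) * f22 q)"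
  by (rule jet2_chain[OF assms]) (rule DERIV_exp)+

lemma jet1_pd:
  assumes "\<And>q. q \<in> W \<Longrightarrow> f differentiable at q"
  shows "jet1 W f (pd UNIV (1, 0) f) (pd UNIV (0, 1) f)"
  unfolding jet1_def
proof
  fix q assume "q \<in> W"
  then have d: "(f has_derivative (\<lambda>b. pd UNIV b f q)) (at q)"
    by (intro has_derivative_pd assms)
  interpret bounded_linear "\<lambda>b. pd UNIV b f q" by (rule has_derivative_bounded_linear[OF d])
  have "pd UNIV v f q = pd UNIV (1, 0) f q * fst v + pd UNIV (0, 1) f q * snd v" for v
  proof -
    have "v = fst v *\<^sub>R (1, 0) + snd v *\<^sub>R (0, 1)" by (simp add: prod_eq_iff)
    then have "pd UNIV v f q = pd UNIV (fst v *\<^sub>R (1, 0) + snd v *\<^sub>R (0, 1)) f q" by simp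
    then show ?thesis by (simp only: add scale real_scaleR_def mult.commute)
  qed
  then show "(f has_derivative (\<lambda>v. pd UNIV (1, 0) f q * fst v + pd UNIV (0, 1) f q * snd v)) (at q)"
    by (intro has_derivative_eq_rhs[OF d] ext)
qed

lemma jet1_partial:
  assumes "jet1 W f f1 f2" "(x, y) \<in> W"
  shows "((\<lambda>x. f (x, y)) has_real_derivative f1 (x, y)) (at x)"
    and "((\<lambda>y. f (x, y)) has_real_derivative f2 (x, y)) (at y)"
proof -
  have d: "(f has_derivative (\<lambda>v. f1 (x, y) * fst v + f2 (x, y) * snd v)) (at (x, y))"
    using assms by (simp add: jet1_def)
  have "((\<lambda>x. f (x, y)) has_derivative (\<lambda>v. f1 (x, y) * fst (v, 0::real) + f2 (x, y) * snd (v, 0::real))) (at x)"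
    by (rule has_derivative_compose[where f = "\<lambda>x. (x, y)", OF _ d]) (auto intro!: derivative_eq_intros)
  then show "((\<lambda>x. f (x, y)) has_real_derivative f1 (x, y)) (at x)"
    by (simp add: has_field_derivative_def)
  have "((\<lambda>y. f (x, y)) has_derivative (\<lambda>v. f1 (x, y) * fst (0::real, v) + f2 (x, y) * snd (0::real, v))) (at y)"
    by (rule has_derivative_compose[where f = "\<lambda>y. (x, y)", OF _ d]) (auto intro!: derivative_eq_intros)
  then show "((\<lambda>y. f (x, y)) has_real_derivative f2 (x, y)) (at y)"
    by (simp add: has_field_derivative_def)
qed

lemma jet1_continuous_on: "jet1 W f f1 f2 \<Longrightarrow> continuous_on W f"
  unfolding jet1_def
  by (meson differentiable_at_imp_differentiable_on differentiable_def differentiable_imp_continuous_on)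

text \<open>Schwarz's theorem by differentiation under the integral: \<open>f\<close> equals its
  value on the lower edge of a rectangle plus the integral of \<open>f2\<close> in \<open>y\<close>.
  Differentiating in \<open>x\<close> replaces \<open>f2\<close> by the continuous
  \<open>f21\<close>, and differentiating the result in \<open>y\<close> recovers
  \<open>f21\<close>.\<close>

lemma mixed_partials_eq:
  assumes "open W" and f: "jet1 W f f1 f2" and f1: "jet1 W f1 f11 f12" and f2: "jet1 W f2 f21 f22"
    and cont: "continuous_on W f21" and q: "q \<in> W"
  shows "f12 q = f21 q"
proof -
  obtain x0 y0 where q0: "q = (x0, y0)" by (cases q)
  obtain A B where AB: "open A" "open B" "x0 \<in> A" "y0 \<in> B" "A \<times> B \<subseteq> W"
    using assms(1) q unfolding q0 open_prod_def by auto
  obtain e where e: "e > 0" "cball x0 e \<subseteq> A" using AB by (meson open_contains_cball)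
  obtain d where d: "d > 0" "cball y0 d \<subseteq> B" using AB by (meson open_contains_cball)
  have W: "(x, y) \<in> W" if "x \<in> {x0-e<..<x0+e}" "y \<in> {y0-d..y0+d}" for x y
    using that e d AB(5) by (auto simp: cball_def dist_real_def subset_iff abs_le_iff)
  let ?U = "{x0-e<..<x0+e}" and ?l = "y0-d" and ?r = "y0+d"
  note c2 = jet1_continuous_on[OF f2]
  have f1_eq: "f1 (x0, y) = f1 (x0, ?l) + integral {?l..y} (\<lambda>t. f21 (x0, t))" if y: "y \<in> {?l..?r}" for y
  proof -
    have ftc: "f (x, y) = f (x, ?l) + integral {?l..y} (\<lambda>t. f2 (x, t))" if "x \<in> ?U" for x
    proof -
      have "((\<lambda>t. f2 (x, t)) has_integral (f (x, y) - f (x, ?l))) {?l..y}"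
        using y that by (intro fundamental_theorem_of_calculus)
          (auto simp: has_real_derivative_iff_has_vector_derivative[symmetric]
            intro!: has_field_derivative_at_within[OF jet1_partial(2)[OF f W]])
      then show ?thesis by (simp add: integral_unique)
    qed
    have "((\<lambda>x. integral (cbox ?l y) (\<lambda>t. f2 (x, t))) has_field_derivative
        integral (cbox ?l y) (\<lambda>t. f21 (x0, t))) (at x0 within ?U)"
    proof (rule leibniz_rule_field_derivative)
      show "((\<lambda>x. f2 (x, t)) has_field_derivative f21 (x, t)) (at x within ?U)"
        if "x \<in> ?U" "t \<in> cbox ?l y" for x t
        using that y by (intro has_field_derivative_at_within[OF jet1_partial(1)[OF f2 W]]) auto
      show "(\<lambda>t. f2 (x, t)) integrable_on cbox ?l y" if "x \<in> ?U" for x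
        using that y W by (intro integrable_continuous continuous_on_compose2[OF c2] continuous_intros) auto
      show "continuous_on (?U \<times> cbox ?l y) (\<lambda>(x, t). f21 (x, t))"
        unfolding split_beta prod.collapse using y W by (intro continuous_on_subset[OF cont]) auto
    qed (use e in auto)
    then have "((\<lambda>x. integral {?l..y} (\<lambda>t. f2 (x, t))) has_field_derivative
        integral {?l..y} (\<lambda>t. f21 (x0, t))) (at x0)"
      using e by (simp add: at_within_open[of x0 ?U])
    then have "((\<lambda>x. f (x, ?l) + integral {?l..y} (\<lambda>t. f2 (x, t))) has_real_derivative
        f1 (x0, ?l) + integral {?l..y} (\<lambda>t. f21 (x0, t))) (at x0)"
      using e d by (intro DERIV_add jet1_partial(1)[OF f W]) auto
    then have "((\<lambda>x. f (x, y)) has_real_derivative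
        f1 (x0, ?l) + integral {?l..y} (\<lambda>t. f21 (x0, t))) (at x0)"
      by (rule has_field_derivative_transform_within_open[of _ _ _ ?U]) (use e ftc in auto)
    moreover have "((\<lambda>x. f (x, y)) has_real_derivative f1 (x0, y)) (at x0)"
      using y e by (intro jet1_partial(1)[OF f W]) auto
    ultimately show ?thesis by (rule DERIV_unique[symmetric])
  qed
  have "continuous_on {?l..?r} (\<lambda>t. f21 (x0, t))"
    using e W by (intro continuous_on_compose2[OF cont] continuous_intros) auto
  then have "((\<lambda>y. integral {?l..y} (\<lambda>t. f21 (x0, t))) has_real_derivative f21 (x0, y0)) (at y0 within {?l..?r})"
    by (rule integral_has_real_derivative) (use d in auto)
  moreover have "at y0 within {?l..?r} = at y0"
    using d by (intro at_within_interior) simp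
  ultimately have "((\<lambda>y. f1 (x0, ?l) + integral {?l..y} (\<lambda>t. f21 (x0, t)))
      has_real_derivative 0 + f21 (x0, y0)) (at y0)"
    by (intro DERIV_add DERIV_const) simp
  then have "((\<lambda>y. f1 (x0, ?l) + integral {?l..y} (\<lambda>t. f21 (x0, t))) has_real_derivative f21 (x0, y0)) (at y0)"
    by simp
  then have "((\<lambda>y. f1 (x0, y)) has_real_derivative f21 (x0, y0)) (at y0)"
    by (rule has_field_derivative_transform_within_open[of _ _ _ "{?l<..<?r}"]) (use d f1_eq[symmetric] in auto)
  then show ?thesis
    using jet1_partial(2)[OF f1 q[unfolded q0]] q0 by (blast intro: DERIV_unique)
qed

lemma Ck_on_2_interior:
  assumes "Ck_on 2 D f" "open W" "W \<subseteq> D" "b \<in> Basis" "c \<in> Basis"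
  shows "\<And>q. q \<in> W \<Longrightarrow> f differentiable at q"
    and "\<And>q. q \<in> W \<Longrightarrow> pd D b f q = pd UNIV b f q"
    and "\<And>q. q \<in> W \<Longrightarrow> pd UNIV b f differentiable at q"
    and "continuous_on W (pd UNIV c (pd UNIV b f))"
proof -
  have Ck: "f differentiable_on D" "pd D b f differentiable_on D" "continuous_on D (pd D c (pd D b f))"
    using assms(1,4,5) by (auto simp: numeral_2_eq_2)
  have at: "at q within D = at q" if "q \<in> W" for q
    using assms(2,3) that by (meson at_within_interior interior_maximal subsetD)
  show "f differentiable at q" if "q \<in> W" for q
    using Ck(1) at[OF that] assms(3) that by (auto simp: differentiable_on_def dest!: bspec[of _ _ q])
  show eq: "pd D b f q = pd UNIV b f q" if "q \<in> W" for q
    by (rule pd_interior[OF assms(2,3) that]) simp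
  have "pd D b f differentiable at q" if "q \<in> W" for q
    using Ck(2) at[OF that] assms(3) that by (auto simp: differentiable_on_def dest!: bspec[of _ _ q])
  then show "pd UNIV b f differentiable at q" if q: "q \<in> W" for q
  proof -
    assume "\<And>q. q \<in> W \<Longrightarrow> pd D b f differentiable at q"
    then obtain f' where "(pd D b f has_derivative f') (at q)"
      using q unfolding differentiable_def by blast
    then have "(pd UNIV b f has_derivative f') (at q)"
      by (rule has_derivative_transform_within_open[OF _ assms(2) q eq])
    then show ?thesis unfolding differentiable_def by blast
  qed
  have "pd D c (pd D b f) q = pd UNIV c (pd UNIV b f) q" if "q \<in> W" for q
    by (rule pd_interior[OF assms(2,3) that eq])
  then show "continuous_on W (pd UNIV c (pd UNIV b f))"
    using continuous_on_subset[OF Ck(3) assms(3)] by (simp cong: continuous_on_cong)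
qed

lemma jet2_Ck_on:
  assumes "Ck_on 2 D f" "open W" "W \<subseteq> D"
  shows "jet2 W f (pd UNIV (1, 0) f) (pd UNIV (0, 1) f) (pd UNIV (1, 0) (pd UNIV (1, 0) f))
      (pd UNIV (0, 1) (pd UNIV (1, 0) f)) (pd UNIV (0, 1) (pd UNIV (0, 1) f))"
proof -
  have b: "(1, 0) \<in> (Basis :: (real \<times> real) set)" "(0, 1) \<in> (Basis :: (real \<times> real) set)"
    by (simp_all add: Basis_prod_def image_iff)
  note C = Ck_on_2_interior[OF assms]
  note j = jet1_pd[of W f, OF C(1)[OF b(1) b(1)]] jet1_pd[of W "pd UNIV (1, 0) f", OF C(3)[OF b(1) b(1)]]
    jet1_pd[of W "pd UNIV (0, 1) f", OF C(3)[OF b(2) b(1)]]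
  have "jet1 W (pd UNIV (0, 1) f) (pd UNIV (0, 1) (pd UNIV (1, 0) f)) (pd UNIV (0, 1) (pd UNIV (0, 1) f))"
    by (rule jet1_cong[OF j(3) assms(2)])
      (auto intro!: mixed_partials_eq[OF assms(2) j C(4)[OF b(2) b(1)], symmetric])
  with j show ?thesis by (simp add: jet2_def)
qed

section \<open>Vacuum equations of a torus bundle metric\<close>

lemma lift_has_derivative:
  assumes "jet1 W f f1 f2" "(p $ 1, p $ 2) \<in> W"
  shows "((\<lambda>p :: real^4. f (p $ 1, p $ 2)) has_derivative
    (\<lambda>v. f1 (p $ 1, p $ 2) * v $ 1 + f2 (p $ 1, p $ 2) * v $ 2)) (at p)"
proof -
  have "(f has_derivative (\<lambda>v. f1 (p $ 1, p $ 2) * fst v + f2 (p $ 1, p $ 2) * snd v)) (at (p $ 1, p $ 2))"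
    using assms by (simp add: jet1_def)
  moreover have "((\<lambda>p :: real^4. (p $ 1, p $ 2)) has_derivative (\<lambda>v. (v $ 1, v $ 2))) (at p)"
    by (intro has_derivative_Pair bounded_linear_imp_has_derivative bounded_linear_vec_nth)
  ultimately have "((\<lambda>p :: real^4. f (p $ 1, p $ 2)) has_derivative
      (\<lambda>v. f1 (p $ 1, p $ 2) * fst (v $ 1, v $ 2) + f2 (p $ 1, p $ 2) * snd (v $ 1, v $ 2))) (at p)"
    by (rule has_derivative_compose[rotated])
  then show ?thesis by simp
qed

lemma lift_jet2:
  fixes W :: "(real \<times> real) set" and f f1 f2
  assumes j: "jet2 W f f1 f2 f11 f12 f22" and W: "open W"
  defines "S \<equiv> {p :: real^4. (p $ 1, p $ 2) \<in> W}"
    and "F \<equiv> \<lambda>p :: real^4. f (p $ 1, p $ 2)"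
  assumes p: "p \<in> S"
  shows "F differentiable at p"
    and "pd UNIV (axis m 1) F p = (if m = 1 then f1 (p $ 1, p $ 2) else if m = 2 then f2 (p $ 1, p $ 2) else 0)"
    and "pd UNIV (axis m 1) F differentiable at p"
    and "pd UNIV (axis n 1) (pd UNIV (axis m 1) F) p
      = (if m = 1 then (if n = 1 then f11 (p $ 1, p $ 2) else if n = 2 then f12 (p $ 1, p $ 2) else 0)
         else if m = 2 then (if n = 1 then f12 (p $ 1, p $ 2) else if n = 2 then f22 (p $ 1, p $ 2) else 0)
         else 0)"
proof -
  have S: "open S"
    unfolding S_def using W by (intro open_vimage[of W "\<lambda>p. (p $ 1, p $ 2)", unfolded vimage_def] continuous_intros) auto
  have pd_lift: "pd UNIV (axis m 1) (\<lambda>p :: real^4. g (p $ 1, p $ 2)) p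
      = (if m = 1 then g1 (p $ 1, p $ 2) else if m = 2 then g2 (p $ 1, p $ 2) else 0)"
    if "jet1 W g g1 g2" "p \<in> S" for g g1 g2 m p
    using pd_has_derivative[OF lift_has_derivative[OF that(1)], of p "axis m 1"] that(2) exhaust_4[of m]
    by (auto simp: S_def axis_def)
  show "F differentiable at p"
    using lift_has_derivative[of W f f1 f2 p] j p unfolding differentiable_def F_def S_def jet2_def by blast
  have F1: "pd UNIV (axis m 1) F p
      = (if m = 1 then f1 (p $ 1, p $ 2) else if m = 2 then f2 (p $ 1, p $ 2) else 0)" if "p \<in> S" for p
    unfolding F_def using j that by (intro pd_lift) (auto simp: jet2_def)
  then show "pd UNIV (axis m 1) F p
      = (if m = 1 then f1 (p $ 1, p $ 2) else if m = 2 then f2 (p $ 1, p $ 2) else 0)" using p .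
  let ?F1 = "\<lambda>p :: real^4. (if m = 1 then f1 (p $ 1, p $ 2) else if m = 2 then f2 (p $ 1, p $ 2) else 0)"
  have "\<exists>D. (?F1 has_derivative D) (at p)"
    using lift_has_derivative[of W f1 f11 f12 p] lift_has_derivative[of W f2 f12 f22 p] j p
    unfolding S_def jet2_def by (cases "m = 1"; cases "m = 2") (auto intro: has_derivative_const)
  then obtain D where "(?F1 has_derivative D) (at p)" ..
  then have "(pd UNIV (axis m 1) F has_derivative D) (at p)"
    by (rule has_derivative_transform_within_open[OF _ S p]) (rule F1[symmetric])
  then show "pd UNIV (axis m 1) F differentiable at p" unfolding differentiable_def by blast
  have "pd UNIV (axis n 1) (pd UNIV (axis m 1) F) p = pd UNIV (axis n 1) ?F1 p"
    by (rule pd_interior[OF S subset_UNIV p]) (rule F1)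
  also have "\<dots> = (if m = 1 then (if n = 1 then f11 (p $ 1, p $ 2) else if n = 2 then f12 (p $ 1, p $ 2) else 0)
         else if m = 2 then (if n = 1 then f12 (p $ 1, p $ 2) else if n = 2 then f22 (p $ 1, p $ 2) else 0)
         else 0)"
    using pd_lift[of f1 f11 f12 p n] pd_lift[of f2 f12 f22 p n] j p
    by (cases "m = 1"; cases "m = 2") (auto simp: jet2_def pd_const)
  finally show "pd UNIV (axis n 1) (pd UNIV (axis m 1) F) p = \<dots>" .
qed

text \<open>Kaluza-Klein form \<open>- N dR^2 + P d\<theta>^2 + u (dx^1 + A dx^2 + (G + A H)
  d\<theta>)^2 + w (dx^2 + H d\<theta>)^2\<close>. Keeping \<open>N\<close>, \<open>P\<close>,
  \<open>u\<close>, \<open>w\<close> general postpones the exponentials until the curvature has been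
  computed.\<close>

definition kk_entry where
  "kk_entry N P u w A G H q = sym4 (- N q)
     (P q + u q * (G q + A q * H q) * (G q + A q * H q) + w q * H q * H q)
     (u q * (G q + A q * H q)) (u q * A q * (G q + A q * H q) + w q * H q)
     (u q) (u q * A q) (u q * A q * A q + w q)"

text \<open>Read off from the dual frame: \<open>\<partial>_R\<close>,
  \<open>\<partial>_\<theta> - G \<partial>_1 - H \<partial>_2\<close>, \<open>\<partial>_1\<close>
  and \<open>\<partial>_2 - A \<partial>_1\<close> are orthogonal, with squared lengths
  \<open>- N\<close>, \<open>P\<close>, \<open>u\<close>, \<open>w\<close>.\<close>

definition kk_inverse where
  "kk_inverse N P u w A G H q = sym4 (- inverse (N q)) (inverse (P q))
     (- G q * inverse (P q)) (- H q * inverse (P q))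
     (inverse (u q) + A q * A q * inverse (w q) + G q * G q * inverse (P q))
     (- A q * inverse (w q) + G q * H q * inverse (P q))
     (inverse (w q) + H q * H q * inverse (P q))"

lemma t2_metric_eq_kk_entry:
  "t2_metric \<eta> U a A G H p $ i $ j
    = kk_entry (\<lambda>q. exp (2 * (\<eta> q - U q))) (\<lambda>q. exp (2 * (\<eta> q - U q)) * inverse ((a q)\<^sup>2))
        (\<lambda>q. exp (2 * U q)) (\<lambda>q. exp (- 2 * U q) * (fst q)\<^sup>2) A G H (p $ 1, p $ 2) i j"
  using exhaust_4[of i] exhaust_4[of j]
  by (elim disjE; simp add: t2_metric_def t2_metric_form_def kk_entry_def Let_def axis_def power2_eq_square)

lemma kk_inverse_inverse:
  assumes "N q \<noteq> 0" "P q \<noteq> 0" "u q \<noteq> 0" "w q \<noteq> 0"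
  shows "(\<chi> i j. kk_entry N P u w A G H q i j) ** (\<chi> i j. kk_inverse N P u w A G H q i j) = mat 1"
    "(\<chi> i j. kk_inverse N P u w A G H q i j) ** (\<chi> i j. kk_entry N P u w A G H q i j) = mat 1"
proof -
  show "(\<chi> i j. kk_entry N P u w A G H q i j) ** (\<chi> i j. kk_inverse N P u w A G H q i j) = mat 1"
    using assms by (simp add: vec_eq_iff forall_4 matrix_matrix_mult_def mat_def sum_4 kk_entry_def kk_inverse_def)
      (simp add: field_simps)
  show "(\<chi> i j. kk_inverse N P u w A G H q i j) ** (\<chi> i j. kk_entry N P u w A G H q i j) = mat 1"
    using assms by (simp add: vec_eq_iff forall_4 matrix_matrix_mult_def mat_def sum_4 kk_entry_def kk_inverse_def)
      (simp add: field_simps)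
qed

text \<open>Each column is a coordinate vector plus a vector along the torus orbits.
  Derivatives along the orbits vanish, so changing basis by such a matrix acts on the derivatives of
  the metric by plain multilinear algebra.\<close>

definition shear :: "real \<Rightarrow> real \<Rightarrow> real \<Rightarrow> 4 \<Rightarrow> 4 \<Rightarrow> real" where
  "shear A G H a i = (if a = i then 1 else if a = 3 \<and> i = 2 then G
     else if a = 4 \<and> i = 2 then H else if a = 3 \<and> i = 4 then A else 0)"

lemma dn_shear [simp]:
  "dn (shear A G H) Y 1 = Y 1" "dn (shear A G H) Y 2 = Y 2 + G * Y 3 + H * Y 4"
  "dn (shear A G H) Y 3 = Y 3" "dn (shear A G H) Y 4 = Y 4 + A * Y 3"
  by (simp_all add: dn_def sum_4 shear_def)

lemma up_shear [simp]:
  "up (shear A G H) X 1 = X 1" "up (shear A G H) X 2 = X 2"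
  "up (shear A G H) X 3 = X 3 + G * X 2 + A * X 4" "up (shear A G H) X 4 = X 4 + H * X 2"
  by (simp_all add: up_def sum_4 shear_def)

lemma shear_inverse:
  "(\<Sum>k\<in>UNIV. shear (- A) (- G) (- H) a k * shear A (G + A * H) H k c) = (if a = c then 1 else 0)"
  using exhaust_4[of a] exhaust_4[of c] by (elim disjE; simp add: sum_4 shear_def)

lemma dn_shear_sym4:
  "dn (shear (- A) (- G) (- H)) (\<lambda>b'. dn (shear (- A) (- G) (- H)) (\<lambda>c'. sym4 n p b c u v w b' c') j) i
    = sym4 n (p - 2 * G * b - 2 * H * c + G * G * u + 2 * G * H * v + H * H * w) (b - G * u - H * v)
        (c - A * b - G * (v - A * u) - H * (w - A * v)) u (v - A * u) (w - 2 * A * v + A * A * u) i j"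
  using exhaust_4[of i] exhaust_4[of j] by (elim disjE; simp add: algebra_simps)

lemma jet1_sym4:
  assumes "jet1 W n n1 n2" "jet1 W p p1 p2" "jet1 W b b1 b2" "jet1 W c c1 c2" "jet1 W u u1 u2"
    "jet1 W v v1 v2" "jet1 W w w1 w2"
  shows "jet1 W (\<lambda>q. sym4 (n q) (p q) (b q) (c q) (u q) (v q) (w q) i j)
    (\<lambda>q. sym4 (n1 q) (p1 q) (b1 q) (c1 q) (u1 q) (v1 q) (w1 q) i j)
    (\<lambda>q. sym4 (n2 q) (p2 q) (b2 q) (c2 q) (u2 q) (v2 q) (w2 q) i j)"
  using exhaust_4[of i] exhaust_4[of j] by (elim disjE; simp add: assms jet1_const)

lemma jet2_sym4:
  assumes "jet2 W n n1 n2 n11 n12 n22" "jet2 W p p1 p2 p11 p12 p22" "jet2 W b b1 b2 b11 b12 b22"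
    "jet2 W c c1 c2 c11 c12 c22" "jet2 W u u1 u2 u11 u12 u22" "jet2 W v v1 v2 v11 v12 v22"
    "jet2 W w w1 w2 w11 w12 w22"
  shows "jet2 W (\<lambda>q. sym4 (n q) (p q) (b q) (c q) (u q) (v q) (w q) i j)
    (\<lambda>q. sym4 (n1 q) (p1 q) (b1 q) (c1 q) (u1 q) (v1 q) (w1 q) i j)
    (\<lambda>q. sym4 (n2 q) (p2 q) (b2 q) (c2 q) (u2 q) (v2 q) (w2 q) i j)
    (\<lambda>q. sym4 (n11 q) (p11 q) (b11 q) (c11 q) (u11 q) (v11 q) (w11 q) i j)
    (\<lambda>q. sym4 (n12 q) (p12 q) (b12 q) (c12 q) (u12 q) (v12 q) (w12 q) i j)
    (\<lambda>q. sym4 (n22 q) (p22 q) (b22 q) (c22 q) (u22 q) (v22 q) (w22 q) i j)"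
  using assms by (simp add: jet2_def jet1_sym4)

lemma differentiable_sym4:
  assumes "n differentiable F" "p differentiable F" "b differentiable F" "c differentiable F"
    "u differentiable F" "v differentiable F" "w differentiable F"
  shows "(\<lambda>y. sym4 (n y) (p y) (b y) (c y) (u y) (v y) (w y) i j) differentiable F"
  using exhaust_4[of i] exhaust_4[of j] assms by (elim disjE; simp)

text \<open>The conclusions are multiples of \<open>Ric\<^sub>3\<^sub>3\<close>, \<open>Ric\<^sub>3\<^sub>4\<close>, \<open>Ric\<^sub>4\<^sub>4\<close> and of the Hamiltonian constraint, in the frame
  that diagonalizes the metric at \<open>q\<close>.  The Greek letters are logarithmic derivatives, and \<open>\<alpha> = N / P\<close>,
  \<open>\<rho> = u / w\<close>.\<close>

lemma kk_vacuum_equations: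
  assumes W: "open W" and D: "\<And>p. (p $ 1, p $ 2) \<in> W \<Longrightarrow> p \<in> D"
    and jN: "jet2 W N N1 N2 N11 N12 N22" and jP: "jet2 W P P1 P2 P11 P12 P22"
    and ju: "jet2 W u u1 u2 u11 u12 u22" and jw: "jet2 W w w1 w2 w11 w12 w22"
    and jA: "jet2 W A A1 A2 A11 A12 A22" and jG: "jet2 W G G1 G2 G11 G12 G22"
    and jH: "jet2 W H H1 H2 H11 H12 H22"
    and pos: "\<And>q. q \<in> W \<Longrightarrow> N q > 0" "\<And>q. q \<in> W \<Longrightarrow> P q > 0"
      "\<And>q. q \<in> W \<Longrightarrow> u q > 0" "\<And>q. q \<in> W \<Longrightarrow> w q > 0"
    and flat: "\<And>p i j. (p $ 1, p $ 2) \<in> W \<Longrightarrow>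
      ricci D (\<lambda>p. \<chi> i j. kk_entry N P u w A G H (p $ 1, p $ 2) i j) i j p = 0"
    and q: "q \<in> W" and twist: "G1 q + A q * H1 q = 0"
    and logs: "N1 q = N q * \<nu>1" "N2 q = N q * \<nu>2" "P1 q = P q * \<pi>1" "P2 q = P q * \<pi>2"
      "u1 q = u q * \<mu>1" "u2 q = u q * \<mu>2" "u11 q = u q * \<mu>11" "u22 q = u q * \<mu>22"
      "w1 q = w q * \<omega>1" "w2 q = w q * \<omega>2" "w11 q = w q * \<omega>11" "w22 q = w q * \<omega>22"
      "N q = \<alpha> * P q" "u q = \<rho> * w q"
  shows "1/2 * \<mu>11 - 1/4 * \<nu>1 * \<mu>1 - 1/2 * \<alpha> * \<mu>22 + 1/4 * \<alpha> * \<pi>2 * \<mu>2 - 1/4 * \<alpha> * \<nu>2 * \<mu>2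
      - 1/4 * \<mu>1 * \<mu>1 - 1/2 * \<rho> * A1 q * A1 q + 1/4 * \<pi>1 * \<mu>1 + 1/4 * \<alpha> * \<mu>2 * \<mu>2
      + 1/2 * \<alpha> * \<rho> * A2 q * A2 q + 1/4 * \<mu>1 * \<omega>1 - 1/4 * \<alpha> * \<mu>2 * \<omega>2 = 0" (is "?e33 = 0")
    and "1/2 * (A11 q + 2 * \<mu>1 * A1 q) - 1/4 * \<nu>1 * A1 q - 1/2 * \<alpha> * (A22 q + 2 * \<mu>2 * A2 q)
      + 1/4 * \<alpha> * \<pi>2 * A2 q - 1/4 * \<alpha> * \<nu>2 * A2 q - 1/4 * \<mu>1 * A1 q - 1/4 * A1 q * \<omega>1
      + 1/4 * \<pi>1 * A1 q + 1/4 * \<alpha> * \<mu>2 * A2 q + 1/4 * \<alpha> * A2 q * \<omega>2 = 0" (is "?e34 = 0")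
    and "1/2 * (\<omega>11 + 2 * \<rho> * A1 q * A1 q) - 1/4 * \<nu>1 * \<omega>1 - 1/2 * \<alpha> * (\<omega>22 + 2 * \<rho> * A2 q * A2 q)
      + 1/4 * \<alpha> * \<pi>2 * \<omega>2 - 1/4 * \<alpha> * \<nu>2 * \<omega>2 - 1/2 * (H1 q * H1 q * w q * inverse (P q))
      - 1/2 * \<rho> * A1 q * A1 q - 1/4 * \<omega>1 * \<omega>1 + 1/4 * \<pi>1 * \<omega>1 + 1/2 * \<alpha> * \<rho> * A2 q * A2 q
      + 1/4 * \<alpha> * \<omega>2 * \<omega>2 + 1/4 * \<mu>1 * \<omega>1 - 1/4 * \<alpha> * \<mu>2 * \<omega>2 = 0" (is "?e44 = 0")
    and "\<alpha> * \<mu>22 - 1/2 * \<alpha> * \<mu>2 * \<mu>2 - 3/2 * \<alpha> * \<rho> * A2 q * A2 q + \<alpha> * (\<omega>22 + 2 * \<rho> * A2 q * A2 q)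
      - 1/2 * \<alpha> * \<omega>2 * \<omega>2 - 1/2 * \<pi>1 * \<mu>1 - 1/2 * \<alpha> * \<pi>2 * \<mu>2 - 1/2 * \<pi>1 * \<omega>1
      - 1/2 * \<alpha> * \<pi>2 * \<omega>2 - 1/2 * \<mu>1 * \<omega>1 + 1/2 * \<alpha> * \<mu>2 * \<omega>2
      + 1/2 * (H1 q * H1 q * w q * inverse (P q)) + 1/2 * \<rho> * A1 q * A1 q = 0" (is "?ham = 0")
proof -
  \<comment> \<open>Any point over \<open>q\<close> would do, as the coefficients do not depend on
    the torus coordinates.\<close>
  define p :: "real^4" where "p = vector [fst q, snd q, 0, 0]"
  have p: "(p $ 1, p $ 2) = q" by (simp add: p_def vector_def)
  define S where "S = {p :: real^4. (p $ 1, p $ 2) \<in> W}"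
  have S: "open S"
    unfolding S_def using W by (intro open_vimage[of W "\<lambda>p. (p $ 1, p $ 2)", unfolded vimage_def] continuous_intros) auto
  have SD: "S \<subseteq> D" and pS: "p \<in> S" using D q p by (auto simp: S_def)
  note jB = jet2_add[OF jG jet2_mult[OF jA jH]]
  \<comment> \<open>Values are recorded only for derivatives that enter the four equations; the
    second derivatives of \<open>N\<close> and of the entries with index 2 drop out of them.\<close>
  obtain b1 b2 b11 b12 b22 where jb: "jet2 W (\<lambda>q. u q * (G q + A q * H q)) b1 b2 b11 b12 b22"
    and b1: "b1 q = u1 q * (G q + A q * H q) + u q * (G1 q + A1 q * H q + A q * H1 q)"
    and b2: "b2 q = u2 q * (G q + A q * H q) + u q * (G2 q + A2 q * H q + A q * H2 q)"
    by (rule that[OF jet2_mult[OF ju jB]]) (simp_all add: algebra_simps)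
  obtain c1 c2 c11 c12 c22 where jc: "jet2 W (\<lambda>q. u q * A q * (G q + A q * H q) + w q * H q) c1 c2 c11 c12 c22"
    and c1: "c1 q = u1 q * A q * (G q + A q * H q) + u q * A1 q * (G q + A q * H q)
      + u q * A q * (G1 q + A1 q * H q + A q * H1 q) + w1 q * H q + w q * H1 q"
    and c2: "c2 q = u2 q * A q * (G q + A q * H q) + u q * A2 q * (G q + A q * H q)
      + u q * A q * (G2 q + A2 q * H q + A q * H2 q) + w2 q * H q + w q * H2 q"
    by (rule that[OF jet2_add[OF jet2_mult[OF jet2_mult[OF ju jA] jB] jet2_mult[OF jw jH]]])
      (simp_all add: algebra_simps)
  obtain v1 v2 v11 v12 v22 where jv: "jet2 W (\<lambda>q. u q * A q) v1 v2 v11 v12 v22"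
    and v: "v1 q = u1 q * A q + u q * A1 q" "v2 q = u2 q * A q + u q * A2 q"
      "v11 q = u11 q * A q + 2 * u1 q * A1 q + u q * A11 q" "v22 q = u22 q * A q + 2 * u2 q * A2 q + u q * A22 q"
    by (rule that[OF jet2_mult[OF ju jA]]) simp_all
  obtain x1 x2 x11 x12 x22 where jx: "jet2 W (\<lambda>q. u q * A q * A q + w q) x1 x2 x11 x12 x22"
    and x: "x1 q = u1 q * A q * A q + 2 * u q * A q * A1 q + w1 q"
      "x2 q = u2 q * A q * A q + 2 * u q * A q * A2 q + w2 q"
      "x11 q = u11 q * A q * A q + 4 * u1 q * A q * A1 q + 2 * u q * A1 q * A1 q + 2 * u q * A q * A11 q + w11 q"
      "x22 q = u22 q * A q * A q + 4 * u2 q * A q * A2 q + 2 * u q * A2 q * A2 q + 2 * u q * A q * A22 q + w22 q"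
    by (rule that[OF jet2_add[OF jet2_mult[OF jet2_mult[OF ju jA] jA] jw]]) (simp_all add: algebra_simps)
  obtain y1 y2 y11 y12 y22 where jy: "jet2 W (\<lambda>q. P q + u q * (G q + A q * H q) * (G q + A q * H q) + w q * H q * H q) y1 y2 y11 y12 y22"
    and y: "y1 q = P1 q + u1 q * (G q + A q * H q) * (G q + A q * H q)
        + 2 * u q * (G q + A q * H q) * (G1 q + A1 q * H q + A q * H1 q) + w1 q * H q * H q + 2 * w q * H q * H1 q"
      "y2 q = P2 q + u2 q * (G q + A q * H q) * (G q + A q * H q)
        + 2 * u q * (G q + A q * H q) * (G2 q + A2 q * H q + A q * H2 q) + w2 q * H q * H q + 2 * w q * H q * H2 q"
    by (rule that[OF jet2_add[OF jet2_add[OF jP jet2_mult[OF jet2_mult[OF ju jB] jB]] jet2_mult[OF jet2_mult[OF jw jH] jH]]])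
      (simp_all add: algebra_simps)
  obtain n1 n2 n11 n12 n22 where jn: "jet2 W (\<lambda>q. - N q) n1 n2 n11 n12 n22"
    and n: "n1 q = - N1 q" "n2 q = - N2 q"
    by (rule that[OF jet2_mult[OF jet2_const[of W "-1"] jN, simplified]]) simp_all
  let ?g = "\<lambda>p. \<chi> i j. kk_entry N P u w A G H (p $ 1, p $ 2) i j"
  let ?h = "\<lambda>p :: real^4. \<chi> i j. kk_inverse N P u w A G H (p $ 1, p $ 2) i j"
  note J = jet2_sym4[OF jn jy jb jc ju jv jx, folded kk_entry_def]
  note lift = lift_jet2[OF J W, folded S_def]
  let ?dg = "\<lambda>m i j. pd UNIV (axis m 1) (\<lambda>p. ?g p $ i $ j) p"
  let ?ddg = "\<lambda>m n i j. pd UNIV (axis m 1) (pd UNIV (axis n 1) (\<lambda>p. ?g p $ i $ j)) p"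
  have jet: "ricci D ?g i j p = ricci_jet (\<lambda>k l. ?h p $ k $ l) ?dg ?ddg i j" for i j
  proof (rule ricci_eq_ricci_jet[OF S SD pS])
    fix y :: "real^4" assume y: "y \<in> S"
    then have yW: "(y $ 1, y $ 2) \<in> W" by (simp add: S_def)
    from kk_inverse_inverse[of N _ P u w A G H] pos[OF yW]
    show "?g y ** ?h y = mat 1" "?h y ** ?g y = mat 1" by (metis less_irrefl)+
    show "(\<lambda>y. ?g y $ i $ j) differentiable at y" for i j
      using lift(1)[OF y] by simp
    show "pd UNIV (axis m 1) (\<lambda>y. ?g y $ i $ j) differentiable at y" for m i j
      using lift(3)[OF y] by simp
    have d: "(\<lambda>p :: real^4. f (p $ 1, p $ 2)) differentiable at y" if "jet2 W f f1 f2 f11 f12 f22" for f f1 f2 f11 f12 f22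
      using lift_jet2(1)[OF that W, folded S_def] y by simp
    have inv: "(\<lambda>p :: real^4. inverse (f (p $ 1, p $ 2))) differentiable at y"
      if "jet2 W f f1 f2 f11 f12 f22" "f (y $ 1, y $ 2) > 0" for f f1 f2 f11 f12 f22
      using that d by (intro differentiable_inverse) auto
    note D = d[OF jA] d[OF jG] d[OF jH] inv[OF jN pos(1)[OF yW]] inv[OF jP pos(2)[OF yW]]
      inv[OF ju pos(3)[OF yW]] inv[OF jw pos(4)[OF yW]]
    show "(\<lambda>y. ?h y $ i $ j) differentiable at y" for i j
      unfolding vec_lambda_beta kk_inverse_def
      by (intro differentiable_sym4 differentiable_add differentiable_mult differentiable_minus D)
  qed
  \<comment> \<open>The columns of \<open>L\<close> are the dual frame with \<open>A\<close>,
    \<open>G\<close>, \<open>H\<close> frozen at \<open>q\<close>; composing the shears in its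
    inverse \<open>M\<close> produces \<open>G + A H\<close>.\<close>
  define L where "L = shear (- A q) (- G q) (- H q)"
  define M where "M = shear (A q) (G q + A q * H q) (H q)"
  define dg' where "dg' m i j = dn L (\<lambda>a. dn L (\<lambda>b. dn L (\<lambda>c. ?dg a b c) j) i) m" for m i j
  define ddg' where "ddg' m n i j = dn L (\<lambda>e. dn L (\<lambda>a. dn L (\<lambda>b. dn L (\<lambda>c. ?ddg e a b c) j) i) n) m" for m n i j
  define h' where "h' k l = up M (\<lambda>c. up M (\<lambda>d. ?h p $ c $ d) l) k" for k l
  have R0: "ricci_jet h' dg' ddg' i j = 0" for i j
  proof -
    have "ricci_jet h' dg' ddg' i j = dn L (\<lambda>a. dn L (\<lambda>b. ricci D ?g a b p) j) i"
      unfolding jet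
      by (rule ricci_jet_covariant[OF _ h'_def dg'_def ddg'_def]) (simp add: L_def M_def shear_inverse)
    then show ?thesis using flat q by (simp add: p dn_def)
  qed
  have dgv: "?dg m i j = (if m = 1 then sym4 (n1 q) (y1 q) (b1 q) (c1 q) (u1 q) (v1 q) (x1 q) i j
      else if m = 2 then sym4 (n2 q) (y2 q) (b2 q) (c2 q) (u2 q) (v2 q) (x2 q) i j else 0)" for m i j
    using lift(2)[OF pS, unfolded p] by simp
  have ddgv: "?ddg m k i j = (if k = 1 then
        (if m = 1 then sym4 (n11 q) (y11 q) (b11 q) (c11 q) (u11 q) (v11 q) (x11 q) i j
         else if m = 2 then sym4 (n12 q) (y12 q) (b12 q) (c12 q) (u12 q) (v12 q) (x12 q) i j else 0)
      else if k = 2 then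
        (if m = 1 then sym4 (n12 q) (y12 q) (b12 q) (c12 q) (u12 q) (v12 q) (x12 q) i j
         else if m = 2 then sym4 (n22 q) (y22 q) (b22 q) (c22 q) (u22 q) (v22 q) (x22 q) i j else 0)
      else 0)" for m k i j
    using lift(4)[OF pS, unfolded p] by simp
  have h'v: "h' = sym4 (- inverse (N q)) (inverse (P q)) 0 0 (inverse (u q)) 0 (inverse (w q))"
  proof (intro ext)
    show "h' i j = sym4 (- inverse (N q)) (inverse (P q)) 0 0 (inverse (u q)) 0 (inverse (w q)) i j" for i j
      unfolding h'_def M_def vec_lambda_beta p kk_inverse_def using exhaust_4[of i] exhaust_4[of j]
      by (elim disjE; simp add: algebra_simps)
  qed
  note dns = dn_zero dn_shear_sym4[of "A q" "G q" "H q", folded L_def]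
  have L: "dn L Y 1 = Y 1" "dn L Y 2 = Y 2 - G q * Y 3 - H q * Y 4" "dn L Y 3 = Y 3" "dn L Y 4 = Y 4 - A q * Y 3" for Y
    by (simp_all add: L_def)
  have d1': "dg' 1 = sym4 (n1 q) (y1 q - 2 * G q * b1 q - 2 * H q * c1 q + G q * G q * u1 q + 2 * G q * H q * v1 q + H q * H q * x1 q)
      (b1 q - G q * u1 q - H q * v1 q) (c1 q - A q * b1 q - G q * (v1 q - A q * u1 q) - H q * (x1 q - A q * v1 q))
      (u1 q) (v1 q - A q * u1 q) (x1 q - 2 * A q * v1 q + A q * A q * u1 q)"
    unfolding fun_eq_iff dg'_def L(1) dgv by (simp add: dns)
  have d2': "dg' 2 = sym4 (n2 q) (y2 q - 2 * G q * b2 q - 2 * H q * c2 q + G q * G q * u2 q + 2 * G q * H q * v2 q + H q * H q * x2 q)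
      (b2 q - G q * u2 q - H q * v2 q) (c2 q - A q * b2 q - G q * (v2 q - A q * u2 q) - H q * (x2 q - A q * v2 q))
      (u2 q) (v2 q - A q * u2 q) (x2 q - 2 * A q * v2 q + A q * A q * u2 q)"
    unfolding fun_eq_iff dg'_def L(2) dgv by (simp add: dns)
  have d0: "dg' 3 = (\<lambda>i j. 0)" "dg' 4 = (\<lambda>i j. 0)"
    unfolding fun_eq_iff dg'_def dgv L by (simp_all add: dns)
  have d11: "ddg' 1 1 = sym4 (n11 q) (y11 q - 2 * G q * b11 q - 2 * H q * c11 q + G q * G q * u11 q + 2 * G q * H q * v11 q + H q * H q * x11 q)
      (b11 q - G q * u11 q - H q * v11 q) (c11 q - A q * b11 q - G q * (v11 q - A q * u11 q) - H q * (x11 q - A q * v11 q))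
      (u11 q) (v11 q - A q * u11 q) (x11 q - 2 * A q * v11 q + A q * A q * u11 q)"
    unfolding fun_eq_iff ddg'_def L(1) L(1) ddgv by (simp add: dns)
  have d12: "ddg' 1 2 = sym4 (n12 q) (y12 q - 2 * G q * b12 q - 2 * H q * c12 q + G q * G q * u12 q + 2 * G q * H q * v12 q + H q * H q * x12 q)
      (b12 q - G q * u12 q - H q * v12 q) (c12 q - A q * b12 q - G q * (v12 q - A q * u12 q) - H q * (x12 q - A q * v12 q))
      (u12 q) (v12 q - A q * u12 q) (x12 q - 2 * A q * v12 q + A q * A q * u12 q)"
    unfolding fun_eq_iff ddg'_def L(1) L(2) ddgv by (simp add: dns)
  have d21: "ddg' 2 1 = sym4 (n12 q) (y12 q - 2 * G q * b12 q - 2 * H q * c12 q + G q * G q * u12 q + 2 * G q * H q * v12 q + H q * H q * x12 q)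
      (b12 q - G q * u12 q - H q * v12 q) (c12 q - A q * b12 q - G q * (v12 q - A q * u12 q) - H q * (x12 q - A q * v12 q))
      (u12 q) (v12 q - A q * u12 q) (x12 q - 2 * A q * v12 q + A q * A q * u12 q)"
    unfolding fun_eq_iff ddg'_def L(2) L(1) ddgv by (simp add: dns)
  have d22: "ddg' 2 2 = sym4 (n22 q) (y22 q - 2 * G q * b22 q - 2 * H q * c22 q + G q * G q * u22 q + 2 * G q * H q * v22 q + H q * H q * x22 q)
      (b22 q - G q * u22 q - H q * v22 q) (c22 q - A q * b22 q - G q * (v22 q - A q * u22 q) - H q * (x22 q - A q * v22 q))
      (u22 q) (v22 q - A q * u22 q) (x22 q - 2 * A q * v22 q + A q * A q * u22 q)"
    unfolding fun_eq_iff ddg'_def L(2) L(2) ddgv by (simp add: dns)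
  have d00: "ddg' m 3 = (\<lambda>i j. 0)" "ddg' m 4 = (\<lambda>i j. 0)" "ddg' 3 m = (\<lambda>i j. 0)" "ddg' 4 m = (\<lambda>i j. 0)" for m
    unfolding fun_eq_iff ddg'_def ddgv L using exhaust_4[of m] by (auto simp: dns L)
  \<comment> \<open>In this frame \<open>A\<close>, \<open>G\<close>, \<open>H\<close> disappear
    except through derivatives. What remains of the \<open>R\<close>-derivatives of the
    \<theta>-orbit entries is the curvature, \<open>u (G_R + A H_R)\<close> and
    \<open>w H_R\<close>, and the first vanishes by the assumption \<open>twist\<close>.\<close>
  have E: "y1 q - 2 * G q * b1 q - 2 * H q * c1 q + G q * G q * u1 q + 2 * G q * H q * v1 q + H q * H q * x1 q = P1 q"
    "y2 q - 2 * G q * b2 q - 2 * H q * c2 q + G q * G q * u2 q + 2 * G q * H q * v2 q + H q * H q * x2 q = P2 q"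
    "b1 q - G q * u1 q - H q * v1 q = u q * (G1 q + A q * H1 q)"
    "c1 q - A q * b1 q - G q * (u q * A1 q) - H q * (x1 q - A q * v1 q) = w q * H1 q"
    "v1 q - A q * u1 q = u q * A1 q" "v2 q - A q * u2 q = u q * A2 q"
    "v11 q - A q * u11 q = u q * A11 q + 2 * u1 q * A1 q" "v22 q - A q * u22 q = u q * A22 q + 2 * u2 q * A2 q"
    "x1 q - 2 * A q * v1 q + A q * A q * u1 q = w1 q" "x2 q - 2 * A q * v2 q + A q * A q * u2 q = w2 q"
    "x11 q - 2 * A q * v11 q + A q * A q * u11 q = w11 q + 2 * u q * A1 q * A1 q"
    "x22 q - 2 * A q * v22 q + A q * A q * u22 q = w22 q + 2 * u q * A2 q * A2 q"
    by (simp_all add: y b1 b2 c1 c2 v x algebra_simps)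
  have nz: "P q \<noteq> 0" "w q \<noteq> 0" "\<alpha> \<noteq> 0" "\<rho> \<noteq> 0"
    using pos[OF q] logs(13,14) by auto
  have "?e33 = N q * inverse (u q) * ricci_jet h' dg' ddg' 3 3"
    unfolding ricci_jet_diagonal(3)[OF h'v d1' d2' d0 d11 d12 d21 d22 d00] unfolding E n twist unfolding logs
    using nz by (simp add: field_simps)
  then show "?e33 = 0" by (simp add: R0)
  have "?e34 = N q * inverse (u q) * ricci_jet h' dg' ddg' 3 4"
    unfolding ricci_jet_diagonal(4)[OF h'v d1' d2' d0 d11 d12 d21 d22 d00] unfolding E n twist unfolding logs
    using nz by (simp add: field_simps)
  then show "?e34 = 0" by (simp add: R0)
  have "?e44 = N q * inverse (w q) * ricci_jet h' dg' ddg' 4 4"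
    unfolding ricci_jet_diagonal(5)[OF h'v d1' d2' d0 d11 d12 d21 d22 d00] unfolding E n twist unfolding logs
    using nz by (simp add: field_simps)
  then show "?e44 = 0" by (simp add: R0)
  \<comment> \<open>This is \<open>-2\<close> times the \<open>RR\<close> component of the Einstein
    tensor, the combination in which all second \<open>R\<close>-derivatives cancel.\<close>
  have "?ham = - ricci_jet h' dg' ddg' 1 1 - N q * inverse (P q) * ricci_jet h' dg' ddg' 2 2
      - N q * inverse (u q) * ricci_jet h' dg' ddg' 3 3 - N q * inverse (w q) * ricci_jet h' dg' ddg' 4 4"
    unfolding ricci_jet_diagonal[OF h'v d1' d2' d0 d11 d12 d21 d22 d00] unfolding E n twist unfolding logs
    using nz by (simp add: field_simps)
  then show "?ham = 0" by (simp add: R0)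
qed

section \<open>The areal gauge Einstein equations\<close>

lemma jet2_cmult:
  assumes "jet2 W f f1 f2 f11 f12 f22"
  shows "jet2 W (\<lambda>q. c * f q) (\<lambda>q. c * f1 q) (\<lambda>q. c * f2 q) (\<lambda>q. c * f11 q) (\<lambda>q. c * f12 q) (\<lambda>q. c * f22 q)"
  using jet2_mult[OF jet2_const[of W c] assms] by simp

lemma jet2_diff:
  assumes "jet2 W f f1 f2 f11 f12 f22" "jet2 W g g1 g2 g11 g12 g22"
  shows "jet2 W (\<lambda>q. f q - g q) (\<lambda>q. f1 q - g1 q) (\<lambda>q. f2 q - g2 q)
    (\<lambda>q. f11 q - g11 q) (\<lambda>q. f12 q - g12 q) (\<lambda>q. f22 q - g22 q)"
  using jet2_add[OF assms(1) jet2_cmult[OF assms(2), of "-1"]] by simp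

abbreviation dR :: "(real \<times> real \<Rightarrow> real) \<Rightarrow> real \<times> real \<Rightarrow> real" where
  "dR f \<equiv> pd UNIV (1, 0) f"

abbreviation dT :: "(real \<times> real \<Rightarrow> real) \<Rightarrow> real \<times> real \<Rightarrow> real" where
  "dT f \<equiv> pd UNIV (0, 1) f"

text \<open>Here \<open>e\<close> stands for \<open>e^(4 U)\<close> and \<open>k\<close> for
  \<open>K^2 e^(2 \<eta>)\<close>. Since \<open>u w = R^2\<close>, the second derivatives of
  \<open>U\<close> and the \<open>A\<close> terms are opposite in the equations for \<open>u\<close>
  and \<open>w\<close>. Their sum retains only \<open>a_R\<close> and the twist term; this in turn
  removes \<open>a_R\<close> from the constraint, leaving a first order equation for \<eta>.\<close>

lemma einstein_algebra:
  fixes a R :: real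
  assumes pos: "a > 0" "R > 0"
    and "1/2 * (4 * U1\<^sup>2 + 2 * U11) - 1/4 * (2 * (n1 - U1)) * (2 * U1) - 1/2 * a\<^sup>2 * (4 * U2\<^sup>2 + 2 * U22) + 1/4 * a\<^sup>2 * (2 * (n2 - U2) - 2 * a2 / a) * (2 * U2) - 1/4 * a\<^sup>2 * (2 * (n2 - U2)) * (2 * U2) - 1/4 * (2 * U1) * (2 * U1) - 1/2 * (e / R\<^sup>2) * A1 * A1 + 1/4 * (2 * (n1 - U1) - 2 * a1 / a) * (2 * U1) + 1/4 * a\<^sup>2 * (2 * U2) * (2 * U2) + 1/2 * a\<^sup>2 * (e / R\<^sup>2) * A2 * A2 + 1/4 * (2 * U1) * (2 / R - 2 * U1) - 1/4 * a\<^sup>2 * (2 * U2) * (- 2 * U2) = 0" (is "?e33 = 0")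
    and "1/2 * (A11 + 2 * (2 * U1) * A1) - 1/4 * (2 * (n1 - U1)) * A1 - 1/2 * a\<^sup>2 * (A22 + 2 * (2 * U2) * A2) + 1/4 * a\<^sup>2 * (2 * (n2 - U2) - 2 * a2 / a) * A2 - 1/4 * a\<^sup>2 * (2 * (n2 - U2)) * A2 - 1/4 * (2 * U1) * A1 - 1/4 * A1 * (2 / R - 2 * U1) + 1/4 * (2 * (n1 - U1) - 2 * a1 / a) * A1 + 1/4 * a\<^sup>2 * (2 * U2) * A2 + 1/4 * a\<^sup>2 * A2 * (- 2 * U2) = 0" (is "?e34 = 0")
    and "1/2 * (((2 / R - 2 * U1)\<^sup>2 - 2 * U11 - 2 / R\<^sup>2) + 2 * (e / R\<^sup>2) * A1 * A1) - 1/4 * (2 * (n1 - U1)) * (2 / R - 2 * U1) - 1/2 * a\<^sup>2 * ((4 * U2\<^sup>2 - 2 * U22) + 2 * (e / R\<^sup>2) * A2 * A2) + 1/4 * a\<^sup>2 * (2 * (n2 - U2) - 2 * a2 / a) * (- 2 * U2) - 1/4 * a\<^sup>2 * (2 * (n2 - U2)) * (- 2 * U2) - 1/2 * (k / R ^ 4) - 1/2 * (e / R\<^sup>2) * A1 * A1 - 1/4 * (2 / R - 2 * U1) * (2 / R - 2 * U1) + 1/4 * (2 * (n1 - U1) - 2 * a1 / a) * (2 / R - 2 * U1) + 1/2 * a\<^sup>2 * (e / R\<^sup>2) * A2 * A2 + 1/4 * a\<^sup>2 * (- 2 * U2) * (- 2 * U2) + 1/4 * (2 * U1) * (2 / R -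 2 * U1) - 1/4 * a\<^sup>2 * (2 * U2) * (- 2 * U2) = 0" (is "?e44 = 0")
    and "a\<^sup>2 * (4 * U2\<^sup>2 + 2 * U22) - 1/2 * a\<^sup>2 * (2 * U2) * (2 * U2) - 3/2 * a\<^sup>2 * (e / R\<^sup>2) * A2 * A2 + a\<^sup>2 * ((4 * U2\<^sup>2 - 2 * U22) + 2 * (e / R\<^sup>2) * A2 * A2) - 1/2 * a\<^sup>2 * (- 2 * U2) * (- 2 * U2) - 1/2 * (2 * (n1 - U1) - 2 * a1 / a) * (2 * U1) - 1/2 * a\<^sup>2 * (2 * (n2 - U2) - 2 * a2 / a) * (2 * U2) - 1/2 * (2 * (n1 - U1) - 2 * a1 / a) * (2 / R - 2 * U1) - 1/2 * a\<^sup>2 * (2 * (n2 - U2) - 2 * a2 / a) * (- 2 * U2) - 1/2 * (2 * U1) * (2 / R - 2 * U1) + 1/2 * a\<^sup>2 * (2 * U2) * (- 2 * U2) + 1/2 * (k / R ^ 4) + 1/2 * (e / R\<^sup>2) * A1 * A1 = 0" (is "?ham = 0")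
  shows "a1 = - a * k / (2 * R ^ 3)" (is ?g1)
    and "R * U11 + U1 - R * (a1 / a) * U1 - R * a\<^sup>2 * U22 - R * a * a2 * U2
      - e / (2 * R) * (A1\<^sup>2 - a\<^sup>2 * A2\<^sup>2) = 0" (is "?g2 = 0")
    and "A11 + (4 * U1 - 1 / R - a1 / a) * A1 - a\<^sup>2 * A22 - (4 * U2 * a\<^sup>2 + a * a2) * A2 = 0" (is "?g3 = 0")
    and "n1 + k / (4 * R ^ 3) - R * (U1\<^sup>2 + a\<^sup>2 * U2\<^sup>2 + e / (4 * R\<^sup>2) * (A1\<^sup>2 + a\<^sup>2 * A2\<^sup>2)) = 0" (is "?g4 = 0")
proof -
  let ?E1 = "a1 / a + k / (2 * R ^ 3)"
  have nz: "a \<noteq> 0" "R \<noteq> 0" using pos by auto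
  have "?E1 = - R * (?e33 + ?e44)"
    using nz by (simp add: field_simps power2_eq_square power3_eq_cube power4_eq_xxxx)
  then have E1: "?E1 = 0" by (simp only: assms(3,5) add_0_left mult_zero_right)
  then show ?g1 using pos by (simp add: field_simps add_eq_0_iff)
  have "?g2 = R * ?e33"
    using nz by (simp add: field_simps power2_eq_square power3_eq_cube power4_eq_xxxx)
  then show "?g2 = 0" by (simp only: assms(3) mult_zero_right)
  have "?g3 = 2 * ?e34"
    using nz by (simp add: field_simps power2_eq_square power3_eq_cube power4_eq_xxxx)
  then show "?g3 = 0" by (simp only: assms(4) mult_zero_right)
  have "?g4 = ?E1 - R * ?ham / 2"
    using nz by (simp add: field_simps power2_eq_square power3_eq_cube power4_eq_xxxx)
  then show "?g4 = 0" by (simp only: assms(6) E1 mult_zero_right div_0 diff_zero)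
qed

locale t2_vacuum =
  fixes \<eta> U a A G H :: "real \<times> real \<Rightarrow> real" and R0 K :: real
  assumes R0_pos: "R0 > 0"
    and smooth: "smooth_periodic R0 \<eta>" "smooth_periodic R0 U" "smooth_periodic R0 a"
      "smooth_periodic R0 A" "smooth_periodic R0 G" "smooth_periodic R0 H"
    and a_pos: "\<And>q. q \<in> quot_dom R0 \<Longrightarrow> a q > 0"
    and vacuum: "ricci_flat_on (total_dom R0) (t2_metric \<eta> U a A G H)"
    and K_pos: "K > 0"
    and twist: "\<And>q. q \<in> quot_dom R0 \<Longrightarrow>
      twist R0 \<eta> U a A G H q $ 1 = 0 \<and> twist R0 \<eta> U a A G H q $ 2 = K"
begin

text \<open>The slice \<open>R = R0\<close> is excluded so that every derivative is
  two-sided.\<close>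

definition W :: "(real \<times> real) set" where "W = {0<..<R0} \<times> UNIV"

lemma open_W: "open W"
  unfolding W_def by (intro open_Times) auto

lemma W_sub: "W \<subseteq> quot_dom R0"
  by (auto simp: W_def quot_dom_def)

lemma jet2_smooth:
  assumes "smooth_periodic R0 f"
  shows "jet2 W f (dR f) (dT f) (dR (dR f)) (dT (dR f)) (dT (dT f))"
  using assms by (intro jet2_Ck_on[OF _ open_W W_sub]) (simp add: smooth_periodic_def smooth_on_def)

lemmas jets = smooth[THEN jet2_smooth]

text \<open>Passing from \<open>dx^1\<close> to \<open>dx^1 + A dx^2\<close> diagonalizes the orbit
  metric, so \<open>C_2 - A C_1\<close> involves only \<open>H_R\<close>; with
  \<open>C_1 = 0\<close> this expresses \<open>H_R\<close> through \<open>K\<close>.\<close>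

lemma connection_derivatives:
  assumes q: "q \<in> W"
  shows "dR G q + A q * dR H q = 0" "dR H q = K * exp (2 * \<eta> q) / (a q * fst q ^ 3)"
proof -
  have [simp]: "pd (quot_dom R0) (1, 0) f q = dR f q" for f
    by (rule pd_interior[OF open_W W_sub q]) simp
  have pos: "fst q > 0" "a q > 0" using q W_sub a_pos by (auto simp: W_def)
  let ?c = "exp (- 2 * (\<eta> q - U q)) * a q * fst q"
  have T: "?c * (exp (2 * U q) * dR G q + exp (2 * U q) * A q * dR H q) = 0"
    "?c * (exp (2 * U q) * A q * dR G q + (exp (2 * U q) * (A q)\<^sup>2 + exp (- 2 * U q) * (fst q)\<^sup>2) * dR H q) = K"
    using twist[of q] q W_sub
    by (auto simp: twist_def orbit_metric_def curvature_R\<theta>_def matrix_vector_mult_def sum_2)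
  have "exp (2 * U q) * dR G q + exp (2 * U q) * A q * dR H q = 0"
    using T(1) pos by simp
  then have "exp (2 * U q) * (dR G q + A q * dR H q) = 0"
    by (simp only: distrib_left mult.assoc)
  then show G: "dR G q + A q * dR H q = 0" by simp
  have "?c * (exp (2 * U q) * A q * dR G q + (exp (2 * U q) * (A q)\<^sup>2 + exp (- 2 * U q) * (fst q)\<^sup>2) * dR H q)
      = ?c * (exp (2 * U q) * A q * (dR G q + A q * dR H q) + exp (- 2 * U q) * (fst q)\<^sup>2 * dR H q)"
    by (simp add: algebra_simps power2_eq_square)
  then have "?c * (exp (- 2 * U q) * (fst q)\<^sup>2 * dR H q) = K"
    unfolding T(2) G by (simp only: mult_zero_right add_0_left)
  moreover have "?c * (exp (- 2 * U q) * (fst q)\<^sup>2 * dR H q)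
      = exp (- 2 * (\<eta> q - U q)) * exp (- 2 * U q) * (a q * fst q ^ 3 * dR H q)"
    by (simp add: power2_eq_square power3_eq_cube)
  moreover have "exp (- 2 * (\<eta> q - U q)) * exp (- 2 * U q) = inverse (exp (2 * \<eta> q))"
    by (simp add: exp_add[symmetric] exp_minus[symmetric])
  ultimately have "inverse (exp (2 * \<eta> q)) * (a q * fst q ^ 3 * dR H q) = K" by simp
  then show "dR H q = K * exp (2 * \<eta> q) / (a q * fst q ^ 3)"
    using pos by (simp add: field_simps)
qed

lemma einstein_equations:
  assumes q: "q \<in> W"
  defines "R \<equiv> fst q" and "\<kappa> \<equiv> K\<^sup>2 * exp (2 * \<eta> q)"
  shows "dR a q = - a q * \<kappa> / (2 * R ^ 3)"
    and "R * dR (dR U) q + dR U q - R * (dR a q / a q) * dR U q - R * (a q)\<^sup>2 * dT (dT U) q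
      - R * a q * dT a q * dT U q - exp (4 * U q) / (2 * R) * ((dR A q)\<^sup>2 - (a q)\<^sup>2 * (dT A q)\<^sup>2) = 0"
    and "dR (dR A) q + (4 * dR U q - 1 / R - dR a q / a q) * dR A q - (a q)\<^sup>2 * dT (dT A) q
      - (4 * dT U q * (a q)\<^sup>2 + a q * dT a q) * dT A q = 0"
    and "dR \<eta> q + \<kappa> / (4 * R ^ 3) - R * ((dR U q)\<^sup>2 + (a q)\<^sup>2 * (dT U q)\<^sup>2
      + exp (4 * U q) / (4 * R\<^sup>2) * ((dR A q)\<^sup>2 + (a q)\<^sup>2 * (dT A q)\<^sup>2)) = 0"
proof -
  have pos: "R > 0" "a q > 0" using q W_sub a_pos by (auto simp: W_def R_def)
  have a_nz: "a q > 0" if "q \<in> W" for q using that W_sub a_pos by blast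
  let ?N = "\<lambda>q. exp (2 * (\<eta> q - U q))" and ?P = "\<lambda>q. exp (2 * (\<eta> q - U q)) * inverse ((a q)\<^sup>2)"
    and ?u = "\<lambda>q. exp (2 * U q)" and ?w = "\<lambda>q. exp (- 2 * U q) * (fst q)\<^sup>2"
  let ?\<nu>1 = "2 * (dR \<eta> q - dR U q)" and ?\<nu>2 = "2 * (dT \<eta> q - dT U q)"
  let ?\<pi>1 = "2 * (dR \<eta> q - dR U q) - 2 * dR a q / a q" and ?\<pi>2 = "2 * (dT \<eta> q - dT U q) - 2 * dT a q / a q"
  let ?\<mu>1 = "2 * dR U q" and ?\<mu>2 = "2 * dT U q"
  let ?\<mu>11 = "4 * (dR U q)\<^sup>2 + 2 * dR (dR U) q" and ?\<mu>22 = "4 * (dT U q)\<^sup>2 + 2 * dT (dT U) q"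
  let ?\<omega>1 = "2 / R - 2 * dR U q" and ?\<omega>2 = "- 2 * dT U q"
  let ?\<omega>11 = "(2 / R - 2 * dR U q)\<^sup>2 - 2 * dR (dR U) q - 2 / R\<^sup>2" and ?\<omega>22 = "4 * (dT U q)\<^sup>2 - 2 * dT (dT U) q"
  note jN0 = jet2_exp[OF jet2_cmult[OF jet2_diff[OF jets(1,2)], of 2]]
  obtain N1 N2 N11 N12 N22 where jN: "jet2 W ?N N1 N2 N11 N12 N22"
    and N: "N1 q = ?N q * ?\<nu>1" "N2 q = ?N q * ?\<nu>2"
    by (rule that[OF jN0]) simp_all
  obtain u1 u2 u11 u12 u22 where ju: "jet2 W ?u u1 u2 u11 u12 u22"
    and u: "u1 q = ?u q * ?\<mu>1" "u2 q = ?u q * ?\<mu>2" "u11 q = ?u q * ?\<mu>11" "u22 q = ?u q * ?\<mu>22"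
    by (rule that[OF jet2_exp[OF jet2_cmult[OF jets(2), of 2]]]) (simp_all add: algebra_simps power2_eq_square)
  have ja: "jet2 W (\<lambda>q. inverse ((a q)\<^sup>2)) (\<lambda>q. - 2 * inverse (a q ^ 3) * dR a q) (\<lambda>q. - 2 * inverse (a q ^ 3) * dT a q)
      (\<lambda>q. 6 * inverse (a q ^ 4) * dR a q * dR a q + - 2 * inverse (a q ^ 3) * dR (dR a) q)
      (\<lambda>q. 6 * inverse (a q ^ 4) * dR a q * dT a q + - 2 * inverse (a q ^ 3) * dT (dR a) q)
      (\<lambda>q. 6 * inverse (a q ^ 4) * dT a q * dT a q + - 2 * inverse (a q ^ 3) * dT (dT a) q)"
  proof (rule jet2_chain[OF jets(3)])
    fix q assume "q \<in> W"
    then have nz: "a q \<noteq> 0" using a_nz[of q] by simp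
    show "((\<lambda>x. inverse (x\<^sup>2)) has_real_derivative - 2 * inverse (a q ^ 3)) (at (a q))"
      using nz by (auto intro!: derivative_eq_intros simp: field_simps power2_eq_square power3_eq_cube)
    show "((\<lambda>x. - 2 * inverse (x ^ 3)) has_real_derivative 6 * inverse (a q ^ 4)) (at (a q))"
      using nz by (auto intro!: derivative_eq_intros simp: field_simps power2_eq_square power3_eq_cube power4_eq_xxxx)
  qed
  obtain P1 P2 P11 P12 P22 where jP: "jet2 W ?P P1 P2 P11 P12 P22"
    and P: "P1 q = ?P q * ?\<pi>1" "P2 q = ?P q * ?\<pi>2"
    by (rule that[OF jet2_mult[OF jN0 ja]])
      (use pos in \<open>simp_all add: field_simps power2_eq_square power3_eq_cube\<close>)
  have jw0: "jet2 W (\<lambda>q. exp (- 2 * U q) * (fst q)\<^sup>2) w1 w2 w11 w12 w22"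
    if "jet2 W (\<lambda>q. exp (- 2 * U q) * (fst q * fst q)) w1 w2 w11 w12 w22" for w1 w2 w11 w12 w22
    using that by (simp add: power2_eq_square)
  obtain w1 w2 w11 w12 w22 where jw: "jet2 W ?w w1 w2 w11 w12 w22"
    and w: "w1 q = ?w q * ?\<omega>1" "w2 q = ?w q * ?\<omega>2" "w11 q = ?w q * ?\<omega>11" "w22 q = ?w q * ?\<omega>22"
    by (rule that[OF jw0[OF jet2_mult[OF jet2_exp[OF jet2_cmult[OF jets(2), of "-2"]] jet2_mult[OF jet2_fst jet2_fst]]]])
      (use pos in \<open>simp_all add: R_def field_simps power2_eq_square\<close>)
  have metric: "t2_metric \<eta> U a A G H = (\<lambda>p. \<chi> i j. kk_entry ?N ?P ?u ?w A G H (p $ 1, p $ 2) i j)"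
    by (rule ext) (simp add: vec_eq_iff t2_metric_eq_kk_entry)
  have rel: "?N q = (a q)\<^sup>2 * ?P q" "?u q = exp (4 * U q) / R\<^sup>2 * ?w q"
  proof -
    show "?N q = (a q)\<^sup>2 * ?P q" using pos by simp
    have "exp (4 * U q) * exp (- 2 * U q) = exp (2 * U q)" by (simp flip: exp_add)
    then show "?u q = exp (4 * U q) / R\<^sup>2 * ?w q" using pos by (simp add: R_def field_simps)
  qed
  have dom: "p \<in> total_dom R0" if "(p $ 1, p $ 2) \<in> W" for p
    using that by (auto simp: W_def total_dom_def)
  have flat: "ricci (total_dom R0) (\<lambda>p. \<chi> i j. kk_entry ?N ?P ?u ?w A G H (p $ 1, p $ 2) i j) i j p = 0"
    if "(p $ 1, p $ 2) \<in> W" for p i j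
    using vacuum dom[OF that] unfolding metric ricci_flat_on_def by blast
  \<comment> \<open>The twist enters the field equations only through this term. The exponentials of
    \<open>U\<close> cancel in it, so its strength is governed by \<open>e^(2 \<eta>)\<close>
    alone.\<close>
  have src: "dR H q * dR H q * ?w q * inverse (?P q) = \<kappa> / R ^ 4"
  proof -
    have "exp (2 * \<eta> q) * exp (2 * \<eta> q) * exp (- 2 * U q) * inverse (exp (2 * (\<eta> q - U q))) = exp (2 * \<eta> q)"
      by (simp add: exp_add[symmetric] exp_minus[symmetric])
    then have "K\<^sup>2 * (exp (2 * \<eta> q) * exp (2 * \<eta> q) * exp (- 2 * U q) * inverse (exp (2 * (\<eta> q - U q)))) / R ^ 4 = \<kappa> / R ^ 4"
      by (simp add: \<kappa>_def)
    moreover have "dR H q * dR H q * ?w q * inverse (?P q) =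
      K\<^sup>2 * (exp (2 * \<eta> q) * exp (2 * \<eta> q) * exp (- 2 * U q) * inverse (exp (2 * (\<eta> q - U q)))) / R ^ 4"
      using pos unfolding connection_derivatives(2)[OF q] R_def[symmetric]
      by (simp add: field_simps power2_eq_square power3_eq_cube power4_eq_xxxx)
    ultimately show ?thesis by simp
  qed
  have wpos: "0 < exp (- 2 * U q) * (fst q)\<^sup>2" if "q \<in> W" for q using that by (auto simp: W_def)
  have Ppos: "0 < ?P q" if "q \<in> W" for q using a_nz[OF that] by simp
  note eqs = kk_vacuum_equations[where D = "total_dom R0" and N = ?N and P = ?P and u = ?u and w = ?w
      and A = A and G = G and H = H and q = q, OF open_W dom jN jP ju jw jets(4,5,6)]
  note E = eqs[OF _ exp_gt_zero Ppos exp_gt_zero wpos flat q connection_derivatives(1)[OF q] N P u w rel, unfolded src]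
  from einstein_algebra[OF pos(2,1) E]
  show "dR a q = - a q * \<kappa> / (2 * R ^ 3)"
    and "R * dR (dR U) q + dR U q - R * (dR a q / a q) * dR U q - R * (a q)\<^sup>2 * dT (dT U) q
      - R * a q * dT a q * dT U q - exp (4 * U q) / (2 * R) * ((dR A q)\<^sup>2 - (a q)\<^sup>2 * (dT A q)\<^sup>2) = 0"
    and "dR (dR A) q + (4 * dR U q - 1 / R - dR a q / a q) * dR A q - (a q)\<^sup>2 * dT (dT A) q
      - (4 * dT U q * (a q)\<^sup>2 + a q * dT a q) * dT A q = 0"
    and "dR \<eta> q + \<kappa> / (4 * R ^ 3) - R * ((dR U q)\<^sup>2 + (a q)\<^sup>2 * (dT U q)\<^sup>2
      + exp (4 * U q) / (4 * R\<^sup>2) * ((dR A q)\<^sup>2 + (a q)\<^sup>2 * (dT A q)\<^sup>2)) = 0"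
    by blast+
qed

end

section \<open>The modified energy\<close>

text \<open>Origin of the constants. Put \<open>v = 1/2 - R U1\<close> and let \<open>D\<close> be
  the energy bracket without its \<open>k\<close> term. Apart from dissipation and flux, the
  derivative of \<open>D / a\<close> is \<open>(a1 / a^2) (D - v)\<close>. The constraint turns
  \<open>D - v\<close> into \<open>R n1 + k / (4 R^2) - 1/4\<close>, and \<open>a1 / a^2\<close> is
  \<open>- k / (2 a R^3)\<close>. The derivative of \<open>k / (4 a R^2)\<close> is
  \<open>(k / (2 a R^3)) (R n1 + k / (4 R^2) - 1)\<close>. So \<open>n1\<close> and the terms
  quadratic in \<open>k\<close> cancel, and what is left, \<open>- 3 k / (8 a R^3)\<close>, equals
  \<open>- (3 K / 8) H1\<close>.\<close>

lemma energy_algebra: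
  fixes a R :: real
  assumes pos: "a > 0" "R > 0"
    and a1: "a1 = - a * k / (2 * R ^ 3)" and H1: "K * H1 = k / (a * R ^ 3)"
    and "R * U11 + U1 - R * (a1 / a) * U1 - R * a\<^sup>2 * U22 - R * a * a2 * U2
      - e / (2 * R) * (A1\<^sup>2 - a\<^sup>2 * A2\<^sup>2) = 0" (is "?g2 = 0")
    and "A11 + (4 * U1 - 1 / R - a1 / a) * A1 - a\<^sup>2 * A22 - (4 * U2 * a\<^sup>2 + a * a2) * A2 = 0" (is "?g3 = 0")
    and "n1 + k / (4 * R ^ 3) - R * (U1\<^sup>2 + a\<^sup>2 * U2\<^sup>2 + e / (4 * R\<^sup>2) * (A1\<^sup>2 + a\<^sup>2 * A2\<^sup>2)) = 0" (is "?g4 = 0")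
  shows "inverse a * (2 * (1/2 - R * U1) * (- U1 - R * U11)
        + 2 * R * a\<^sup>2 * U2\<^sup>2 + R\<^sup>2 * (2 * a * a1) * U2\<^sup>2 + R\<^sup>2 * a\<^sup>2 * (2 * U2 * U12)
        + e * U1 * (A1\<^sup>2 + a\<^sup>2 * A2\<^sup>2) + e / 4 * (2 * A1 * A11 + 2 * a * a1 * A2\<^sup>2 + a\<^sup>2 * (2 * A2 * A12))
        + k * n1 / (2 * R\<^sup>2) - k / (2 * R ^ 3))
      - a1 / a\<^sup>2 * ((1/2 - R * U1)\<^sup>2 + R\<^sup>2 * a\<^sup>2 * U2\<^sup>2 + e / 4 * (A1\<^sup>2 + a\<^sup>2 * A2\<^sup>2) + k / (4 * R\<^sup>2))
      + 3 * K / 8 * H1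
    = ((2 * R\<^sup>2 * a * U2\<^sup>2 + e * a * A2\<^sup>2 / 2)
      - (2 * (- R * U12) * R\<^sup>2 * a * U2 + 2 * (1/2 - R * U1) * R\<^sup>2 * (a2 * U2 + a * U22)
         - R / 2 * e * (A12 * a * A2 + A1 * (4 * U2 * a * A2 + a2 * A2 + a * A22)))) / R"
    (is "?L = ?M")
proof -
  have H1': "3 * K / 8 * H1 = 3 / 8 * (k / (a * R ^ 3))" using H1 by simp
  \<comment> \<open>The multipliers of an energy estimate: the equation for \<open>U\<close> is
    tested against \<open>(1/2 - R * U1) / a\<close>, the one for \<open>A\<close> against
    \<open>A1 / a\<close>, and the constraint removes \<open>n1\<close>.\<close>
  have "?L - ?M = - 2 * (1/2 - R * U1) / a * ?g2 + e * A1 / (2 * a) * ?g3 + k / (2 * R\<^sup>2 * a) * ?g4"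
    unfolding H1' a1 using pos by (simp add: field_simps power2_eq_square power3_eq_cube)
  then show ?thesis by (simp only: assms(5,6,7) mult_zero_right add_0_left right_minus_eq)
qed

context t2_vacuum
begin

text \<open>Since \<open>1/2 - R U\<^sub>R = (2 U - ln R)\<^sub>\<tau> / 2\<close>, the terms without \<open>K\<close> are the wave-map energy density.\<close>

definition energy_density :: "real \<times> real \<Rightarrow> real" where
  "energy_density q = inverse (a q) * ((1/2 - fst q * dR U q)\<^sup>2 + (fst q)\<^sup>2 * (a q)\<^sup>2 * (dT U q)\<^sup>2
     + exp (4 * U q) / 4 * ((dR A q)\<^sup>2 + (a q)\<^sup>2 * (dT A q)\<^sup>2) + K\<^sup>2 * exp (2 * \<eta> q) / (4 * (fst q)\<^sup>2))
     + 3 * K / 8 * H q"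

text \<open>Twice the \<theta>-derivative part of the energy density. In terms of
  \<open>2 U - ln R\<close> and \<open>A\<close> that part carries the explicit weight
  \<open>R^2 = e^(- 2 \<tau>)\<close>, whose decay is the source of the dissipation.\<close>

definition dissipation :: "real \<times> real \<Rightarrow> real" where
  "dissipation q = 2 * (fst q)\<^sup>2 * a q * (dT U q)\<^sup>2 + exp (4 * U q) * a q * (dT A q)\<^sup>2 / 2"

text \<open>The products of \<tau>- and \<theta>-derivatives, as in the energy-momentum tensor of a
  wave map. In the local balance law, \<open>R\<close> times the \<open>R\<close>-derivative of the
  density is the dissipation minus the \<theta>-derivative of this flux.\<close>

definition flux :: "real \<times> real \<Rightarrow> real" where
  "flux q = 2 * (1/2 - fst q * dR U q) * (fst q)\<^sup>2 * a q * dT U q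
     - fst q / 2 * exp (4 * U q) * dR A q * a q * dT A q"

definition flux_T :: "real \<times> real \<Rightarrow> real" where
  "flux_T q = 2 * (- fst q * dT (dR U) q) * (fst q)\<^sup>2 * a q * dT U q
     + 2 * (1/2 - fst q * dR U q) * (fst q)\<^sup>2 * (dT a q * dT U q + a q * dT (dT U) q)
     - fst q / 2 * exp (4 * U q) * (dT (dR A) q * a q * dT A q
         + dR A q * (4 * dT U q * a q * dT A q + dT a q * dT A q + a q * dT (dT A) q))"

lemma W_pos: "q \<in> W \<Longrightarrow> fst q > 0" "q \<in> W \<Longrightarrow> a q > 0"
  using W_sub a_pos by (auto simp: W_def)

lemma partials:
  assumes "(R, \<theta>) \<in> W" "smooth_periodic R0 f"
  shows "((\<lambda>R. f (R, \<theta>)) has_real_derivative dR f (R, \<theta>)) (at R)"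
    "((\<lambda>R. dR f (R, \<theta>)) has_real_derivative dR (dR f) (R, \<theta>)) (at R)"
    "((\<lambda>R. dT f (R, \<theta>)) has_real_derivative dT (dR f) (R, \<theta>)) (at R)"
    "((\<lambda>\<theta>. f (R, \<theta>)) has_real_derivative dT f (R, \<theta>)) (at \<theta>)"
    "((\<lambda>\<theta>. dR f (R, \<theta>)) has_real_derivative dT (dR f) (R, \<theta>)) (at \<theta>)"
    "((\<lambda>\<theta>. dT f (R, \<theta>)) has_real_derivative dT (dT f) (R, \<theta>)) (at \<theta>)"
  using jet2_smooth[OF assms(2)] jet1_partial[OF _ assms(1)] unfolding jet2_def by blast+

lemma energy_density_derivative:
  assumes q: "(R, \<theta>) \<in> W"
  shows "((\<lambda>R. energy_density (R, \<theta>)) has_real_derivative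
    (dissipation (R, \<theta>) - flux_T (R, \<theta>)) / R) (at R)"
proof -
  have pos: "a (R, \<theta>) > 0" "R > 0" using W_pos[OF q] by auto
  note E = einstein_equations[OF q, unfolded fst_conv]
  have H1: "K * dR H (R, \<theta>) = K\<^sup>2 * exp (2 * \<eta> (R, \<theta>)) / (a (R, \<theta>) * R ^ 3)"
    using connection_derivatives(2)[OF q] by (simp add: power2_eq_square)
  note alg = energy_algebra[OF pos E(1) H1 E(2,3,4), of "dT (dR U) (R, \<theta>)" "dT (dR A) (R, \<theta>)"]
  note P = partials[OF q smooth(1)] partials[OF q smooth(2)] partials[OF q smooth(3)]
    partials[OF q smooth(4)] partials[OF q smooth(6)]
  have nz: "4 \<noteq> (0::real)" "4 * R\<^sup>2 \<noteq> 0" "a (R, \<theta>) \<noteq> 0" using pos by auto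
  let ?U1 = "\<lambda>R. dR U (R, \<theta>)" and ?U2 = "\<lambda>R. dT U (R, \<theta>)"
  let ?A1 = "\<lambda>R. dR A (R, \<theta>)" and ?A2 = "\<lambda>R. dT A (R, \<theta>)"
  let ?a = "\<lambda>R. a (R, \<theta>)" and ?e = "\<lambda>R. exp (4 * U (R, \<theta>))" and ?\<eta> = "\<lambda>R. \<eta> (R, \<theta>)"
  have d1: "((\<lambda>R. (1/2 - R * ?U1 R)\<^sup>2) has_real_derivative
      2 * (1/2 - R * ?U1 R) * (- ?U1 R - R * dR (dR U) (R, \<theta>))) (at R)"
    by (rule derivative_eq_intros P refl)+ (simp add: algebra_simps)
  have d2: "((\<lambda>R. R\<^sup>2 * (?a R)\<^sup>2 * (?U2 R)\<^sup>2) has_real_derivative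
      2 * R * (?a R)\<^sup>2 * (?U2 R)\<^sup>2 + R\<^sup>2 * (2 * ?a R * dR a (R, \<theta>)) * (?U2 R)\<^sup>2
        + R\<^sup>2 * (?a R)\<^sup>2 * (2 * ?U2 R * dT (dR U) (R, \<theta>))) (at R)"
    by (rule derivative_eq_intros P refl)+ (simp add: algebra_simps)
  have d3: "((\<lambda>R. ?e R / 4 * ((?A1 R)\<^sup>2 + (?a R)\<^sup>2 * (?A2 R)\<^sup>2)) has_real_derivative
      ?e R * ?U1 R * ((?A1 R)\<^sup>2 + (?a R)\<^sup>2 * (?A2 R)\<^sup>2) + ?e R / 4 * (2 * ?A1 R * dR (dR A) (R, \<theta>)
        + 2 * ?a R * dR a (R, \<theta>) * (?A2 R)\<^sup>2 + (?a R)\<^sup>2 * (2 * ?A2 R * dT (dR A) (R, \<theta>)))) (at R)"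
    by (rule derivative_eq_intros P nz refl)+ (simp_all add: algebra_simps)
  have d4: "((\<lambda>R. K\<^sup>2 * exp (2 * ?\<eta> R) / (4 * R\<^sup>2)) has_real_derivative
      (K\<^sup>2 * exp (2 * ?\<eta> R)) * dR \<eta> (R, \<theta>) / (2 * R\<^sup>2) - (K\<^sup>2 * exp (2 * ?\<eta> R)) / (2 * R ^ 3)) (at R)"
    by (rule derivative_eq_intros P nz refl)+
      (use pos in \<open>simp_all add: field_simps power2_eq_square power3_eq_cube\<close>)
  have d0: "((\<lambda>R. inverse (?a R)) has_real_derivative - (dR a (R, \<theta>) / (?a R)\<^sup>2)) (at R)"
    by (rule derivative_eq_intros P nz refl)+ (use pos in \<open>simp_all add: field_simps power2_eq_square\<close>)
  show ?thesis
    unfolding energy_density_def fst_conv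
    by (rule DERIV_cong[OF DERIV_add[OF DERIV_mult[OF d0 DERIV_add[OF DERIV_add[OF DERIV_add[OF d1 d2] d3] d4]]
          DERIV_cmult[OF partials(1)[OF q smooth(6)]]]])
      (use alg in \<open>simp add: dissipation_def flux_T_def algebra_simps\<close>)
qed

lemma flux_derivative:
  assumes q: "(R, \<theta>) \<in> W"
  shows "((\<lambda>\<theta>. flux (R, \<theta>)) has_real_derivative flux_T (R, \<theta>)) (at \<theta>)"
proof -
  note P = partials[OF q smooth(1)] partials[OF q smooth(2)] partials[OF q smooth(3)]
    partials[OF q smooth(4)] partials[OF q smooth(6)]
  show ?thesis
    unfolding flux_def flux_T_def fst_conv
    by (rule DERIV_cong, (rule P derivative_eq_intros refl)+) (simp add: algebra_simps)
qed

lemma periodic_derivatives: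
  assumes f: "smooth_periodic R0 f" and q: "(R, \<theta>) \<in> W"
  shows "f (R, \<theta> + 2 * pi) = f (R, \<theta>)" "dR f (R, \<theta> + 2 * pi) = dR f (R, \<theta>)"
    "dT f (R, \<theta> + 2 * pi) = dT f (R, \<theta>)"
proof -
  have per: "f (R, \<theta> + 2 * pi) = f (R, \<theta>)" if "R \<in> {0<..<R0}" for R \<theta>
    using f that by (auto simp: smooth_periodic_def)
  have R: "R \<in> {0<..<R0}" and q': "(R, \<theta> + 2 * pi) \<in> W" using q by (auto simp: W_def)
  show "f (R, \<theta> + 2 * pi) = f (R, \<theta>)" by (rule per[OF R])
  have "((\<lambda>R. f (R, \<theta>)) has_real_derivative dR f (R, \<theta> + 2 * pi)) (at R)"
    by (rule has_field_derivative_transform_within_open[OF partials(1)[OF q' f], of "{0<..<R0}"])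
      (use R per in auto)
  then show "dR f (R, \<theta> + 2 * pi) = dR f (R, \<theta>)"
    using partials(1)[OF q f] by (rule DERIV_unique)
  have "((\<lambda>\<theta>. f (R, \<theta> + 2 * pi)) has_real_derivative dT f (R, \<theta> + 2 * pi)) (at \<theta>)"
    using partials(4)[OF q' f] by (simp add: DERIV_shift)
  then have "((\<lambda>\<theta>. f (R, \<theta>)) has_real_derivative dT f (R, \<theta> + 2 * pi)) (at \<theta>)"
    by (simp add: per[OF R])
  then show "dT f (R, \<theta> + 2 * pi) = dT f (R, \<theta>)"
    using partials(4)[OF q f] by (rule DERIV_unique)
qed

lemma continuous_W:
  assumes "smooth_periodic R0 f"
  shows "continuous_on W f" "continuous_on W (dR f)" "continuous_on W (dT f)"
    "continuous_on W (dT (dR f))" "continuous_on W (dT (dT f))"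
proof -
  have b: "(1, 0) \<in> (Basis :: (real \<times> real) set)" "(0, 1) \<in> (Basis :: (real \<times> real) set)"
    by (simp_all add: Basis_prod_def image_iff)
  have Ck: "Ck_on 2 (quot_dom R0) f" using assms by (simp add: smooth_periodic_def smooth_on_def)
  show "continuous_on W f" "continuous_on W (dR f)" "continuous_on W (dT f)"
    using jet2_smooth[OF assms] jet1_continuous_on unfolding jet2_def by blast+
  show "continuous_on W (dT (dR f))" "continuous_on W (dT (dT f))"
    using Ck_on_2_interior(4)[OF Ck open_W W_sub] b by blast+
qed

lemmas continuous_metric = smooth[THEN continuous_W(1)] smooth[THEN continuous_W(2)]
  smooth[THEN continuous_W(3)] smooth[THEN continuous_W(4)] smooth[THEN continuous_W(5)]

lemma continuous_energy:
  "continuous_on W energy_density" "continuous_on W dissipation" "continuous_on W flux_T"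
proof -
  have nz: "\<forall>q\<in>W. a q \<noteq> 0" "\<forall>q\<in>W. 4 * (fst q)\<^sup>2 \<noteq> 0" using W_pos by fastforce+
  show "continuous_on W energy_density" "continuous_on W dissipation" "continuous_on W flux_T"
    unfolding energy_density_def[abs_def] dissipation_def[abs_def] flux_T_def[abs_def]
    by (intro continuous_intros continuous_metric nz; simp)+
qed

lemma continuous_slice:
  assumes "continuous_on W f" "R \<in> {0<..<R0}"
  shows "continuous_on S (\<lambda>\<theta>. f (R, \<theta>))"
  by (rule continuous_on_compose2[OF assms(1)]) (use assms(2) in \<open>auto simp: W_def intro!: continuous_intros\<close>)

definition energy :: "real \<Rightarrow> real" where
  "energy R = integral {0..2*pi} (\<lambda>\<theta>. energy_density (R, \<theta>))"

text \<open>The flux is periodic, so its \<theta>-derivative integrates to zero. As the dissipation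
  is nonnegative, the energy is nondecreasing in \<open>R\<close>, that is, nonincreasing in
  \<tau>.\<close>

lemma energy_derivative:
  assumes R: "R \<in> {0<..<R0}"
  shows "(energy has_real_derivative integral {0..2*pi} (\<lambda>\<theta>. dissipation (R, \<theta>)) / R) (at R)"
proof -
  let ?U = "{0<..<R0}" and ?D = "\<lambda>R \<theta>. (dissipation (R, \<theta>) - flux_T (R, \<theta>)) / R"
  have W: "(R, \<theta>) \<in> W" if "R \<in> ?U" for R \<theta> using that by (simp add: W_def)
  have cD: "continuous_on W (\<lambda>q. (dissipation q - flux_T q) / fst q)"
    by (intro continuous_intros continuous_energy) (use W_pos in fastforce)
  have "((\<lambda>R. integral (cbox 0 (2*pi)) (\<lambda>\<theta>. energy_density (R, \<theta>))) has_field_derivative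
      integral (cbox 0 (2*pi)) (?D R)) (at R within ?U)"
  proof (rule leibniz_rule_field_derivative)
    show "((\<lambda>R. energy_density (R, \<theta>)) has_field_derivative ?D R \<theta>) (at R within ?U)"
      if "R \<in> ?U" for R \<theta>
      by (rule has_field_derivative_at_within[OF energy_density_derivative[OF W[OF that]]])
    show "(\<lambda>\<theta>. energy_density (R, \<theta>)) integrable_on cbox 0 (2*pi)" if "R \<in> ?U" for R
      by (intro integrable_continuous continuous_slice continuous_energy that)
    show "continuous_on (?U \<times> cbox 0 (2*pi)) (\<lambda>(R, \<theta>). ?D R \<theta>)"
      unfolding split_beta
      by (rule continuous_on_subset[OF cD, THEN continuous_on_eq]) (auto simp: W_def)
  qed (use R in auto)
  then have "(energy has_real_derivative integral {0..2*pi} (?D R)) (at R)"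
    unfolding energy_def[abs_def] using R by (simp add: at_within_open[of R ?U])
  moreover have "integral {0..2*pi} (?D R) = integral {0..2*pi} (\<lambda>\<theta>. dissipation (R, \<theta>)) / R"
  proof -
    have "(flux_T_slice has_integral (flux (R, 2*pi) - flux (R, 0))) {0..2*pi}"
      if "flux_T_slice = (\<lambda>\<theta>. flux_T (R, \<theta>))" for flux_T_slice
      unfolding that by (intro fundamental_theorem_of_calculus)
        (auto simp: has_real_derivative_iff_has_vector_derivative[symmetric]
          intro!: has_field_derivative_at_within[OF flux_derivative] W R)
    moreover have "flux (R, 2*pi) = flux (R, 0)"
      using smooth[THEN periodic_derivatives(1), OF W[OF R, of 0]] smooth[THEN periodic_derivatives(2), OF W[OF R, of 0]]
        smooth[THEN periodic_derivatives(3), OF W[OF R, of 0]]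
      by (simp add: flux_def)
    ultimately have F: "((\<lambda>\<theta>. flux_T (R, \<theta>)) has_integral 0) {0..2*pi}" by simp
    have "(\<lambda>\<theta>. dissipation (R, \<theta>)) integrable_on {0..2*pi}"
      by (intro integrable_continuous_interval continuous_slice continuous_energy R)
    from integral_unique[OF has_integral_divide[OF has_integral_diff[OF integrable_integral[OF this] F], of R]]
    show ?thesis by (simp only: diff_zero)
  qed
  ultimately show ?thesis by (simp only:)
qed

end

section \<open>Integral inequalities and monotone limits\<close>

lemma LINT_eq_integral:
  fixes f :: "real \<Rightarrow> real"
  assumes "continuous_on {x..y} f"
  shows "(LINT t:{x..y}|lborel. f t) = integral {x..y} f"
  by (rule set_borel_integral_eq_integral(2)[OF borel_integrable_atLeastAtMost'[OF assms]])

lemma integral_Cauchy_Schwarz: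
  fixes f g :: "real \<Rightarrow> real"
  assumes f: "continuous_on {x..y} f" and g: "continuous_on {x..y} g"
  shows "(integral {x..y} (\<lambda>t. f t * g t))\<^sup>2 \<le> integral {x..y} (\<lambda>t. (f t)\<^sup>2) * integral {x..y} (\<lambda>t. (g t)\<^sup>2)"
proof -
  let ?P = "integral {x..y} (\<lambda>t. (f t)\<^sup>2)" and ?Q = "integral {x..y} (\<lambda>t. (g t)\<^sup>2)"
    and ?S = "integral {x..y} (\<lambda>t. f t * g t)"
  have quad: "0 \<le> ?P + 2 * c * ?S + c\<^sup>2 * ?Q" for c
  proof -
    have "((\<lambda>t. (f t)\<^sup>2 + 2 * c * (f t * g t) + c\<^sup>2 * (g t)\<^sup>2) has_integral ?P + 2 * c * ?S + c\<^sup>2 * ?Q) {x..y}"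
      by (intro has_integral_add has_integral_mult_right integrable_integral integrable_continuous_interval
          continuous_intros f g)
    moreover have "0 \<le> (f t)\<^sup>2 + 2 * c * (f t * g t) + c\<^sup>2 * (g t)\<^sup>2" for t
    proof -
      have "(f t)\<^sup>2 + 2 * c * (f t * g t) + c\<^sup>2 * (g t)\<^sup>2 = (f t + c * g t)\<^sup>2"
        by (simp add: power2_eq_square algebra_simps)
      then show ?thesis by simp
    qed
    ultimately show ?thesis by (rule has_integral_nonneg)
  qed
  show ?thesis
  proof (cases "?Q = 0")
    case True
    have "?S = 0"
    proof (rule ccontr)
      assume "?S \<noteq> 0"
      \<comment> \<open>With \<open>?Q = 0\<close> the quadratic is affine in \<open>c\<close>, and
        this choice of \<open>c\<close> makes it \<open>-1\<close>. In the other case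
        \<open>c = - ?S / ?Q\<close> is its minimizer.\<close>
      then have "?P + 2 * (- (?P + 1) / (2 * ?S)) * ?S = -1" by (simp add: field_simps)
      then show False using quad[of "- (?P + 1) / (2 * ?S)"] True by simp
    qed
    then show ?thesis using True by simp
  next
    case False
    have "?Q \<ge> 0" by (rule integral_nonneg) (auto intro!: integrable_continuous_interval continuous_intros g)
    with False have Q: "?Q > 0" by simp
    have "?P + 2 * (- ?S / ?Q) * ?S + (- ?S / ?Q)\<^sup>2 * ?Q = ?P - ?S\<^sup>2 / ?Q"
      using Q by (simp add: field_simps power2_eq_square)
    then have "?S\<^sup>2 / ?Q \<le> ?P" using quad[of "- ?S / ?Q"] by simp
    then show ?thesis using Q by (simp add: field_simps)
  qed
qed

lemma mono_bounded_tendsto_at_top: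
  fixes M :: "real \<Rightarrow> real"
  assumes mono: "\<And>s t. x \<le> s \<Longrightarrow> s \<le> t \<Longrightarrow> M s \<le> M t" and bound: "\<And>t. x \<le> t \<Longrightarrow> M t \<le> C"
  shows "(M \<longlongrightarrow> Sup (M ` {x..})) at_top"
proof (rule increasing_tendsto)
  have bdd: "bdd_above (M ` {x..})" using bound by (auto intro!: bdd_aboveI)
  show "\<forall>\<^sub>F t in at_top. M t \<le> Sup (M ` {x..})"
    using eventually_ge_at_top[of x] by eventually_elim (auto intro!: cSup_upper bdd)
  fix z assume "z < Sup (M ` {x..})"
  then obtain s where s: "s \<ge> x" "z < M s" using less_cSup_iff[OF _ bdd] by fastforce
  show "\<forall>\<^sub>F t in at_top. z < M t"
    using eventually_ge_at_top[of s] by eventually_elim (use s mono in fastforce)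
qed

section \<open>Finiteness of the total dissipation\<close>

context t2_vacuum
begin

lemma energy_lower_bound:
  assumes R: "R \<in> {0<..<R0}"
  shows "3 * K / 8 * integral {0..2*pi} (\<lambda>\<theta>. H (R, \<theta>)) \<le> energy R"
proof -
  have W: "(R, \<theta>) \<in> W" for \<theta> using R by (simp add: W_def)
  have "integral {0..2*pi} (\<lambda>\<theta>. 3 * K / 8 * H (R, \<theta>)) \<le> energy R"
    unfolding energy_def
  proof (rule integral_le)
    show "(\<lambda>\<theta>. 3 * K / 8 * H (R, \<theta>)) integrable_on {0..2*pi}" "(\<lambda>\<theta>. energy_density (R, \<theta>)) integrable_on {0..2*pi}"
      by (intro integrable_continuous_interval continuous_intros continuous_slice[OF _ R] continuous_energy continuous_metric)+
    show "3 * K / 8 * H (R, \<theta>) \<le> energy_density (R, \<theta>)" for \<theta>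
      using W_pos(2)[OF W[of \<theta>]] by (simp add: energy_density_def)
  qed
  then show ?thesis by simp
qed

text \<open>The square of the norm of \<open>a U_\<theta>\<close> in
  \<open>L^2(a^-1 d\<theta>)\<close>, the quantity that bounds the dual norm of the divergence
  \<open>a (a U_\<theta>)_\<theta>\<close>.\<close>

definition gradient :: "real \<Rightarrow> real" where
  "gradient R = integral {0..2*pi} (\<lambda>\<theta>. a (R, \<theta>) * (dT U (R, \<theta>))\<^sup>2)"

lemma gradient_nonneg: "R \<in> {0<..<R0} \<Longrightarrow> 0 \<le> gradient R"
  unfolding gradient_def
  by (intro integral_nonneg integrable_continuous_interval continuous_intros continuous_slice continuous_metric)
    (auto intro!: mult_nonneg_nonneg less_imp_le[OF W_pos(2)] simp: W_def)

lemma gradient_le_dissipation: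
  assumes R: "R \<in> {0<..<R0}"
  shows "2 * R\<^sup>2 * gradient R \<le> integral {0..2*pi} (\<lambda>\<theta>. dissipation (R, \<theta>))"
proof -
  have W: "(R, \<theta>) \<in> W" for \<theta> using R by (simp add: W_def)
  have "integral {0..2*pi} (\<lambda>\<theta>. 2 * R\<^sup>2 * (a (R, \<theta>) * (dT U (R, \<theta>))\<^sup>2)) \<le> integral {0..2*pi} (\<lambda>\<theta>. dissipation (R, \<theta>))"
  proof (rule integral_le)
    show "(\<lambda>\<theta>. 2 * R\<^sup>2 * (a (R, \<theta>) * (dT U (R, \<theta>))\<^sup>2)) integrable_on {0..2*pi}" "(\<lambda>\<theta>. dissipation (R, \<theta>)) integrable_on {0..2*pi}"
      by (intro integrable_continuous_interval continuous_intros continuous_slice[OF _ R] continuous_energy continuous_metric)+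
    show "2 * R\<^sup>2 * (a (R, \<theta>) * (dT U (R, \<theta>))\<^sup>2) \<le> dissipation (R, \<theta>)" for \<theta>
      using W_pos(2)[OF W[of \<theta>]] by (simp add: dissipation_def)
  qed
  then show ?thesis by (simp add: gradient_def)
qed

lemma continuous_exp_slice:
  fixes f :: "real \<times> real \<Rightarrow> real"
  assumes "continuous_on W f" "R0 = exp (- \<tau>0)"
  shows "continuous_on {\<tau>0<..} (\<lambda>\<tau>. integral {0..2*pi} (\<lambda>\<theta>. f (exp (- \<tau>), \<theta>)))"
proof -
  have W: "(exp (- \<tau>), \<theta>) \<in> W" if "\<tau>0 < \<tau>" for \<tau> \<theta>
    unfolding W_def using that assms(2) by simp
  have "continuous_on ({\<tau>0<..} \<times> cbox 0 (2*pi)) (\<lambda>(\<tau>, \<theta>). f (exp (- \<tau>), \<theta>))"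
    unfolding split_beta
    by (intro continuous_on_compose2[OF assms(1)] continuous_intros) (auto intro: W)
  from integral_continuous_on_param[OF this] show ?thesis by simp
qed

text \<open>The factor \<open>1 / R\<close> of \<open>energy_derivative\<close> cancels against
  \<open>dR = - R d\<tau>\<close>, so minus the energy is a primitive in \<tau> of the integrated
  dissipation. It is nondecreasing and bounded above, hence converges, and the fundamental theorem
  on a half line gives a finite integral.\<close>

lemma gradient_integrable_late:
  assumes R0: "R0 = exp (- \<tau>0)" and \<tau>1: "\<tau>0 < \<tau>1"
    and H_below: "\<exists>B. \<forall>\<^sub>F \<tau> in at_top. B \<le> (LINT \<theta>:{0..2*pi}|lborel. in_tau H (\<tau>, \<theta>))"
  shows "(\<integral>\<^sup>+\<tau>. ennreal (exp (- 2 * \<tau>) * gradient (exp (- \<tau>))) * indicator {\<tau>1..} \<tau> \<partial>lborel) < \<infinity>"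
proof -
  have R: "exp (- \<tau>) \<in> {0<..<R0}" if "\<tau>0 < \<tau>" for \<tau> using that R0 by simp
  define g where "g \<tau> = integral {0..2*pi} (\<lambda>\<theta>. dissipation (exp (- \<tau>), \<theta>))" for \<tau>
  define M where "M \<tau> = - energy (exp (- \<tau>))" for \<tau>
  have grad: "exp (- 2 * \<tau>) * gradient (exp (- \<tau>)) \<le> g \<tau>" "0 \<le> g \<tau>" if "\<tau>0 < \<tau>" for \<tau>
  proof -
    have "(exp (- \<tau>))\<^sup>2 = exp (- 2 * \<tau>)" by (simp add: power2_eq_square flip: exp_add)
    then have "2 * (exp (- 2 * \<tau>) * gradient (exp (- \<tau>))) \<le> g \<tau>"
      using gradient_le_dissipation[OF R[OF that]] by (simp add: g_def)
    moreover have "0 \<le> exp (- 2 * \<tau>) * gradient (exp (- \<tau>))" using gradient_nonneg[OF R[OF that]] by simp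
    ultimately show "exp (- 2 * \<tau>) * gradient (exp (- \<tau>)) \<le> g \<tau>" "0 \<le> g \<tau>" by linarith+
  qed
  have dM: "(M has_real_derivative g \<tau>) (at \<tau>)" if "\<tau>0 < \<tau>" for \<tau>
  proof -
    have "((\<lambda>\<tau>. energy (exp (- \<tau>))) has_real_derivative (g \<tau> / exp (- \<tau>)) * (- exp (- \<tau>))) (at \<tau>)"
      unfolding g_def
      by (rule DERIV_chain2[where f = energy and g = "\<lambda>\<tau>. exp (- \<tau>)", OF energy_derivative[OF R[OF that]]])
        (auto intro!: derivative_eq_intros)
    then show ?thesis unfolding M_def by (auto intro!: derivative_eq_intros)
  qed
  have mono: "M s \<le> M t" if "\<tau>1 \<le> s" "s \<le> t" for s t
  proof (rule DERIV_nonneg_imp_nondecreasing[OF that(2)])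
    show "\<exists>y. (M has_real_derivative y) (at x) \<and> 0 \<le> y" if "s \<le> x" "x \<le> t" for x
      using dM[of x] grad(2)[of x] that \<open>\<tau>1 \<le> s\<close> \<tau>1 by fastforce
  qed
  obtain B where "\<forall>\<^sub>F \<tau> in at_top. B \<le> (LINT \<theta>:{0..2*pi}|lborel. in_tau H (\<tau>, \<theta>))" using H_below by blast
  then obtain \<tau>2 where \<tau>2: "\<And>\<tau>. \<tau>2 \<le> \<tau> \<Longrightarrow> B \<le> (LINT \<theta>:{0..2*pi}|lborel. in_tau H (\<tau>, \<theta>))"
    unfolding eventually_at_top_linorder by blast
  \<comment> \<open>The bound on \<open>H\<close> holds only from \<open>\<tau>2\<close> on;
    monotonicity of \<open>M\<close> carries the resulting bound back to earlier times.\<close>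
  have bound: "M t \<le> - (3 * K / 8 * B)" if t: "\<tau>1 \<le> t" for t
  proof -
    let ?s = "max t \<tau>2"
    have s: "\<tau>0 < ?s" using t \<tau>1 by simp
    have "B \<le> integral {0..2*pi} (\<lambda>\<theta>. H (exp (- ?s), \<theta>))"
      using \<tau>2[of ?s] LINT_eq_integral[OF continuous_slice[OF continuous_W(1)[OF smooth(6)] R[OF s]]]
      by (simp add: in_tau_def)
    then have "3 * K / 8 * B \<le> energy (exp (- ?s))"
      using energy_lower_bound[OF R[OF s]] K_pos by (smt (verit) mult_left_mono divide_pos_pos)
    then have "M ?s \<le> - (3 * K / 8 * B)" by (simp add: M_def)
    then show ?thesis using mono[of t ?s] t by simp
  qed
  have cg: "continuous_on {\<tau>1..} g"
    unfolding g_def using \<tau>1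
    by (intro continuous_on_subset[OF continuous_exp_slice[OF continuous_energy(2) R0]]) auto
  have "(\<integral>\<^sup>+\<tau>. ennreal (indicator {\<tau>1..} \<tau> *\<^sub>R g \<tau>) * indicator {\<tau>1..} \<tau> \<partial>lborel) = Sup (M ` {\<tau>1..}) - M \<tau>1"
  proof (rule nn_integral_FTC_atLeast)
    \<comment> \<open>The indicator inside makes the integrand measurable on the whole line, since
      \<open>g\<close> is known to be continuous only on \<open>{\<tau>1..}\<close>.\<close>
    show "(\<lambda>\<tau>. indicator {\<tau>1..} \<tau> *\<^sub>R g \<tau>) \<in> borel_measurable borel"
      by (rule borel_measurable_continuous_on_indicator[OF _ cg]) simp
    show "(M has_real_derivative indicator {\<tau>1..} x *\<^sub>R g x) (at x)" if "\<tau>1 \<le> x" for x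
      using dM[of x] that \<tau>1 by simp
    show "0 \<le> indicator {\<tau>1..} x *\<^sub>R g x" if "\<tau>1 \<le> x" for x using grad(2)[of x] that \<tau>1 by simp
    show "(M \<longlongrightarrow> Sup (M ` {\<tau>1..})) at_top" by (rule mono_bounded_tendsto_at_top[OF mono bound])
  qed
  moreover have "(\<integral>\<^sup>+\<tau>. ennreal (exp (- 2 * \<tau>) * gradient (exp (- \<tau>))) * indicator {\<tau>1..} \<tau> \<partial>lborel)
      \<le> (\<integral>\<^sup>+\<tau>. ennreal (indicator {\<tau>1..} \<tau> *\<^sub>R g \<tau>) * indicator {\<tau>1..} \<tau> \<partial>lborel)"
    using grad(1) \<tau>1 by (intro nn_integral_mono) (auto simp: indicator_def intro!: ennreal_leI)
  ultimately show ?thesis by (simp add: order.strict_trans1)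
qed

text \<open>The derivative \<open>pd (quot_dom R0) (0, 1) U\<close> is continuous up to
  \<open>R = R0\<close> and agrees with \<open>dT U\<close> inside, so compactness of a closed band
  bounds the integrand. This reaches the initial slice, which the energy identity, stated for
  \<open>R < R0\<close>, leaves out.\<close>

lemma gradient_bounded_early:
  assumes R0: "R0 = exp (- \<tau>0)"
  obtains C where "\<And>\<tau>. \<tau>0 < \<tau> \<Longrightarrow> \<tau> \<le> \<tau>1 \<Longrightarrow> gradient (exp (- \<tau>)) \<le> C"
proof -
  let ?D = "quot_dom R0"
  let ?Q = "{exp (- \<tau>1)..R0} \<times> {0..2*pi}"
  have Ck: "Ck_on 1 ?D U" "Ck_on 0 ?D a" using smooth by (simp_all only: smooth_periodic_def smooth_on_def)
  have b: "(0, 1) \<in> (Basis :: (real \<times> real) set)" by (simp add: Basis_prod_def image_iff)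
  have "continuous_on ?D (\<lambda>q. a q * (pd ?D (0, 1) U q)\<^sup>2)"
    using Ck b by (intro continuous_intros) simp_all
  moreover have sub: "?Q \<subseteq> ?D"
    by (auto simp: quot_dom_def intro: less_le_trans[OF exp_gt_zero])
  ultimately have "continuous_on ?Q (\<lambda>q. a q * (pd ?D (0, 1) U q)\<^sup>2)"
    by (rule continuous_on_subset)
  then have "compact ((\<lambda>q. a q * (pd ?D (0, 1) U q)\<^sup>2) ` ?Q)"
    by (rule compact_continuous_image) (intro compact_Times compact_Icc)
  then have "bdd_above ((\<lambda>q. a q * (pd ?D (0, 1) U q)\<^sup>2) ` ?Q)"
    by (intro bounded_imp_bdd_above compact_imp_bounded)
  then obtain C where C: "\<And>q. q \<in> ?Q \<Longrightarrow> a q * (pd ?D (0, 1) U q)\<^sup>2 \<le> C"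
    unfolding bdd_above_def by blast
  have "gradient (exp (- \<tau>)) \<le> 2 * pi * C" if "\<tau>0 < \<tau>" "\<tau> \<le> \<tau>1" for \<tau>
  proof -
    have R: "exp (- \<tau>) \<in> {0<..<R0}" using that R0 by simp
    have "gradient (exp (- \<tau>)) \<le> integral {0..2*pi} (\<lambda>\<theta>. C)"
      unfolding gradient_def
    proof (rule integral_le)
      show "(\<lambda>\<theta>. a (exp (- \<tau>), \<theta>) * (dT U (exp (- \<tau>), \<theta>))\<^sup>2) integrable_on {0..2*pi}"
        by (intro integrable_continuous_interval continuous_intros continuous_slice[OF _ R] continuous_metric)
      show "a (exp (- \<tau>), \<theta>) * (dT U (exp (- \<tau>), \<theta>))\<^sup>2 \<le> C" if "\<theta> \<in> {0..2*pi}" for \<theta>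
      proof -
        have W: "(exp (- \<tau>), \<theta>) \<in> W" using R by (simp add: W_def)
        have "pd ?D (0, 1) U (exp (- \<tau>), \<theta>) = dT U (exp (- \<tau>), \<theta>)"
          by (rule pd_interior[OF open_W W_sub W]) simp
        moreover have "(exp (- \<tau>), \<theta>) \<in> ?Q" using R that \<open>\<tau> \<le> \<tau>1\<close> by simp
        ultimately show ?thesis using C by metis
      qed
    qed (intro integrable_continuous_interval continuous_intros)
    then show ?thesis by simp
  qed
  then show thesis by (rule that)
qed

lemma gradient_integrable:
  assumes R0: "R0 = exp (- \<tau>0)"
    and H_below: "\<exists>B. \<forall>\<^sub>F \<tau> in at_top. B \<le> (LINT \<theta>:{0..2*pi}|lborel. in_tau H (\<tau>, \<theta>))"
  shows "(\<integral>\<^sup>+\<tau>. ennreal (exp (- 2 * \<tau>) * gradient (exp (- \<tau>))) * indicator {\<tau>0<..} \<tau> \<partial>lborel) < \<infinity>"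
proof -
  let ?f = "\<lambda>\<tau>. ennreal (exp (- 2 * \<tau>) * gradient (exp (- \<tau>)))"
  let ?\<tau>1 = "\<tau>0 + 1"
  obtain C where C: "\<And>\<tau>. \<tau>0 < \<tau> \<Longrightarrow> \<tau> \<le> ?\<tau>1 \<Longrightarrow> gradient (exp (- \<tau>)) \<le> C"
    using gradient_bounded_early[OF R0] by blast
  have cont: "continuous_on {?\<tau>1..} (\<lambda>\<tau>. exp (- 2 * \<tau>) * gradient (exp (- \<tau>)))"
    unfolding gradient_def
    by (intro continuous_intros continuous_on_subset[OF continuous_exp_slice[OF _ R0, of "\<lambda>q. a q * (dT U q)\<^sup>2"]]
        continuous_metric) auto
  have meas: "(\<lambda>\<tau>. ?f \<tau> * indicator {?\<tau>1..} \<tau>) \<in> borel_measurable lborel"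
  proof -
    have "(\<lambda>\<tau>. ennreal (indicator {?\<tau>1..} \<tau> *\<^sub>R (exp (- 2 * \<tau>) * gradient (exp (- \<tau>))))) \<in> borel_measurable borel"
      by (intro measurable_compose[OF borel_measurable_continuous_on_indicator[OF _ cont]] measurable_ennreal) simp
    also have "(\<lambda>\<tau>. ennreal (indicator {?\<tau>1..} \<tau> *\<^sub>R (exp (- 2 * \<tau>) * gradient (exp (- \<tau>)))))
        = (\<lambda>\<tau>. ?f \<tau> * indicator {?\<tau>1..} \<tau>)"
      by (auto simp: indicator_def)
    finally show ?thesis by simp
  qed
  have "(\<integral>\<^sup>+\<tau>. ?f \<tau> * indicator {\<tau>0<..} \<tau> \<partial>lborel)
      \<le> (\<integral>\<^sup>+\<tau>. ennreal (exp (- 2 * \<tau>0) * \<bar>C\<bar>) * indicator {\<tau>0..?\<tau>1} \<tau> + ?f \<tau> * indicator {?\<tau>1..} \<tau> \<partial>lborel)"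
  proof (intro nn_integral_mono)
    fix \<tau> :: real
    have "?f \<tau> \<le> ennreal (exp (- 2 * \<tau>0) * \<bar>C\<bar>)" if "\<tau>0 < \<tau>" "\<tau> \<le> ?\<tau>1"
      using C[OF that] gradient_nonneg[of "exp (- \<tau>)"] R0 that by (intro ennreal_leI mult_mono) auto
    then show "?f \<tau> * indicator {\<tau>0<..} \<tau>
        \<le> ennreal (exp (- 2 * \<tau>0) * \<bar>C\<bar>) * indicator {\<tau>0..?\<tau>1} \<tau> + ?f \<tau> * indicator {?\<tau>1..} \<tau>"
      by (auto simp: indicator_def intro: add_increasing2)
  qed
  also have "\<dots> = (\<integral>\<^sup>+\<tau>. ennreal (exp (- 2 * \<tau>0) * \<bar>C\<bar>) * indicator {\<tau>0..?\<tau>1} \<tau> \<partial>lborel)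
      + (\<integral>\<^sup>+\<tau>. ?f \<tau> * indicator {?\<tau>1..} \<tau> \<partial>lborel)"
    by (rule nn_integral_add[OF _ meas]) simp
  also have "\<dots> < \<infinity>"
    using gradient_integrable_late[OF R0 _ H_below, of ?\<tau>1]
    by (simp add: nn_integral_cmult ennreal_mult_less_top)
  finally show ?thesis .
qed

end

section \<open>The dual Sobolev norm\<close>

lemma test_functionD:
  assumes "s \<in> test_functions"
  shows "(s has_real_derivative deriv s \<theta>) (at \<theta>)" "continuous_on S s" "continuous_on S (deriv s)"
    "s (\<theta> + 2 * pi) = s \<theta>"
proof -
  have sm: "Ck_on 1 UNIV s" using assms by (simp add: test_functions_def smooth_on_def)
  then have diff: "s differentiable (at \<theta>)" for \<theta> by (simp add: differentiable_on_def)
  have lin: "(s has_real_derivative pd UNIV 1 s \<theta>) (at \<theta>)" for \<theta>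
  proof -
    have d: "(s has_derivative (\<lambda>b. pd UNIV b s \<theta>)) (at \<theta>)" by (rule has_derivative_pd[OF diff])
    then have "pd UNIV b s \<theta> = pd UNIV 1 s \<theta> * b" for b
      using linear_scale[OF has_derivative_linear[OF d], of b 1] by (simp add: mult.commute)
    then have "(\<lambda>b. pd UNIV b s \<theta>) = (*) (pd UNIV 1 s \<theta>)" by (rule ext)
    with d show ?thesis by (simp only: has_field_derivative_def)
  qed
  have eq: "deriv s = pd UNIV 1 s" by (rule ext) (rule DERIV_imp_deriv[OF lin])
  show "(s has_real_derivative deriv s \<theta>) (at \<theta>)" using lin by (simp only: eq)
  show "continuous_on S s" using lin by (blast intro: DERIV_continuous_on has_field_derivative_at_within)
  show "continuous_on S (deriv s)" unfolding eq using sm by (auto intro: continuous_on_subset)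
  show "s (\<theta> + 2 * pi) = s \<theta>" using assms by (simp add: test_functions_def)
qed

lemma Ck_on_uminus: "Ck_on k UNIV s \<Longrightarrow> Ck_on k UNIV (\<lambda>x. - s x)"
proof (induction k arbitrary: s)
  case (Suc k)
  then have diff: "s differentiable at x" for x by (simp add: differentiable_on_def)
  have "pd UNIV b (\<lambda>x. - s x) = (\<lambda>x. - pd UNIV b s x)" for b
    by (intro ext pd_has_derivative has_derivative_minus has_derivative_pd diff)
  with Suc show ?case by (simp add: differentiable_on_minus)
qed (simp add: continuous_on_minus)

text \<open>\<open>ennreal\<close> sends negative quotients to zero, so a term entering with a minus
  sign is estimated by testing its norm against \<open>- s\<close>.\<close>

lemma test_function_uminus: "s \<in> test_functions \<Longrightarrow> (\<lambda>\<theta>. - s \<theta>) \<in> test_functions"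
  by (auto simp: test_functions_def smooth_on_def Ck_on_uminus fun_eq_iff)

text \<open>Equality can fail because \<open>ennreal\<close> truncates: a negative summand may lower
  the left side but never the right.\<close>

lemma ennreal_add_le: "ennreal (x + y) \<le> ennreal x + ennreal y"
proof -
  have max: "ennreal (max 0 z) = ennreal z" for z by (simp add: max_def ennreal_neg)
  have "ennreal (x + y) \<le> ennreal (max 0 x + max 0 y)" by (intro ennreal_leI) simp
  also have "\<dots> = ennreal x + ennreal y" by (simp add: ennreal_plus max)
  finally show ?thesis .
qed

definition test_norm :: "(real \<Rightarrow> real) \<Rightarrow> (real \<Rightarrow> real) \<Rightarrow> real" where
  "test_norm b s = sqrt (integral {0..2*pi} (\<lambda>\<theta>. ((s \<theta>)\<^sup>2 + (b \<theta>)\<^sup>2 * (deriv s \<theta>)\<^sup>2) * inverse (b \<theta>)))"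

lemma Hm1_norm_eq:
  assumes "continuous_on {0..2*pi} b" "\<And>\<theta>. \<theta> \<in> {0..2*pi} \<Longrightarrow> b \<theta> > 0" "continuous_on {0..2*pi} \<sigma>"
  shows "Hm1_norm b \<sigma> = (SUP s\<in>test_functions.
    ennreal (integral {0..2*pi} (\<lambda>\<theta>. \<sigma> \<theta> * s \<theta> * inverse (b \<theta>)) / test_norm b s))"
  unfolding Hm1_norm_def test_norm_def
proof (intro SUP_cong refl arg_cong[where f = ennreal] arg_cong2[where f = "(/)"] arg_cong[where f = sqrt]
    LINT_eq_integral)
  fix s assume s: "s \<in> test_functions"
  note c = continuous_intros assms(1,3) test_functionD(2,3)[OF s]
  show "continuous_on {0..2*pi} (\<lambda>\<theta>. \<sigma> \<theta> * s \<theta> * inverse (b \<theta>))"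
    "continuous_on {0..2*pi} (\<lambda>\<theta>. ((s \<theta>)\<^sup>2 + (b \<theta>)\<^sup>2 * (deriv s \<theta>)\<^sup>2) * inverse (b \<theta>))"
    using assms(2) by (intro c; force)+
qed

text \<open>Integration by parts moves the derivative of \<open>f\<close> onto the test function; the rest is Cauchy--Schwarz
  in \<open>L\<^sup>2(b\<^sup>-\<^sup>1 d\<theta>)\<close>.\<close>

lemma Hm1_norm_divergence_le:
  fixes b f f' \<rho> \<sigma> :: "real \<Rightarrow> real"
  assumes b: "continuous_on {0..2*pi} b" "\<And>\<theta>. \<theta> \<in> {0..2*pi} \<Longrightarrow> b \<theta> > 0"
    and f: "\<And>\<theta>. (f has_real_derivative f' \<theta>) (at \<theta>)" "continuous_on {0..2*pi} f'" "f (2*pi) = f 0"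
    and \<rho>: "continuous_on {0..2*pi} \<rho>" and r: "r \<ge> 0"
    and \<sigma>: "\<And>\<theta>. \<sigma> \<theta> = r * (b \<theta> * f' \<theta>) - 1/2 * \<rho> \<theta>"
  shows "Hm1_norm b \<sigma> \<le> ennreal (r * sqrt (integral {0..2*pi} (\<lambda>\<theta>. (f \<theta>)\<^sup>2 * inverse (b \<theta>))))
      + ennreal (1/2) * Hm1_norm b \<rho>"
proof -
  let ?I = "integral {0..2*pi}"
  have cf: "continuous_on {0..2*pi} f" using f(1) by (blast intro: DERIV_continuous_on has_field_derivative_at_within)
  have c\<sigma>: "continuous_on {0..2*pi} \<sigma>" unfolding \<sigma>[abs_def] by (intro continuous_intros b f \<rho>)
  have bnz: "\<forall>\<theta>\<in>{0..2*pi}. b \<theta> \<noteq> 0" using b(2) by force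
  have norm_eq: "Hm1_norm b z = (SUP s\<in>test_functions.
      ennreal (?I (\<lambda>\<theta>. z \<theta> * s \<theta> * inverse (b \<theta>)) / test_norm b s))" if "continuous_on {0..2*pi} z" for z
    by (rule Hm1_norm_eq[OF b(1) _ that]) (rule b(2))
  show ?thesis
    unfolding norm_eq[OF c\<sigma>]
  proof (rule SUP_least)
    fix s assume s: "s \<in> test_functions"
    note S = test_functionD[OF s]
    let ?D = "test_norm b s" and ?Y = "?I (\<lambda>\<theta>. \<rho> \<theta> * s \<theta> * inverse (b \<theta>))"
    let ?F = "?I (\<lambda>\<theta>. f \<theta> * deriv s \<theta>)" and ?J = "?I (\<lambda>\<theta>. (f \<theta>)\<^sup>2 * inverse (b \<theta>))"
    let ?N = "\<lambda>\<theta>. ((s \<theta>)\<^sup>2 + (b \<theta>)\<^sup>2 * (deriv s \<theta>)\<^sup>2) * inverse (b \<theta>)"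
    have "continuous_on {0..2*pi} ?N" by (intro continuous_intros b(1) bnz S(2,3))
    then have N0: "0 \<le> ?I ?N"
    proof (intro integral_nonneg integrable_continuous_interval)
      show "0 \<le> ?N \<theta>" if "\<theta> \<in> {0..2*pi}" for \<theta> using b(2)[OF that] by simp
    qed
    then have D0: "?D \<ge> 0" unfolding test_norm_def by (rule real_sqrt_ge_zero)
    have parts: "?I (\<lambda>\<theta>. f' \<theta> * s \<theta>) = - ?F"
    proof -
      have "((\<lambda>\<theta>. f' \<theta> * s \<theta> + f \<theta> * deriv s \<theta>) has_integral (f (2*pi) * s (2*pi) - f 0 * s 0)) {0..2*pi}"
      proof (rule fundamental_theorem_of_calculus)
        show "((\<lambda>\<theta>. f \<theta> * s \<theta>) has_vector_derivative f' \<theta> * s \<theta> + f \<theta> * deriv s \<theta>) (at \<theta> within {0..2*pi})" for \<theta>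
          unfolding has_real_derivative_iff_has_vector_derivative[symmetric]
          by (rule has_field_derivative_at_within[OF DERIV_cong[OF DERIV_mult[OF f(1) S(1)]]]) (simp only: mult.commute)
      qed simp
      moreover have "f (2*pi) * s (2*pi) - f 0 * s 0 = 0" using f(3) S(4)[of 0] by simp
      ultimately have "?I (\<lambda>\<theta>. f' \<theta> * s \<theta> + f \<theta> * deriv s \<theta>) = 0" by (simp add: integral_unique)
      moreover have "?I (\<lambda>\<theta>. f' \<theta> * s \<theta> + f \<theta> * deriv s \<theta>) = ?I (\<lambda>\<theta>. f' \<theta> * s \<theta>) + ?F"
        by (intro integral_add integrable_continuous_interval continuous_intros f(2) S(2,3) cf)
      ultimately show ?thesis by simp
    qed
    have "?I (\<lambda>\<theta>. \<sigma> \<theta> * s \<theta> * inverse (b \<theta>)) = ?I (\<lambda>\<theta>. r * (f' \<theta> * s \<theta>) - 1/2 * (\<rho> \<theta> * s \<theta> * inverse (b \<theta>)))"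
      by (intro integral_cong) (use bnz in \<open>auto simp: \<sigma> field_simps\<close>)
    also have "\<dots> = r * ?I (\<lambda>\<theta>. f' \<theta> * s \<theta>) - 1/2 * ?Y"
    proof (intro integral_unique has_integral_diff has_integral_mult_right integrable_integral integrable_continuous_interval)
      show "continuous_on {0..2*pi} (\<lambda>\<theta>. f' \<theta> * s \<theta>)" "continuous_on {0..2*pi} (\<lambda>\<theta>. \<rho> \<theta> * s \<theta> * inverse (b \<theta>))"
        by (intro continuous_intros f(2) \<rho> S(2,3) b(1) bnz)+
    qed
    finally have split: "?I (\<lambda>\<theta>. \<sigma> \<theta> * s \<theta> * inverse (b \<theta>)) / ?D = r * (- ?F / ?D) + 1/2 * (- ?Y / ?D)"
      unfolding parts by (simp add: diff_divide_distrib)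
    have J0: "0 \<le> ?J"
    proof (intro integral_nonneg integrable_continuous_interval continuous_intros cf b(1) bnz)
      show "0 \<le> (f \<theta>)\<^sup>2 * inverse (b \<theta>)" if "\<theta> \<in> {0..2*pi}" for \<theta> using b(2)[OF that] by simp
    qed
    have "- ?F \<le> sqrt ?J * ?D"
    proof -
      \<comment> \<open>The factor \<open>1 = b^(-1/2) b^(1/2)\<close> is inserted so that
        Cauchy-Schwarz yields the weighted norm of \<open>f\<close> and, from the test function,
        only the part of its norm that contains \<open>deriv s\<close>.\<close>
      have csb: "continuous_on {0..2*pi} (\<lambda>\<theta>. sqrt (b \<theta>))" by (intro continuous_intros b(1))
      have sq: "sqrt (b \<theta>) \<noteq> 0" if "\<theta> \<in> {0..2*pi}" for \<theta> using b(2)[OF that] by simp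
      have "?F\<^sup>2 = (?I (\<lambda>\<theta>. (f \<theta> * inverse (sqrt (b \<theta>))) * (sqrt (b \<theta>) * deriv s \<theta>)))\<^sup>2"
        using sq by (intro arg_cong[where f = "\<lambda>x. x\<^sup>2"] integral_cong) (simp add: field_simps)
      also have "\<dots> \<le> ?I (\<lambda>\<theta>. (f \<theta> * inverse (sqrt (b \<theta>)))\<^sup>2) * ?I (\<lambda>\<theta>. (sqrt (b \<theta>) * deriv s \<theta>)\<^sup>2)"
        by (intro integral_Cauchy_Schwarz continuous_intros cf csb S(2,3)) (use sq in blast)
      also have "?I (\<lambda>\<theta>. (f \<theta> * inverse (sqrt (b \<theta>)))\<^sup>2) = ?J"
        by (intro integral_cong) (use b(2) in \<open>auto simp: power_mult_distrib power_inverse less_imp_le\<close>)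
      finally have F1: "?F\<^sup>2 \<le> ?J * ?I (\<lambda>\<theta>. (sqrt (b \<theta>) * deriv s \<theta>)\<^sup>2)" .
      have "?I (\<lambda>\<theta>. (sqrt (b \<theta>) * deriv s \<theta>)\<^sup>2) \<le> ?I (\<lambda>\<theta>. ((s \<theta>)\<^sup>2 + (b \<theta>)\<^sup>2 * (deriv s \<theta>)\<^sup>2) * inverse (b \<theta>))"
      proof (rule integral_le)
        show "(\<lambda>\<theta>. (sqrt (b \<theta>) * deriv s \<theta>)\<^sup>2) integrable_on {0..2*pi}"
          "(\<lambda>\<theta>. ((s \<theta>)\<^sup>2 + (b \<theta>)\<^sup>2 * (deriv s \<theta>)\<^sup>2) * inverse (b \<theta>)) integrable_on {0..2*pi}"
          by (intro integrable_continuous_interval continuous_intros csb S(2,3) b(1) bnz)+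
        show "(sqrt (b \<theta>) * deriv s \<theta>)\<^sup>2 \<le> ((s \<theta>)\<^sup>2 + (b \<theta>)\<^sup>2 * (deriv s \<theta>)\<^sup>2) * inverse (b \<theta>)"
          if "\<theta> \<in> {0..2*pi}" for \<theta>
        proof -
          have "((s \<theta>)\<^sup>2 + (b \<theta>)\<^sup>2 * (deriv s \<theta>)\<^sup>2) * inverse (b \<theta>) = (s \<theta>)\<^sup>2 * inverse (b \<theta>) + b \<theta> * (deriv s \<theta>)\<^sup>2"
            using b(2)[OF that] by (simp add: field_simps power2_eq_square)
          moreover have "(s \<theta>)\<^sup>2 * inverse (b \<theta>) \<ge> 0" using b(2)[OF that] by simp
          ultimately show ?thesis using b(2)[OF that] by (simp add: power_mult_distrib)
        qed
      qed
      also have "\<dots> = ?D\<^sup>2"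
        unfolding test_norm_def by (rule real_sqrt_pow2[OF N0, symmetric])
      finally have "?J * ?I (\<lambda>\<theta>. (sqrt (b \<theta>) * deriv s \<theta>)\<^sup>2) \<le> ?J * ?D\<^sup>2"
        by (rule mult_left_mono[OF _ J0])
      with F1 have "?F\<^sup>2 \<le> ?J * ?D\<^sup>2" by (rule order_trans)
      then have "\<bar>?F\<bar> \<le> sqrt (?J * ?D\<^sup>2)" by (intro real_le_rsqrt) (simp only: power2_abs)
      also have "\<dots> = sqrt ?J * ?D" using D0 by (simp add: real_sqrt_mult)
      finally show ?thesis by simp
    qed
    moreover have "0 \<le> sqrt ?J" using J0 by (rule real_sqrt_ge_zero)
    \<comment> \<open>If \<open>?D = 0\<close>, the quotient is \<open>0\<close> by the convention
      on division by zero.\<close>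
    ultimately have "- ?F / ?D \<le> sqrt ?J"
      using D0 by (cases "?D = 0") (auto simp: field_simps)
    then have "r * (- ?F / ?D) \<le> r * sqrt ?J" using r by (rule mult_left_mono)
    then have "ennreal (?I (\<lambda>\<theta>. \<sigma> \<theta> * s \<theta> * inverse (b \<theta>)) / ?D) \<le> ennreal (r * sqrt ?J + 1/2 * (- ?Y / ?D))"
      unfolding split by (intro ennreal_leI add_right_mono)
    also have "\<dots> \<le> ennreal (r * sqrt ?J) + ennreal (1/2 * (- ?Y / ?D))"
      by (rule ennreal_add_le)
    also have "ennreal (1/2 * (- ?Y / ?D)) = ennreal (1/2) * ennreal (- ?Y / ?D)"
      by (rule ennreal_mult') simp
    also have "ennreal (- ?Y / ?D) \<le> Hm1_norm b \<rho>"
    proof -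
      have "deriv (\<lambda>\<theta>. - s \<theta>) = (\<lambda>\<theta>. - deriv s \<theta>)"
        by (intro ext DERIV_imp_deriv DERIV_minus S(1))
      then have "test_norm b (\<lambda>\<theta>. - s \<theta>) = ?D" by (simp add: test_norm_def)
      moreover have "?I (\<lambda>\<theta>. \<rho> \<theta> * (- s \<theta>) * inverse (b \<theta>)) = - ?Y" by simp
      ultimately show ?thesis
        unfolding norm_eq[OF \<rho>] by (intro SUP_upper2[OF test_function_uminus[OF s]]) simp
    qed
    finally show "ennreal (?I (\<lambda>\<theta>. \<sigma> \<theta> * s \<theta> * inverse (b \<theta>)) / ?D)
      \<le> ennreal (r * sqrt ?J) + ennreal (1/2) * Hm1_norm b \<rho>"
      by (simp add: add_left_mono mult_left_mono)
  qed
qed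

text \<open>A supremum over an uncountable family need not be measurable in general. Here each
  quotient depends continuously on \<tau> wherever its denominator is positive, so the strict
  superlevel sets of the supremum are unions of open sets.\<close>

lemma Hm1_norm_slices_measurable:
  fixes b \<sigma> :: "real \<times> real \<Rightarrow> real"
  assumes b: "continuous_on ({\<tau>0<..} \<times> UNIV) b" "\<And>\<tau> \<theta>. \<tau>0 < \<tau> \<Longrightarrow> b (\<tau>, \<theta>) > 0"
    and \<sigma>: "continuous_on ({\<tau>0<..} \<times> UNIV) \<sigma>"
  shows "(\<lambda>\<tau>. Hm1_norm (\<lambda>\<theta>. b (\<tau>, \<theta>)) (\<lambda>\<theta>. \<sigma> (\<tau>, \<theta>)) * indicator {\<tau>0<..} \<tau>) \<in> borel_measurable borel"
proof (rule borel_measurableI_greater)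
  fix y :: ennreal
  let ?I = "integral {0..2*pi}"
  define Y where "Y s \<tau> = ?I (\<lambda>\<theta>. \<sigma> (\<tau>, \<theta>) * s \<theta> * inverse (b (\<tau>, \<theta>)))" for s \<tau>
  define D where "D s \<tau> = ?I (\<lambda>\<theta>. ((s \<theta>)\<^sup>2 + (b (\<tau>, \<theta>))\<^sup>2 * (deriv s \<theta>)\<^sup>2) * inverse (b (\<tau>, \<theta>)))" for s \<tau>
  have slice: "continuous_on {0..2*pi} (\<lambda>\<theta>. f (\<tau>, \<theta>))"
    if "continuous_on ({\<tau>0<..} \<times> UNIV) f" "\<tau>0 < \<tau>" for f :: "real \<times> real \<Rightarrow> real" and \<tau>
    by (rule continuous_on_compose2[OF that(1)]) (use that(2) in \<open>auto intro!: continuous_intros\<close>)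
  have N: "Hm1_norm (\<lambda>\<theta>. b (\<tau>, \<theta>)) (\<lambda>\<theta>. \<sigma> (\<tau>, \<theta>)) = (SUP s\<in>test_functions. ennreal (Y s \<tau> / sqrt (D s \<tau>)))"
    if "\<tau>0 < \<tau>" for \<tau>
    unfolding Y_def D_def
    by (subst Hm1_norm_eq) (simp_all add: slice[OF b(1) that] slice[OF \<sigma> that] b(2)[OF that] test_norm_def)
  have open_set: "open {\<tau> \<in> {\<tau>0<..}. y < ennreal (Y s \<tau> / sqrt (D s \<tau>))}" if s: "s \<in> test_functions" for s
  proof -
    let ?U = "{\<tau>0<..}"
    have param: "continuous_on ?U (\<lambda>\<tau>. ?I (f \<tau>))"
      if "continuous_on (?U \<times> UNIV) (\<lambda>q. f (fst q) (snd q))" for f :: "real \<Rightarrow> real \<Rightarrow> real"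
    proof -
      have "continuous_on (?U \<times> cbox 0 (2*pi)) (\<lambda>(\<tau>, \<theta>). f \<tau> \<theta>)"
        unfolding split_beta by (rule continuous_on_subset[OF that]) auto
      from integral_continuous_on_param[OF this] show ?thesis by simp
    qed
    have cs: "continuous_on (?U \<times> UNIV) (\<lambda>q. s (snd q))" "continuous_on (?U \<times> UNIV) (\<lambda>q. deriv s (snd q))"
      by (rule continuous_on_compose2[OF _ continuous_on_snd[OF continuous_on_id] subset_UNIV],
          rule test_functionD[OF s])+
    have cb: "continuous_on (?U \<times> UNIV) (\<lambda>q. b (fst q, snd q))" "continuous_on (?U \<times> UNIV) (\<lambda>q. \<sigma> (fst q, snd q))"
      using b(1) \<sigma> by simp_all
    have nz: "\<forall>q\<in>?U \<times> UNIV. b (fst q, snd q) \<noteq> 0"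
      using b(2) by (auto simp: less_imp_neq[symmetric])
    have cY: "continuous_on ?U (Y s)" unfolding Y_def
      by (rule param) (intro continuous_intros cs cb nz)
    have cD: "continuous_on ?U (D s)" unfolding D_def
      by (rule param) (intro continuous_intros cs cb nz)
    let ?T = "?U \<inter> D s -` {0<..}"
    have T: "open ?T" by (rule continuous_open_preimage[OF cD]) auto
    have "continuous_on ?T (\<lambda>\<tau>. ennreal (Y s \<tau> / sqrt (D s \<tau>)))"
      by (intro continuous_on_ennreal continuous_intros continuous_on_subset[OF cY] continuous_on_subset[OF cD]) auto
    then have "open (?T \<inter> (\<lambda>\<tau>. ennreal (Y s \<tau> / sqrt (D s \<tau>))) -` {y<..})"
      by (rule continuous_open_preimage[OF _ T]) auto
    \<comment> \<open>Restricting to \<open>?T\<close> loses nothing: where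
      \<open>D s \<tau>\<close> is zero the quotient is \<open>0\<close>, which exceeds no
      \<open>y\<close>.\<close>
    moreover have "D s \<tau> > 0" if \<tau>: "\<tau>0 < \<tau>" and y: "y < ennreal (Y s \<tau> / sqrt (D s \<tau>))" for \<tau>
    proof (rule ccontr)
      assume "\<not> D s \<tau> > 0"
      moreover have "D s \<tau> \<ge> 0" unfolding D_def
        by (intro integral_nonneg integrable_continuous_interval continuous_intros slice[OF b(1) \<tau>]
            test_functionD(2,3)[OF s])
          (use b(2)[OF \<tau>] in \<open>auto intro!: mult_nonneg_nonneg simp: less_imp_neq[symmetric] less_imp_le\<close>)
      ultimately have "D s \<tau> = 0" by simp
      then show False using y by simp
    qed
    then have "?T \<inter> (\<lambda>\<tau>. ennreal (Y s \<tau> / sqrt (D s \<tau>))) -` {y<..} = {\<tau> \<in> ?U. y < ennreal (Y s \<tau> / sqrt (D s \<tau>))}"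
      by auto
    ultimately show ?thesis by simp
  qed
  have "{\<tau>. y < Hm1_norm (\<lambda>\<theta>. b (\<tau>, \<theta>)) (\<lambda>\<theta>. \<sigma> (\<tau>, \<theta>)) * indicator {\<tau>0<..} \<tau>}
      = (\<Union>s\<in>test_functions. {\<tau> \<in> {\<tau>0<..}. y < ennreal (Y s \<tau> / sqrt (D s \<tau>))})"
    using N by (auto simp: less_SUP_iff indicator_def split: if_splits)
  moreover have "open \<dots>" using open_set by blast
  ultimately show "{\<tau> \<in> space borel. y < Hm1_norm (\<lambda>\<theta>. b (\<tau>, \<theta>)) (\<lambda>\<theta>. \<sigma> (\<tau>, \<theta>)) * indicator {\<tau>0<..} \<tau>} \<in> sets borel"
    by simp
qed

text \<open>Comparison with \<open>2 * max x y\<close> avoids subtraction, which truncates in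
  \<open>ennreal\<close>. The constant \<open>4\<close> later cancels the square of the factor
  \<open>1/2\<close> in front of the \<open>A\<close> term.\<close>

lemma ennreal_square_add_le: "(x + y)\<^sup>2 \<le> 4 * x\<^sup>2 + 4 * y\<^sup>2" for x y :: ennreal
proof -
  have "(x + y)\<^sup>2 \<le> (2 * max x y)\<^sup>2"
    by (intro power_mono) (auto simp: mult_2 intro: add_mono)
  also have "\<dots> = 4 * (max x y)\<^sup>2" by (simp add: power_mult_distrib)
  also have "\<dots> \<le> 4 * x\<^sup>2 + 4 * y\<^sup>2" by (auto simp: max_def)
  finally show ?thesis .
qed

section \<open>The wave operator on time slices\<close>

context t2_vacuum
begin

lemma exp_slice_in_W: "R0 = exp (- \<tau>0) \<Longrightarrow> \<tau>0 < \<tau> \<Longrightarrow> (exp (- \<tau>), \<theta>) \<in> W"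
  unfolding W_def by simp

text \<open>Agreement of \<open>F\<close> with the pulled-back \<open>f\<close> is asked only for
  \<open>\<tau>0 < \<tau>\<close>, so that the lemma applies again to a product containing
  \<open>d_tau\<close>, whose value is known only off the initial slice.\<close>

lemma tau_derivatives:
  assumes R0: "R0 = exp (- \<tau>0)" and \<tau>: "\<tau>0 < \<tau>" and f: "jet1 W f f1 f2"
    and F: "\<And>\<tau> \<theta>. \<tau>0 < \<tau> \<Longrightarrow> F (\<tau>, \<theta>) = f (exp (- \<tau>), \<theta>)"
  shows "d_tau \<tau>0 F (\<tau>, \<theta>) = - exp (- \<tau>) * f1 (exp (- \<tau>), \<theta>)"
    and "d_theta \<tau>0 F (\<tau>, \<theta>) = f2 (exp (- \<tau>), \<theta>)"
proof -
  let ?S = "{\<tau>0<..} \<times> (UNIV :: real set)"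
  let ?c = "\<lambda>q :: real \<times> real. (exp (- fst q), snd q)"
  have S: "open ?S" "?S \<subseteq> {\<tau>0..} \<times> UNIV" "(\<tau>, \<theta>) \<in> ?S"
    using \<tau> by (auto intro!: open_Times)
  have pd: "pd ({\<tau>0..} \<times> UNIV) b F (\<tau>, \<theta>) = pd UNIV b (\<lambda>q. f (?c q)) (\<tau>, \<theta>)" for b
    by (rule pd_interior[OF S]) (use F in auto)
  have "(f has_derivative (\<lambda>v. f1 (?c (\<tau>, \<theta>)) * fst v + f2 (?c (\<tau>, \<theta>)) * snd v)) (at (?c (\<tau>, \<theta>)))"
    using f exp_slice_in_W[OF R0 \<tau>] by (simp add: jet1_def)
  moreover have "(?c has_derivative (\<lambda>v. (- exp (- \<tau>) * fst v, snd v))) (at (\<tau>, \<theta>))"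
    by (auto intro!: derivative_eq_intros)
  ultimately have d: "((\<lambda>q. f (?c q)) has_derivative (\<lambda>v. f1 (?c (\<tau>, \<theta>)) * fst (- exp (- \<tau>) * fst v, snd v)
      + f2 (?c (\<tau>, \<theta>)) * snd (- exp (- \<tau>) * fst v, snd v))) (at (\<tau>, \<theta>))"
    by (rule has_derivative_compose[rotated])
  show "d_tau \<tau>0 F (\<tau>, \<theta>) = - exp (- \<tau>) * f1 (exp (- \<tau>), \<theta>)"
    unfolding d_tau_def pd by (subst pd_has_derivative[OF d]) simp
  show "d_theta \<tau>0 F (\<tau>, \<theta>) = f2 (exp (- \<tau>), \<theta>)"
    unfolding d_theta_def pd by (subst pd_has_derivative[OF d]) simp
qed

text \<open>By \<open>\<partial>_\<tau> = - R \<partial>_R\<close>, the term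
  \<open>e^(2 \<tau>) A_\<tau>^2\<close> is \<open>A_R^2\<close>, and the two sides differ by
  \<open>R\<close> times the field equation for \<open>U\<close>.\<close>

lemma wave_operator:
  assumes R0: "R0 = exp (- \<tau>0)" and \<tau>: "\<tau>0 < \<tau>"
  defines "q \<equiv> \<lambda>\<theta>. (exp (- \<tau>), \<theta>)"
  shows "in_tau a (\<tau>, \<theta>) * d_tau \<tau>0 (\<lambda>q. inverse (in_tau a q) * d_tau \<tau>0 (in_tau U) q) (\<tau>, \<theta>)
      - 1/2 * exp (2 * \<tau>) * exp (4 * in_tau U (\<tau>, \<theta>)) * (d_tau \<tau>0 (in_tau A) (\<tau>, \<theta>))\<^sup>2
    = (exp (- \<tau>))\<^sup>2 * (a (q \<theta>) * (dT a (q \<theta>) * dT U (q \<theta>) + a (q \<theta>) * dT (dT U) (q \<theta>)))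
      - 1/2 * (exp (4 * U (q \<theta>)) * (a (q \<theta>))\<^sup>2 * (dT A (q \<theta>))\<^sup>2)"
proof -
  let ?q = "(exp (- \<tau>), \<theta>)" and ?R = "exp (- \<tau>)"
  have W: "?q \<in> W" by (rule exp_slice_in_W[OF R0 \<tau>])
  have a: "a ?q > 0" by (rule W_pos(2)[OF W])
  note J = jets[unfolded jet2_def]
  have ja: "jet1 W (\<lambda>q. inverse (a q)) (\<lambda>q. - (inverse (a q) ^ Suc (Suc 0)) * dR a q) (\<lambda>q. - (inverse (a q) ^ Suc (Suc 0)) * dT a q)"
  proof (rule jet1_chain[where f = a and F = inverse and F' = "\<lambda>x. - (inverse x ^ Suc (Suc 0))"])
    show "jet1 W a (dR a) (dT a)" using J(3) by blast
    show "(inverse has_real_derivative - (inverse (a q) ^ Suc (Suc 0))) (at (a q))" if "q \<in> W" for q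
      using W_pos(2)[OF that] by (intro DERIV_inverse) simp
  qed
  have jU: "jet1 W (dR U) (dR (dR U)) (dT (dR U))" and jU0: "jet1 W U (dR U) (dT U)"
    and jA: "jet1 W A (dR A) (dT A)" using J by blast+
  note jm = jet1_mult[OF ja jet1_mult[OF jet1_mult[OF jet1_const[of W "-1"] jet1_fst] jU]]
  have "d_tau \<tau>0 (in_tau U) (s, t) = - exp (- s) * dR U (exp (- s), t)" if "\<tau>0 < s" for s t
    by (rule tau_derivatives(1)[OF R0 that jU0]) (simp add: in_tau_def)
  then have m: "d_tau \<tau>0 (\<lambda>q. inverse (in_tau a q) * d_tau \<tau>0 (in_tau U) q) (\<tau>, \<theta>)
      = - ?R * (- (inverse (a ?q) ^ Suc (Suc 0)) * dR a ?q * (- 1 * ?R * dR U ?q)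
          + inverse (a ?q) * (- dR U ?q + - 1 * ?R * dR (dR U) ?q))"
    by (subst tau_derivatives(1)[OF R0 \<tau> jm]) (simp_all add: in_tau_def)
  have dA: "d_tau \<tau>0 (in_tau A) (\<tau>, \<theta>) = - ?R * dR A ?q"
    by (rule tau_derivatives(1)[OF R0 \<tau> jA]) (simp add: in_tau_def)
  have e: "exp (2 * \<tau>) * (?R)\<^sup>2 = 1" by (simp add: power2_eq_square flip: exp_add)
  let ?e = "exp (4 * U ?q)"
  have src: "1/2 * exp (2 * \<tau>) * ?e * (- ?R * dR A ?q)\<^sup>2 = 1/2 * ?e * (dR A ?q)\<^sup>2"
  proof -
    have "1/2 * exp (2 * \<tau>) * ?e * (- ?R * dR A ?q)\<^sup>2 = 1/2 * ?e * (dR A ?q)\<^sup>2 * (exp (2 * \<tau>) * (?R)\<^sup>2)"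
      by (simp only: power_mult_distrib power2_minus mult_ac)
    then show ?thesis by (simp only: e mult_1_right)
  qed
  have alg: "\<alpha> * (- R * (- (inverse \<alpha> ^ Suc (Suc 0)) * a1 * (- 1 * R * U1) + inverse \<alpha> * (- U1 + - 1 * R * U11)))
      - 1/2 * e * A1\<^sup>2 = R\<^sup>2 * (\<alpha> * (a2 * U2 + \<alpha> * U22)) - 1/2 * (e * \<alpha>\<^sup>2 * A2\<^sup>2)"
    if "R * U11 + U1 - R * (a1 / \<alpha>) * U1 - R * \<alpha>\<^sup>2 * U22 - R * \<alpha> * a2 * U2
      - e / (2 * R) * (A1\<^sup>2 - \<alpha>\<^sup>2 * A2\<^sup>2) = 0" "R > 0" "\<alpha> > 0"
    for \<alpha> R a1 U1 U11 e A1 a2 U2 U22 A2 :: real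
  proof -
    have "\<alpha> * (- R * (- (inverse \<alpha> ^ Suc (Suc 0)) * a1 * (- 1 * R * U1) + inverse \<alpha> * (- U1 + - 1 * R * U11)))
      - 1/2 * e * A1\<^sup>2 - (R\<^sup>2 * (\<alpha> * (a2 * U2 + \<alpha> * U22)) - 1/2 * (e * \<alpha>\<^sup>2 * A2\<^sup>2))
      = R * (R * U11 + U1 - R * (a1 / \<alpha>) * U1 - R * \<alpha>\<^sup>2 * U22 - R * \<alpha> * a2 * U2
        - e / (2 * R) * (A1\<^sup>2 - \<alpha>\<^sup>2 * A2\<^sup>2))"
      using that(2,3) by (simp add: field_simps power2_eq_square)
    then show ?thesis by (simp only: that(1) mult_zero_right right_minus_eq)
  qed
  show ?thesis
    unfolding m dA q_def unfolding in_tau_def prod.case src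
    by (rule alg[OF einstein_equations(2)[OF W, unfolded fst_conv] exp_gt_zero a])
qed

lemma wave_operator_norm_le:
  assumes R0: "R0 = exp (- \<tau>0)" and \<tau>: "\<tau>0 < \<tau>"
  shows "Hm1_norm (\<lambda>\<theta>. in_tau a (\<tau>, \<theta>))
      (\<lambda>\<theta>. in_tau a (\<tau>, \<theta>) * d_tau \<tau>0 (\<lambda>q. inverse (in_tau a q) * d_tau \<tau>0 (in_tau U) q) (\<tau>, \<theta>)
        - 1/2 * exp (2 * \<tau>) * exp (4 * in_tau U (\<tau>, \<theta>)) * (d_tau \<tau>0 (in_tau A) (\<tau>, \<theta>))\<^sup>2)
    \<le> ennreal ((exp (- \<tau>))\<^sup>2 * sqrt (gradient (exp (- \<tau>))))
      + ennreal (1/2) * Hm1_norm (\<lambda>\<theta>. in_tau a (\<tau>, \<theta>))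
          (\<lambda>\<theta>. exp (4 * in_tau U (\<tau>, \<theta>)) * (in_tau a (\<tau>, \<theta>))\<^sup>2 * (d_theta \<tau>0 (in_tau A) (\<tau>, \<theta>))\<^sup>2)"
proof -
  let ?R = "exp (- \<tau>)"
  have W: "(?R, \<theta>) \<in> W" for \<theta> by (rule exp_slice_in_W[OF R0 \<tau>])
  have R: "?R \<in> {0<..<R0}" using R0 \<tau> by simp
  have dA: "d_theta \<tau>0 (in_tau A) (\<tau>, \<theta>) = dT A (?R, \<theta>)" for \<theta>
    by (rule tau_derivatives(2)[OF R0 \<tau>, of A "dR A"]) (use jets(4) in \<open>auto simp: jet2_def in_tau_def\<close>)
  let ?f = "\<lambda>\<theta>. a (?R, \<theta>) * dT U (?R, \<theta>)"
  let ?f' = "\<lambda>\<theta>. dT a (?R, \<theta>) * dT U (?R, \<theta>) + a (?R, \<theta>) * dT (dT U) (?R, \<theta>)"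
  let ?\<rho> = "\<lambda>\<theta>. exp (4 * U (?R, \<theta>)) * (a (?R, \<theta>))\<^sup>2 * (dT A (?R, \<theta>))\<^sup>2"
  note slices = continuous_metric[THEN continuous_slice[OF _ R]]
  have "Hm1_norm (\<lambda>\<theta>. a (?R, \<theta>)) (\<lambda>\<theta>. ?R\<^sup>2 * (a (?R, \<theta>) * ?f' \<theta>) - 1/2 * ?\<rho> \<theta>)
      \<le> ennreal (?R\<^sup>2 * sqrt (integral {0..2*pi} (\<lambda>\<theta>. (?f \<theta>)\<^sup>2 * inverse (a (?R, \<theta>)))))
        + ennreal (1/2) * Hm1_norm (\<lambda>\<theta>. a (?R, \<theta>)) ?\<rho>"
  proof (rule Hm1_norm_divergence_le)
    show "continuous_on {0..2*pi} (\<lambda>\<theta>. a (?R, \<theta>))" "continuous_on {0..2*pi} ?f'" "continuous_on {0..2*pi} ?\<rho>"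
      by (intro continuous_intros slices)+
    show "0 < a (?R, \<theta>)" for \<theta> by (rule W_pos(2)[OF W])
    show "(?f has_real_derivative ?f' \<theta>) (at \<theta>)" for \<theta>
      by (rule DERIV_cong[OF DERIV_mult[OF partials(4)[OF W smooth(3)] partials(6)[OF W smooth(2)]]])
        (simp only: mult.commute)
    show "?f (2*pi) = ?f 0"
      using periodic_derivatives(1)[OF smooth(3) W, of 0] periodic_derivatives(3)[OF smooth(2) W, of 0] by simp
  qed simp_all
  moreover have "integral {0..2*pi} (\<lambda>\<theta>. (?f \<theta>)\<^sup>2 * inverse (a (?R, \<theta>))) = gradient ?R"
    unfolding gradient_def
  proof (rule integral_cong)
    show "(?f \<theta>)\<^sup>2 * inverse (a (?R, \<theta>)) = a (?R, \<theta>) * (dT U (?R, \<theta>))\<^sup>2" for \<theta>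
      using W_pos(2)[OF W[of \<theta>]] by (simp add: power2_eq_square)
  qed
  ultimately show ?thesis
    unfolding wave_operator[OF R0 \<tau>] dA by (simp only: in_tau_def prod.case)
qed

end

section \<open>Comparison of the weighted time integrals\<close>

theorem theorem1p6:
  fixes \<eta> U a A G H :: "real \<times> real \<Rightarrow> real" and R0 \<tau>0 K :: real
  assumes R0: "R0 = exp (- \<tau>0)"
    and smooth: "smooth_periodic R0 \<eta>" "smooth_periodic R0 U" "smooth_periodic R0 a"
      "smooth_periodic R0 A" "smooth_periodic R0 G" "smooth_periodic R0 H"
    and a_pos: "\<And>q. q \<in> quot_dom R0 \<Longrightarrow> a q > 0"
    and vacuum: "ricci_flat_on (total_dom R0) (t2_metric \<eta> U a A G H)"
    and K_pos: "K > 0"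
    and twist: "\<And>q. q \<in> quot_dom R0 \<Longrightarrow>
      twist R0 \<eta> U a A G H q $ 1 = 0 \<and> twist R0 \<eta> U a A G H q $ 2 = K"
    and H_below: "\<exists>B. \<forall>\<^sub>F \<tau> in at_top. B \<le> (LINT \<theta>:{0..2*pi}|lborel. in_tau H (\<tau>, \<theta>))"
    and A_bound: "(\<integral>\<^sup>+\<tau>\<in>{\<tau>0..}. ennreal (exp (2 * \<tau>)) *
        (Hm1_norm (\<lambda>\<theta>. in_tau a (\<tau>, \<theta>))
          (\<lambda>\<theta>. exp (4 * in_tau U (\<tau>, \<theta>)) * (in_tau a (\<tau>, \<theta>))\<^sup>2
                * (d_theta \<tau>0 (in_tau A) (\<tau>, \<theta>))\<^sup>2))\<^sup>2 \<partial>lborel) < \<infinity>"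
  shows "(\<integral>\<^sup>+\<tau>\<in>{\<tau>0..}. ennreal (exp (2 * \<tau>)) *
        (Hm1_norm (\<lambda>\<theta>. in_tau a (\<tau>, \<theta>))
          (\<lambda>\<theta>. in_tau a (\<tau>, \<theta>)
                * d_tau \<tau>0 (\<lambda>q. inverse (in_tau a q) * d_tau \<tau>0 (in_tau U) q) (\<tau>, \<theta>)
              - 1/2 * exp (2 * \<tau>) * exp (4 * in_tau U (\<tau>, \<theta>))
                * (d_tau \<tau>0 (in_tau A) (\<tau>, \<theta>))\<^sup>2))\<^sup>2 \<partial>lborel) < \<infinity>"
proof -
  interpret t2_vacuum \<eta> U a A G H R0 K
    using R0 smooth a_pos vacuum K_pos twist by unfold_locales auto
  let ?NA = "\<lambda>\<tau>. Hm1_norm (\<lambda>\<theta>. in_tau a (\<tau>, \<theta>))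
    (\<lambda>\<theta>. exp (4 * in_tau U (\<tau>, \<theta>)) * (in_tau a (\<tau>, \<theta>))\<^sup>2 * (d_theta \<tau>0 (in_tau A) (\<tau>, \<theta>))\<^sup>2)"
  let ?NC = "\<lambda>\<tau>. Hm1_norm (\<lambda>\<theta>. in_tau a (\<tau>, \<theta>))
    (\<lambda>\<theta>. in_tau a (\<tau>, \<theta>) * d_tau \<tau>0 (\<lambda>q. inverse (in_tau a q) * d_tau \<tau>0 (in_tau U) q) (\<tau>, \<theta>)
      - 1/2 * exp (2 * \<tau>) * exp (4 * in_tau U (\<tau>, \<theta>)) * (d_tau \<tau>0 (in_tau A) (\<tau>, \<theta>))\<^sup>2)"
  let ?G = "\<lambda>\<tau>. exp (- 2 * \<tau>) * gradient (exp (- \<tau>))"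
  let ?ind = "\<lambda>\<tau>. indicator {\<tau>0<..} \<tau> :: ennreal"
  have R: "exp (- \<tau>) \<in> {0<..<R0}" if "\<tau>0 < \<tau>" for \<tau> using that R0 by simp
  have W: "(exp (- \<tau>), \<theta>) \<in> W" if "\<tau>0 < \<tau>" for \<tau> \<theta> by (rule exp_slice_in_W[OF R0 that])
  have lift: "continuous_on ({\<tau>0<..} \<times> UNIV) (\<lambda>q. f (exp (- fst q), snd q))"
    if "continuous_on W f" for f :: "real \<times> real \<Rightarrow> real"
    by (rule continuous_on_compose2[OF that]) (auto intro!: continuous_intros W)
  \<comment> \<open>Measurability is what allows the integral of the sum to be split below:
    \<open>nn_integral_add\<close> asks for it.\<close>
  have "(\<lambda>\<tau>. Hm1_norm (\<lambda>\<theta>. a (exp (- fst (\<tau>, \<theta>)), snd (\<tau>, \<theta>)))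
      (\<lambda>\<theta>. exp (4 * U (exp (- fst (\<tau>, \<theta>)), snd (\<tau>, \<theta>))) * (a (exp (- fst (\<tau>, \<theta>)), snd (\<tau>, \<theta>)))\<^sup>2
        * (dT A (exp (- fst (\<tau>, \<theta>)), snd (\<tau>, \<theta>)))\<^sup>2) * indicator {\<tau>0<..} \<tau>) \<in> borel_measurable borel"
    (is "?M \<in> _")
  proof (rule Hm1_norm_slices_measurable)
    show "a (exp (- fst (\<tau>, \<theta>)), snd (\<tau>, \<theta>)) > 0" if "\<tau>0 < \<tau>" for \<tau> \<theta>
      using W_pos(2)[OF W[OF that]] by simp
  qed (intro continuous_intros lift continuous_metric)+
  also have "?M = (\<lambda>\<tau>. ?NA \<tau> * ?ind \<tau>)"
  proof
    fix \<tau>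
    have "d_theta \<tau>0 (in_tau A) (\<tau>, \<theta>) = dT A (exp (- \<tau>), \<theta>)" if "\<tau>0 < \<tau>" for \<theta>
      by (rule tau_derivatives(2)[OF R0 that, of A "dR A"]) (use jets(4) in \<open>auto simp: jet2_def in_tau_def\<close>)
    then show "?M \<tau> = ?NA \<tau> * ?ind \<tau>"
      by (cases "\<tau>0 < \<tau>") (simp_all add: in_tau_def)
  qed
  finally have NA_meas: "(\<lambda>\<tau>. ennreal (exp (2 * \<tau>)) * (?NA \<tau> * ?ind \<tau>)\<^sup>2) \<in> borel_measurable lborel"
    by simp
  have "continuous_on {\<tau>0<..} ?G"
    unfolding gradient_def
    by (intro continuous_intros continuous_exp_slice[OF _ R0, of "\<lambda>q. a q * (dT U q)\<^sup>2"] continuous_metric)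
  then have "(\<lambda>\<tau>. ennreal (indicator {\<tau>0<..} \<tau> *\<^sub>R ?G \<tau>)) \<in> borel_measurable borel"
    by (intro measurable_compose[OF borel_measurable_continuous_on_indicator] measurable_ennreal) auto
  also have "(\<lambda>\<tau>. ennreal (indicator {\<tau>0<..} \<tau> *\<^sub>R ?G \<tau>)) = (\<lambda>\<tau>. ennreal (?G \<tau>) * ?ind \<tau>)"
    by (auto simp: indicator_def)
  finally have G_meas: "(\<lambda>\<tau>. ennreal (?G \<tau>) * ?ind \<tau>) \<in> borel_measurable lborel" by simp
  \<comment> \<open>The weights fit: \<open>e^(2 \<tau>) (e^(- 2 \<tau>))^2 = e^(- 2 \<tau>)\<close>
    is exactly the one in the finite dissipation integral, while \<open>4 (1/2)^2 = 1\<close>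
    reproduces the hypothesis on \<open>A\<close> with constant one.\<close>
  have pointwise: "ennreal (exp (2 * \<tau>)) * (?NC \<tau>)\<^sup>2 \<le> 4 * ennreal (?G \<tau>) + ennreal (exp (2 * \<tau>)) * (?NA \<tau>)\<^sup>2"
    if \<tau>: "\<tau>0 < \<tau>" for \<tau>
  proof -
    let ?R = "exp (- \<tau>)" and ?x = "ennreal ((exp (- \<tau>))\<^sup>2 * sqrt (gradient (exp (- \<tau>))))"
    have "(?NC \<tau>)\<^sup>2 \<le> (?x + ennreal (1/2) * ?NA \<tau>)\<^sup>2"
      by (intro power_mono wave_operator_norm_le[OF R0 \<tau>]) simp
    also have "\<dots> \<le> 4 * ?x\<^sup>2 + 4 * (ennreal (1/2) * ?NA \<tau>)\<^sup>2" by (rule ennreal_square_add_le)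
    also have "?x\<^sup>2 = ennreal (?R ^ 4 * gradient ?R)"
      using gradient_nonneg[OF R[OF \<tau>]] by (simp add: ennreal_power power_mult_distrib flip: power_mult)
    also have "4 * (ennreal (1/2) * ?NA \<tau>)\<^sup>2 = (?NA \<tau>)\<^sup>2"
    proof -
      have "(ennreal (1/2))\<^sup>2 = ennreal ((1/2)\<^sup>2)" by (rule ennreal_power) simp
      then have "4 * (ennreal (1/2))\<^sup>2 = ennreal 4 * ennreal ((1/2)\<^sup>2)"
        by (simp only: ennreal_numeral)
      also have "\<dots> = ennreal (4 * (1/2)\<^sup>2)" by (rule ennreal_mult[symmetric]) simp_all
      also have "4 * (1/2)\<^sup>2 = (1::real)" by (simp add: power2_eq_square)
      finally have four: "4 * (ennreal (1/2))\<^sup>2 = 1" by simp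
      have "4 * (ennreal (1/2) * ?NA \<tau>)\<^sup>2 = (4 * (ennreal (1/2))\<^sup>2) * (?NA \<tau>)\<^sup>2"
        by (simp only: power_mult_distrib mult.assoc)
      then show ?thesis by (simp only: four mult_1_left)
    qed
    finally have "ennreal (exp (2 * \<tau>)) * (?NC \<tau>)\<^sup>2
        \<le> ennreal (exp (2 * \<tau>)) * (4 * ennreal (?R ^ 4 * gradient ?R) + (?NA \<tau>)\<^sup>2)"
      by (intro mult_left_mono) simp_all
    also have "\<dots> = 4 * (ennreal (exp (2 * \<tau>)) * ennreal (?R ^ 4 * gradient ?R)) + ennreal (exp (2 * \<tau>)) * (?NA \<tau>)\<^sup>2"
      by (simp add: distrib_left mult_ac)
    also have "ennreal (exp (2 * \<tau>)) * ennreal (?R ^ 4 * gradient ?R) = ennreal (?G \<tau>)"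
    proof -
      have "exp (2 * \<tau>) * ?R ^ 4 = exp (- 2 * \<tau>)" by (simp flip: exp_of_nat_mult exp_add)
      then have "exp (2 * \<tau>) * (?R ^ 4 * gradient ?R) = ?G \<tau>" by (simp add: mult.assoc[symmetric])
      moreover have "ennreal (exp (2 * \<tau>)) * ennreal (?R ^ 4 * gradient ?R) = ennreal (exp (2 * \<tau>) * (?R ^ 4 * gradient ?R))"
        by (rule ennreal_mult'[symmetric]) simp
      ultimately show ?thesis by (simp only:)
    qed
    finally show ?thesis .
  qed
  have "(\<integral>\<^sup>+\<tau>\<in>{\<tau>0..}. ennreal (exp (2 * \<tau>)) * (?NC \<tau>)\<^sup>2 \<partial>lborel)
      \<le> (\<integral>\<^sup>+\<tau>. 4 * (ennreal (?G \<tau>) * ?ind \<tau>) + ennreal (exp (2 * \<tau>)) * (?NA \<tau> * ?ind \<tau>)\<^sup>2 \<partial>lborel)"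
  \<comment> \<open>The pointwise bound misses \<open>\<tau> = \<tau>0\<close>, a null set.\<close>
  proof (rule nn_integral_mono_AE)
    show "AE \<tau> in lborel. ennreal (exp (2 * \<tau>)) * (?NC \<tau>)\<^sup>2 * indicator {\<tau>0..} \<tau>
      \<le> 4 * (ennreal (?G \<tau>) * ?ind \<tau>) + ennreal (exp (2 * \<tau>)) * (?NA \<tau> * ?ind \<tau>)\<^sup>2"
      using AE_lborel_singleton[of \<tau>0]
    proof eventually_elim
      case (elim \<tau>)
      show ?case
      proof (cases "\<tau>0 < \<tau>")
        case True
        then show ?thesis using pointwise[OF True] by simp
      qed (use elim in simp)
    qed
  qed
  also have "\<dots> = 4 * (\<integral>\<^sup>+\<tau>. ennreal (?G \<tau>) * ?ind \<tau> \<partial>lborel)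
      + (\<integral>\<^sup>+\<tau>. ennreal (exp (2 * \<tau>)) * (?NA \<tau> * ?ind \<tau>)\<^sup>2 \<partial>lborel)"
    using G_meas NA_meas by (simp add: nn_integral_add nn_integral_cmult)
  also have "\<dots> < \<infinity>"
  proof -
    have "(\<integral>\<^sup>+\<tau>. ennreal (exp (2 * \<tau>)) * (?NA \<tau> * ?ind \<tau>)\<^sup>2 \<partial>lborel)
        \<le> (\<integral>\<^sup>+\<tau>\<in>{\<tau>0..}. ennreal (exp (2 * \<tau>)) * (?NA \<tau>)\<^sup>2 \<partial>lborel)"
      by (intro nn_integral_mono) (auto simp: indicator_def)
    then have "(\<integral>\<^sup>+\<tau>. ennreal (exp (2 * \<tau>)) * (?NA \<tau> * ?ind \<tau>)\<^sup>2 \<partial>lborel) < \<infinity>"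
      using A_bound by (rule order.strict_trans1)
    then show ?thesis
      using gradient_integrable[OF R0 H_below] by (simp add: ennreal_mult_less_top)
  qed
  finally show ?thesis .
qed

end
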